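(* Let $\{f_k\}$ be a sequence, with $k\to\infty$, of cusp forms for $SL_2(\mathbb{Z})$, $f_k$ of weight $k$, normalized by $\langle f_k,f_k\rangle=1$, such that $\nu(f_k)\sim k/12$. Assume there is a constant $c>0$ such that $y^k|f_k(z)|^2\,dV(z)\to c\,dV(z)$ weakly, i.e. for every compactly supported continuous function $G$ on $\Gamma\backslash\mathbb{H}$, $\int_{\Gamma\backslash\mathbb{H}}G(z)y^k|f_k(z)|^2dV(z)\to c\int_{\Gamma\backslash\mathbb{H}}G(z)\,dV(z)$. Then the zeros of $f_k$ are equidistributed with respect to $dV$: for every $F\in C_c^\infty(\Gamma\backslash\mathbb{H})$, $$\frac{1}{\nu(f_k)}\sum_{j}w(z_j)F(z_j)\;\longrightarrow\;\int_{\Gamma\backslash\mathbb{H}}F(z)\,dV(z)\qquad(k\to\infty),$$ where $z_j$ runs over the $\Gamma$-inequivalent zeros of $f_k$ in $\mathbb{H}$, counted with multiplicity.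
   Context: $\mathbb{H}$ is the upper half-plane, $z=x+iy$, $\Gamma=SL_2(\mathbb{Z})/\{\pm I\}$. A cusp form of weight $k$ for $SL_2(\mathbb{Z})$ is a holomorphic $f$ on $\mathbb{H}$ with $f(\frac{az+b}{cz+d})=(cz+d)^kf(z)$ for all $\begin{pmatrix}a&b\\c&d\end{pmatrix}\in SL_2(\mathbb{Z})$, whose expansion in $q=e^{2\pi iz}$ is holomorphic at $q=0$ and vanishes there. The Petersson inner product is $\langle f,g\rangle=\int_{SL_2(\mathbb{Z})\backslash\mathbb{H}}f(z)\overline{g(z)}y^k\frac{dx\,dy}{y^2}$. $dV(z)=\frac{1}{\operatorname{vol}(\Gamma\backslash\mathbb{H})}\frac{dx\,dy}{y^2}$ is the normalized hyperbolic measure. $w(z)=1/\#\Gamma_z$ with $\Gamma_z$ the stabilizer of $z$ in $\Gamma$, and $\nu(f)=\sum_{z\in\Gamma\backslash\mathbb{H}}w(z)\operatorname{ord}_z(f)$. *)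

theory Defs
  imports "HOL-Complex_Analysis.Complex_Analysis" "HOL-Library.Landau_Symbols"
begin

definition upper_half_plane :: "complex set" where
  "upper_half_plane = {z. Im z > 0}"

definition SL2Z :: "(int^2^2) set" where
  "SL2Z = {A. det A = 1}"

definition SL2Z_act :: "int^2^2 \<Rightarrow> complex \<Rightarrow> complex" where
  "SL2Z_act A = moebius (of_int (A$1$1)) (of_int (A$1$2)) (of_int (A$2$1)) (of_int (A$2$2))"

text \<open>\<open>PSL2Z\<close> is $\Gamma = SL_2(Z)/\{\pm I\}$, as a set of cosets $\{A, -A\}$; both members of a coset
  act in the same way.\<close>

definition PSL2Z :: "(int^2^2) set set" where
  "PSL2Z = SL2Z // {(A, B). A \<in> SL2Z \<and> (B = A \<or> B = - A)}"

definition PSL2Z_stabilizer :: "complex \<Rightarrow> (int^2^2) set set" where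
  "PSL2Z_stabilizer z = {C \<in> PSL2Z. \<forall>A\<in>C. SL2Z_act A z = z}"

definition stabilizer_weight :: "complex \<Rightarrow> real" where
  "stabilizer_weight z = 1 / real (card (PSL2Z_stabilizer z))"


subsection \<open>The quotient of the upper half-plane\<close>

definition modular_orbit :: "complex \<Rightarrow> complex set" where
  "modular_orbit z = (\<lambda>A. SL2Z_act A z) ` SL2Z"

definition modular_surface :: "complex set set" where
  "modular_surface = modular_orbit ` upper_half_plane"

definition orbit_rep :: "complex set \<Rightarrow> complex" where
  "orbit_rep p = (SOME z. z \<in> p)"

definition modular_topology :: "complex set topology" where
  "modular_topology = topology (\<lambda>U. U \<subseteq> modular_surface \<and>
     openin (top_of_set upper_half_plane) {z \<in> upper_half_plane. modular_orbit z \<in> U})"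

lemma openin_modular_topology:
  "openin modular_topology U \<longleftrightarrow> U \<subseteq> modular_surface \<and>
     openin (top_of_set upper_half_plane) {z \<in> upper_half_plane. modular_orbit z \<in> U}"
proof -
  let ?X = "top_of_set upper_half_plane"
  let ?P = "\<lambda>U. U \<subseteq> modular_surface \<and>
     openin ?X {z \<in> upper_half_plane. modular_orbit z \<in> U}"
  have "istopology ?P"
    unfolding istopology_def
  proof (intro conjI allI impI)
    fix S T assume "?P S" "?P T"
    moreover have "{z \<in> upper_half_plane. modular_orbit z \<in> S \<inter> T} =
        {z \<in> upper_half_plane. modular_orbit z \<in> S} \<inter> {z \<in> upper_half_plane. modular_orbit z \<in> T}"
      by blast
    ultimately show "S \<inter> T \<subseteq> modular_surface"
      and "openin ?X {z \<in> upper_half_plane. modular_orbit z \<in> S \<inter> T}"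
      by (blast, simp only: openin_Int)
  next
    fix \<K> assume K: "\<forall>K\<in>\<K>. ?P K"
    then show "\<Union>\<K> \<subseteq> modular_surface" by blast
    have eq: "{z \<in> upper_half_plane. modular_orbit z \<in> \<Union>\<K>} =
        \<Union>((\<lambda>K. {z \<in> upper_half_plane. modular_orbit z \<in> K}) ` \<K>)"
      by blast
    show "openin ?X {z \<in> upper_half_plane. modular_orbit z \<in> \<Union>\<K>}"
      unfolding eq using K by (intro openin_Union) blast
  qed
  then show ?thesis
    by (simp add: modular_topology_def topology_inverse')
qed

lemma topspace_modular_topology [simp]: "topspace modular_topology = modular_surface"
proof
  show "topspace modular_topology \<subseteq> modular_surface"
    using openin_modular_topology openin_topspace by blast
  have "{z \<in> upper_half_plane. modular_orbit z \<in> modular_surface} = upper_half_plane"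
    by (auto simp: modular_surface_def)
  then have "openin modular_topology modular_surface"
    by (simp add: openin_modular_topology)
  then show "modular_surface \<subseteq> topspace modular_topology"
    by (rule openin_subset)
qed

lemma quotient_map_modular_orbit:
  "quotient_map (top_of_set upper_half_plane) modular_topology modular_orbit"
  by (auto simp: quotient_map_def openin_modular_topology modular_surface_def)

definition compactly_supported :: "(complex set \<Rightarrow> complex) \<Rightarrow> bool" where
  "compactly_supported G \<longleftrightarrow>
     compactin modular_topology (modular_topology closure_of {p \<in> modular_surface. G p \<noteq> 0})"

fun higher_differentiable_on ::
    "'a::real_normed_vector set \<Rightarrow> ('a \<Rightarrow> 'b::real_normed_vector) \<Rightarrow> nat \<Rightarrow> bool" where
  "higher_differentiable_on S f 0 \<longleftrightarrow> continuous_on S f"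
| "higher_differentiable_on S f (Suc n) \<longleftrightarrow>
     (\<forall>x\<in>S. f differentiable (at x)) \<and>
     (\<forall>v. higher_differentiable_on S (\<lambda>x. frechet_derivative f (at x) v) n)"

definition Cc_modular :: "(complex set \<Rightarrow> complex) set" where
  "Cc_modular = {G. continuous_map modular_topology euclidean G \<and> compactly_supported G}"

text \<open>The quotient has orbifold points; smoothness of a function on it means smoothness (in the two
  real variables) of its lift to the upper half-plane.\<close>

definition Cc_smooth_modular :: "(complex set \<Rightarrow> complex) set" where
  "Cc_smooth_modular =
     {F. (\<forall>n. higher_differentiable_on upper_half_plane (\<lambda>z. F (modular_orbit z)) n) \<and>
         compactly_supported F}"


subsection \<open>Integration over the quotient\<close>

definition hyperbolic_measure :: "complex measure" where
  "hyperbolic_measure =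
     density lborel (\<lambda>z. indicator upper_half_plane z * ennreal (1 / (Im z)\<^sup>2))"

text \<open>Integrals over the quotient are integrals of lifts over the standard fundamental domain. It
  is taken closed: the boundary identifications only concern a null set.\<close>

definition fundamental_domain :: "complex set" where
  "fundamental_domain = {z \<in> upper_half_plane. \<bar>Re z\<bar> \<le> 1/2 \<and> 1 \<le> cmod z}"

text \<open>The restriction makes the values of an integrand outside the fundamental domain irrelevant, also
  for measurability: functions here are unconstrained off the upper half-plane.\<close>

definition modular_measure :: "complex measure" where
  "modular_measure =
     restrict_space (uniform_measure hyperbolic_measure fundamental_domain) fundamental_domain"


subsection \<open>Cusp forms\<close>

definition cusp_form :: "nat \<Rightarrow> (complex \<Rightarrow> complex) \<Rightarrow> bool" where
  "cusp_form k f \<longleftrightarrow>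
     f holomorphic_on upper_half_plane \<and>
     (\<forall>A\<in>SL2Z. \<forall>z\<in>upper_half_plane.
        f (SL2Z_act A z) = (of_int (A$2$1) * z + of_int (A$2$2)) ^ k * f z) \<and>
     (\<exists>g. g holomorphic_on ball 0 1 \<and> g 0 = 0 \<and>
        (\<forall>z\<in>upper_half_plane. f z = g (exp (2 * of_real pi * \<i> * z))))"

definition petersson :: "nat \<Rightarrow> (complex \<Rightarrow> complex) \<Rightarrow> (complex \<Rightarrow> complex) \<Rightarrow> complex" where
  "petersson k f g =
     (LINT z:fundamental_domain|hyperbolic_measure. f z * cnj (g z) * of_real (Im z ^ k))"

definition zero_count :: "(complex \<Rightarrow> complex) \<Rightarrow> real" where
  "zero_count f =
     (\<Sum>\<^sub>\<infinity>p\<in>modular_surface. stabilizer_weight (orbit_rep p) * of_int (zorder f (orbit_rep p)))"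

definition zero_orbits :: "(complex \<Rightarrow> complex) \<Rightarrow> complex set set" where
  "zero_orbits f = {p \<in> modular_surface. f (orbit_rep p) = 0}"

end

(*
  Write y^k |f_k|^2 = exp (k h_k). The function ln |f_k| is subharmonic and its Laplacian is
  2 pi times the zero divisor, so that of h_k is (4 pi / k) times the zero divisor minus 1 / y^2;
  it suffices to show h_k -> 0 in L^1_loc. The sub-mean value property of |f_k|^2 turns bounded
  mass into y^k |f_k|^2 = O(k^2), so limsup h_k <= 0 locally uniformly. Conversely every disc of
  radius s contains a point where y^k |f_k|^2 >= c/2; the sub-mean value property of ln |f_k| at
  that point bounds the integral of |h_k| over the disc by O(s^4) for large k, and about s^(-2)
  discs cover a compact set. Zeros are counted with Jensen's formula for the radial kernel
  (R^2 - |z|^2)_+^2, whose integral over a disc involves h_k only through its L^1 norm, and R -> 0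
  recovers all continuous test functions; smoothness of F plays no role. Unfolding along SL_2(Z)
  transports everything between the upper half-plane and the quotient, where vol = pi/3 matches
  the normalization nu(f_k) ~ k/12.
*)

theory Submission
  imports Defs "HOL-Real_Asymp.Real_Asymp"
begin

text \<open>Weak convergence of exp(k h) says little about h where the density is tiny, yet counting
  zeros needs h itself: the danger is a deep trough of h on a small set. Subharmonicity of ln |f|
  excludes it, since one good point controls the average around it. What is lost is only the failure
  of ln y to be harmonic, an error s^2 over an area s^2. The value of c is washed out, as ln(c/2)/k
  tends to 0. Distributions and Green's formula are avoided: writing f on a disc as exp(g) times
  linear factors reduces every identity to the circle averages of ln |z - w|, which are found by
  averaging over roots of unity. The order of limits matters: at fixed R the L^1 norm of h tends to
  0 as k grows; only afterwards does R -> 0 remove the Taylor error R^7 against the kernel mass R^6.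
  On the quotient, a sum over SL_2(Z) meets each point of an orbit 2 #stabilizer times. This cancels
  the weights w(z) and leaves the factor 2, from A and -A, that turns 12 / (4 pi) into 6 / pi = 2 *
  (3 / pi), the constant of the unfolded integral.\<close>

no_notation fps_nth (infixl "$" 75)

subsection \<open>Lebesgue measure on the complex plane\<close>

text \<open>The change of variables theorem used below speaks about \<open>real^'n\<close> and the
  determinant of the derivative; this identification, with its inverse, transports it to
  \<open>complex\<close>.\<close>

definition complex_of_vec :: "real^2 \<Rightarrow> complex" where
  "complex_of_vec v = Complex (v $ 1) (v $ 2)"

definition vec_of_complex :: "complex \<Rightarrow> real^2" where
  "vec_of_complex z = vector [Re z, Im z]"

lemma complex_of_vec_of_complex [simp]: "complex_of_vec (vec_of_complex z) = z"
  by (simp add: complex_of_vec_def vec_of_complex_def)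

lemma vec_of_complex_of_vec [simp]: "vec_of_complex (complex_of_vec v) = v"
  by (simp add: complex_of_vec_def vec_of_complex_def vec_eq_iff forall_2)

lemma linear_complex_of_vec: "linear complex_of_vec"
  by (rule linearI) (auto simp: complex_of_vec_def complex_eq_iff)

lemma linear_vec_of_complex: "linear vec_of_complex"
  by (rule linearI) (auto simp: vec_of_complex_def vec_eq_iff forall_2)

lemma borel_measurable_complex_of_vec [measurable]: "complex_of_vec \<in> borel_measurable borel"
  by (intro borel_measurable_continuous_onI linear_continuous_on linear_complex_of_vec[unfolded linear_conv_bounded_linear])

lemma lborel_complex_eq_distr_vec: "(lborel :: complex measure) = distr lborel borel complex_of_vec"
proof (rule lborel_eqI)
  fix l u :: complex
  assume le: "\<And>b. b \<in> Basis \<Longrightarrow> l \<bullet> b \<le> u \<bullet> b"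
  have "Re l \<le> Re u" "Im l \<le> Im u"
    using le[of 1] le[of \<i>] by (auto simp: Basis_complex_def)
  have vim: "complex_of_vec -` box l u = box (vec_of_complex l) (vec_of_complex u)"
    by (auto simp: in_box_complex_iff complex_of_vec_def vec_of_complex_def mem_box_cart forall_2)
  have "emeasure lborel (box (vec_of_complex l) (vec_of_complex u))
      = (\<Prod>b\<in>Basis. (vec_of_complex u - vec_of_complex l) \<bullet> b)"
    by (rule emeasure_lborel_box)
      (use \<open>Re l \<le> Re u\<close> \<open>Im l \<le> Im u\<close> in \<open>auto simp: Basis_vec_def inner_axis vec_of_complex_def UNIV_2\<close>)
  also have "(\<Prod>b\<in>Basis. (vec_of_complex u - vec_of_complex l) \<bullet> b) = (Re u - Re l) * (Im u - Im l)"
  proof -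
    have "(Basis :: (real^2) set) = (\<lambda>i. axis i 1) ` UNIV"
      by (auto simp: Basis_vec_def)
    also have "\<dots> = {axis 1 1, axis 2 1}" by (auto simp: UNIV_2)
    finally have B: "(Basis :: (real^2) set) = {axis 1 1, axis 2 1}" .
    have "axis 1 1 \<noteq> (axis 2 1 :: real^2)" by (simp add: axis_eq_axis)
    then show ?thesis
      by (simp add: B inner_axis vec_of_complex_def)
  qed
  also have "\<dots> = (\<Prod>b\<in>Basis. (u - l) \<bullet> b)"
    by (simp add: Basis_complex_def)
  finally show "emeasure (distr lborel borel complex_of_vec) (box l u) = ennreal (\<Prod>b\<in>Basis. (u - l) \<bullet> b)"
    by (simp add: emeasure_distr vim)
qed simp

text \<open>Multiplication by \<open>c\<close> = p + iq is the matrix with rows (p, -q) and (q, p),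
  of determinant p^2 + q^2. Thus the Jacobian of a holomorphic map is the squared modulus of its
  derivative.\<close>

lemma det_matrix_complex_mult:
  "det (matrix (\<lambda>v. vec_of_complex (c * complex_of_vec v))) = (cmod c)\<^sup>2"
  by (simp add: det_2 matrix_def vec_of_complex_def complex_of_vec_def axis_def cmod_power2) (simp add: power2_eq_square)

text \<open>Change of variables for an injective holomorphic map, kept in \<open>emeasure\<close>
  form so that sets of infinite area are covered and the result can be read as an equality of
  measures.\<close>

lemma emeasure_holomorphic_preimage:
  fixes g g' :: "complex \<Rightarrow> complex"
  assumes S: "S \<in> sets borel" and inj: "inj_on g S"
    and der: "\<And>z. z \<in> S \<Longrightarrow> (g has_field_derivative g' z) (at z)"
    and g': "g' \<in> borel_measurable borel" and g: "g \<in> borel_measurable borel"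
    and B: "B \<in> sets borel" "B \<subseteq> g ` S"
  shows "emeasure lborel B = (\<integral>\<^sup>+z. indicator (S \<inter> g -` B) z * ennreal ((cmod (g' z))\<^sup>2) \<partial>lborel)"
proof -
  note [measurable] = S g g' B(1)
  define A where "A = S \<inter> g -` B"
  have "g -` B \<in> sets borel"
    using measurable_sets[OF g B(1)] by simp
  then have A [measurable]: "A \<in> sets borel"
    unfolding A_def using S by blast
  define A' where "A' = complex_of_vec -` A"
  have A' [measurable]: "A' \<in> sets borel"
    using measurable_sets[OF borel_measurable_complex_of_vec A] by (simp add: A'_def)
  define B' where "B' = complex_of_vec -` B"
  have B' [measurable]: "B' \<in> sets borel"
    using measurable_sets[OF borel_measurable_complex_of_vec B(1)] by (simp add: B'_def)
  define G where "G = (\<lambda>v. vec_of_complex (g (complex_of_vec v)))"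
  define G' where "G' = (\<lambda>v h. vec_of_complex (g' (complex_of_vec v) * complex_of_vec h))"
  define D where "D = (\<lambda>v. (cmod (g' (complex_of_vec v)))\<^sup>2)"
  have GA: "G ` A' = B'"
  proof -
    have "w \<in> G ` A'" if "w \<in> B'" for w
    proof -
      from that obtain z where z: "z \<in> S" "complex_of_vec w = g z" "g z \<in> B"
        using B(2) unfolding B'_def by auto
      then have "w = G (vec_of_complex z)" "vec_of_complex z \<in> A'"
        by (auto simp: G_def A'_def A_def) (metis vec_of_complex_of_vec)
      then show ?thesis by blast
    qed
    then show ?thesis by (auto simp: G_def A'_def A_def B'_def)
  qed
  have injG: "inj_on G A'"
  proof (rule inj_onI)
    fix x y assume *: "x \<in> A'" "y \<in> A'" "G x = G y"
    then have "g (complex_of_vec x) = g (complex_of_vec y)"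
      unfolding G_def by (metis complex_of_vec_of_complex)
    with * inj have "complex_of_vec x = complex_of_vec y"
      by (auto simp: inj_on_def A'_def A_def)
    then show "x = y" by (metis vec_of_complex_of_vec)
  qed
  have derG: "(G has_derivative G' v) (at v within A')" if "v \<in> A'" for v
  proof -
    have 1: "(complex_of_vec has_derivative complex_of_vec) (at v within A')"
      by (intro linear_imp_has_derivative linear_complex_of_vec)
    have "(g has_derivative (*) (g' (complex_of_vec v))) (at (complex_of_vec v))"
      using der[of "complex_of_vec v"] that by (simp add: has_field_derivative_def A'_def A_def)
    from diff_chain_within[OF 1 has_derivative_at_withinI[OF this]]
    have 2: "((\<lambda>x. g (complex_of_vec x)) has_derivative (\<lambda>h. g' (complex_of_vec v) * complex_of_vec h)) (at v within A')"
      by (simp add: o_def)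
    have 3: "(vec_of_complex has_derivative vec_of_complex) (at (g (complex_of_vec v)) within (\<lambda>x. g (complex_of_vec x)) ` A')"
      by (intro linear_imp_has_derivative linear_vec_of_complex)
    from diff_chain_within[OF 2 3] show ?thesis
      by (simp add: o_def G_def G'_def)
  qed
  \<comment> \<open>The equivalence serves in both directions: left to right it evaluates the
    integral when the area is finite; right to left it shows that a finite integral forces finite
    area.\<close>
  have key: "B' \<in> lmeasurable \<and> measure lebesgue B' = m \<longleftrightarrow> (D has_integral m) A'" for m
    using has_measure_differentiable_image[of A' G G' m] derG injG GA A'
    by (simp add: D_def G'_def det_matrix_complex_mult)
  have Dm [measurable]: "D \<in> borel_measurable borel"
    unfolding D_def by measurable
  have "emeasure lborel B = emeasure lborel B'"
    by (subst lborel_complex_eq_distr_vec) (simp add: emeasure_distr B'_def)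
  also have "\<dots> = (\<integral>\<^sup>+v. ennreal (D v) * indicator A' v \<partial>lborel)"
  proof (cases "emeasure lborel B' < \<infinity>")
    case True
    then have Bl: "B' \<in> lmeasurable"
      by (intro fmeasurableI) auto
    then have "(D has_integral (measure lebesgue B')) A'"
      using key by blast
    from nn_integral_has_integral_lebesgue[OF _ this]
    have "(\<integral>\<^sup>+v. ennreal (indicator A' v * D v) \<partial>lborel) = ennreal (measure lebesgue B')"
      by (auto simp: D_def)
    moreover have "(\<integral>\<^sup>+v. ennreal (D v) * indicator A' v \<partial>lborel) = (\<integral>\<^sup>+v. ennreal (indicator A' v * D v) \<partial>lborel)"
      by (intro nn_integral_cong) (auto simp: indicator_def)
    ultimately have "(\<integral>\<^sup>+v. ennreal (D v) * indicator A' v \<partial>lborel) = ennreal (measure lebesgue B')"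
      by simp
    also have "\<dots> = emeasure lborel B'"
      using Bl emeasure_eq_measure2[of B' lebesgue] by simp
    finally show ?thesis by simp
  next
    case False
    have "\<not> (\<integral>\<^sup>+v. ennreal (D v) * indicator A' v \<partial>lborel) < \<infinity>"
    proof
      assume fin: "(\<integral>\<^sup>+v. ennreal (D v) * indicator A' v \<partial>lborel) < \<infinity>"
      have eq: "(\<integral>\<^sup>+v. ennreal (D v) * indicator A' v \<partial>lborel) = (\<integral>\<^sup>+v. ennreal (indicator A' v * D v) \<partial>lborel)"
        by (intro nn_integral_cong) (auto simp: indicator_def)
      obtain r where r: "r \<ge> 0" "(\<integral>\<^sup>+v. ennreal (indicator A' v * D v) \<partial>lborel) = ennreal r"
        using fin unfolding eq by (metis ennreal_cases less_irrefl infinity_ennreal_def)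
      then have "((\<lambda>v. indicator A' v * D v) has_integral r) UNIV"
        by (intro nn_integral_has_integral) (auto simp: D_def)
      then have "(D has_integral r) A'"
        using has_integral_restrict_UNIV[of A' D r] by (simp add: indicator_times_eq_if)
      then have "B' \<in> lmeasurable" using key by blast
      then show False using False by (auto simp: fmeasurable_def)
    qed
    with False show ?thesis by (metis infinity_ennreal_def top.not_eq_extremum)
  qed
  also have "\<dots> = (\<integral>\<^sup>+z. indicator (S \<inter> g -` B) z * ennreal ((cmod (g' z))\<^sup>2) \<partial>lborel)"
    unfolding A_def[symmetric]
    by (subst lborel_complex_eq_distr_vec, subst nn_integral_distr)
      (auto simp: D_def A'_def indicator_def intro!: nn_integral_cong)
  finally show ?thesis .
qed

section \<open>Invariance of area and polar coordinates\<close>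

lemma lborel_distr_rotation:
  fixes c :: complex
  assumes "cmod c = 1"
  shows "distr lborel borel ((*) c) = (lborel :: complex measure)"
proof (rule measure_eqI)
  fix B :: "complex set" assume "B \<in> sets (distr lborel borel ((*) c))"
  then have B: "B \<in> sets borel" by simp
  have c0: "c \<noteq> 0" using assms by auto
  have inj: "inj_on ((*) c) UNIV" using c0 by (auto simp: inj_on_def)
  have surj: "B \<subseteq> (*) c ` UNIV"
    using c0 by (auto intro!: image_eqI[where x="_ / c"])
  have der: "((*) c has_field_derivative c) (at z)" for z
    by (auto intro!: derivative_eq_intros)
  have "emeasure lborel B = (\<integral>\<^sup>+z. indicator (UNIV \<inter> (*) c -` B) z * ennreal ((cmod c)\<^sup>2) \<partial>lborel)"
    by (rule emeasure_holomorphic_preimage[OF _ inj der _ _ B surj]) auto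
  also have "\<dots> = emeasure lborel ((*) c -` B)"
    using assms measurable_sets[of "(*) c" borel borel B] B by simp
  finally show "emeasure (distr lborel borel ((*) c)) B = emeasure lborel B"
    using B by (simp add: emeasure_distr)
qed simp

lemma integrable_lborel_rotation:
  fixes f :: "complex \<Rightarrow> 'b::{banach, second_countable_topology}"
  assumes "cmod c = 1" "integrable lborel f"
  shows "integrable lborel (\<lambda>z. f (c * z))"
    and "integral\<^sup>L lborel (\<lambda>z. f (c * z)) = integral\<^sup>L lborel f"
proof -
  have f: "f \<in> borel_measurable borel" using assms(2) by auto
  show "integrable lborel (\<lambda>z. f (c * z))"
    using assms(2) integrable_distr_eq[of "(*) c" lborel borel f] f lborel_distr_rotation[OF assms(1)] by simp
  show "integral\<^sup>L lborel (\<lambda>z. f (c * z)) = integral\<^sup>L lborel f"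
    using integral_distr[of "(*) c" lborel borel f] f lborel_distr_rotation[OF assms(1)] by simp
qed

lemma integrable_lborel_translation:
  fixes f :: "'a::euclidean_space \<Rightarrow> 'b::{banach, second_countable_topology}"
  assumes "integrable lborel f"
  shows "integrable lborel (\<lambda>z. f (a + z))"
    and "integral\<^sup>L lborel (\<lambda>z. f (a + z)) = integral\<^sup>L lborel f"
proof -
  have f: "f \<in> borel_measurable borel" using assms by auto
  show "integrable lborel (\<lambda>z. f (a + z))"
    using assms integrable_distr_eq[of "(+) a" lborel borel f] f lborel_distr_plus[of a] by simp
  show "integral\<^sup>L lborel (\<lambda>z. f (a + z)) = integral\<^sup>L lborel f"
    using integral_distr[of "(+) a" lborel borel f] f lborel_distr_plus[of a] by simp
qed

text \<open>The half-lines \<open>{..b}\<close> generate the Borel sets and pull back to closed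
  discs of area pi b^2, whose derivative 2 pi r is the density. Polar coordinates without the angle
  are all that radial weights need.\<close>

lemma distr_cmod_lborel:
  "distr lborel borel cmod = density lborel (\<lambda>r. ennreal (2 * pi * r) * indicator {0..} r)"
proof (rule measure_eqI_generator_eq[where E="range (\<lambda>b. {..b})" and \<Omega>=UNIV and A="\<lambda>n. {..real n}"])
  show "Int_stable (range (\<lambda>b::real. {..b}))"
    by (auto simp: Int_stable_def)
  show "sets (distr lborel borel cmod) = sigma_sets UNIV (range (\<lambda>b. {..b}))"
    and "sets (density lborel (\<lambda>r. ennreal (2 * pi * r) * indicator {0..} r)) = sigma_sets UNIV (range (\<lambda>b. {..b}))"
    by (simp_all add: borel_eq_atMost)
  show "(\<Union>n. {..real n}) = UNIV"
    using real_arch_simple by auto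
  have L: "emeasure (distr lborel borel cmod) {..b} = (if b < 0 then 0 else ennreal (pi * b\<^sup>2))" for b
  proof (cases "b < 0")
    case True
    then have "cmod -` {..b} = {}"
      by (auto simp: vimage_def) (smt (verit) norm_ge_zero)
    then show ?thesis using True by (simp add: emeasure_distr)
  next
    case False
    then have "cmod -` {..b} = cball 0 b"
      by (auto simp: dist_norm)
    then show ?thesis using False
      by (simp add: emeasure_distr emeasure_cball unit_ball_vol_2)
  qed
  show "emeasure (distr lborel borel cmod) {..real n} \<noteq> \<infinity>" for n
    by (simp add: L)
  fix X :: "real set" assume "X \<in> range (\<lambda>b. {..b})"
  then obtain b where X: "X = {..b}" by auto
  have "emeasure (density lborel (\<lambda>r. ennreal (2 * pi * r) * indicator {0..} r)) {..b} =
      (\<integral>\<^sup>+r. ennreal (2 * pi * r) * indicator {0..b} r \<partial>lborel)"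
    by (subst emeasure_density) (auto intro!: nn_integral_cong simp: indicator_def)
  also have "\<dots> = (if b < 0 then 0 else ennreal (pi * b\<^sup>2))"
  proof (cases "b < 0")
    case False
    have "(\<integral>\<^sup>+r. ennreal (2 * pi * r) * indicator {0..b} r \<partial>lborel) = ennreal (pi * b\<^sup>2 - pi * 0\<^sup>2)"
      using False by (intro nn_integral_FTC_Icc) (auto intro!: derivative_eq_intros)
    then show ?thesis using False by simp
  qed simp
  finally show "emeasure (distr lborel borel cmod) X = emeasure (density lborel (\<lambda>r. ennreal (2 * pi * r) * indicator {0..} r)) X"
    by (simp add: L X)
qed auto

lemma integrable_radial:
  fixes p :: "real \<Rightarrow> real"
  assumes [measurable]: "p \<in> borel_measurable borel"
  shows "integrable lborel (\<lambda>z::complex. p (cmod z)) \<longleftrightarrow> set_integrable lborel {0..} (\<lambda>r. 2 * pi * r * p r)"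
    and "(\<integral>z. p (cmod z) \<partial>(lborel :: complex measure)) = (LINT r:{0..}|lborel. 2 * pi * r * p r)"
proof -
  have eq: "(\<lambda>r. ennreal (2 * pi * r) * indicator {0..} r) = (\<lambda>r. ennreal (2 * pi * r * indicator {0..} r))"
    by (auto simp: indicator_def fun_eq_iff)
  have "integrable lborel (\<lambda>z::complex. p (cmod z)) \<longleftrightarrow> integrable (distr lborel borel cmod) p"
    by (subst integrable_distr_eq) auto
  also have "\<dots> \<longleftrightarrow> set_integrable lborel {0..} (\<lambda>r. 2 * pi * r * p r)"
    unfolding distr_cmod_lborel eq set_integrable_def
    by (subst integrable_density) (auto simp: indicator_def algebra_simps)
  finally show "integrable lborel (\<lambda>z::complex. p (cmod z)) \<longleftrightarrow> set_integrable lborel {0..} (\<lambda>r. 2 * pi * r * p r)" .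
  have "(\<integral>z. p (cmod z) \<partial>(lborel :: complex measure)) = integral\<^sup>L (distr lborel borel cmod) p"
    by (subst integral_distr) auto
  also have "\<dots> = (LINT r:{0..}|lborel. 2 * pi * r * p r)"
    unfolding distr_cmod_lborel eq set_lebesgue_integral_def
    by (subst integral_density) (auto simp: indicator_def algebra_simps intro!: Bochner_Integration.integral_cong)
  finally show "(\<integral>z. p (cmod z) \<partial>(lborel :: complex measure)) = (LINT r:{0..}|lborel. 2 * pi * r * p r)" .
qed

lemma set_integral_radial:
  fixes p :: "real \<Rightarrow> real"
  assumes p [measurable]: "p \<in> borel_measurable borel" and "R \<ge> 0"
  shows "set_integrable lborel (ball 0 R) (\<lambda>z::complex. p (cmod z)) \<longleftrightarrow> set_integrable lborel {0..<R} (\<lambda>r. 2 * pi * r * p r)"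
    and "(LINT z:ball 0 R|lborel. p (cmod (z::complex))) = (LINT r:{0..<R}|lborel. 2 * pi * r * p r)"
proof -
  have [measurable]: "(\<lambda>r. indicator {..<R} r * p r) \<in> borel_measurable borel" by measurable
  have 1: "(\<lambda>z::complex. indicat_real (ball 0 R) z *\<^sub>R p (cmod z)) = (\<lambda>z. indicator {..<R} (cmod z) * p (cmod z))"
    by (auto simp: indicator_def fun_eq_iff)
  have 2: "(\<lambda>r. indicat_real {0..} r *\<^sub>R (2 * pi * r * (indicator {..<R} r * p r))) = (\<lambda>r. indicator {0..<R} r *\<^sub>R (2 * pi * r * p r))"
    by (auto simp: indicator_def fun_eq_iff)
  note * = integrable_radial[of "\<lambda>r. indicator {..<R} r * p r", unfolded set_integrable_def set_lebesgue_integral_def 2]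
  show "set_integrable lborel (ball 0 R) (\<lambda>z::complex. p (cmod z)) \<longleftrightarrow> set_integrable lborel {0..<R} (\<lambda>r. 2 * pi * r * p r)"
    unfolding set_integrable_def 1 by (rule *(1)) measurable
  show "(LINT z:ball 0 R|lborel. p (cmod (z::complex))) = (LINT r:{0..<R}|lborel. 2 * pi * r * p r)"
    unfolding set_lebesgue_integral_def 1 by (rule *(2)) measurable
qed

section \<open>Integrability of logarithmic singularities\<close>

lemma set_integrable_ln_from_0: "set_integrable lborel {0..(b::real)} ln"
proof (cases "b \<ge> 0")
  case True
  have 1: "set_integrable lborel {0..b} (\<lambda>x. 2 * x powr (-1/2) + x)"
  proof -
    have "(\<lambda>x. 2 * x powr (-1/2) + x) integrable_on {0..b}"
      using True by (intro integrable_add integrable_on_mult_right integrable_on_powr_from_0 ident_integrable_on) auto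
    then have "(\<lambda>x. 2 * x powr (-1/2) + x) absolutely_integrable_on {0..b}"
      by (subst absolutely_integrable_on_iff_nonneg) auto
    then show ?thesis
      by (simp add: set_integrable_def integrable_completion)
  qed
  show ?thesis
    unfolding set_integrable_def
  proof (rule Bochner_Integration.integrable_bound[OF 1[unfolded set_integrable_def]])
    show "AE x in lborel. norm (indicat_real {0..b} x *\<^sub>R ln x) \<le> norm (indicat_real {0..b} x *\<^sub>R (2 * x powr (-1/2) + x))"
    proof (rule AE_I2)
      fix x :: real
      show "norm (indicat_real {0..b} x *\<^sub>R ln x) \<le> norm (indicat_real {0..b} x *\<^sub>R (2 * x powr (-1/2) + x))"
      proof (cases "x \<in> {0<..b}")
        case True
        then have x: "x > 0" by auto
        have "ln x \<le> x" using ln_le_minus_one[OF x] by simp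
        \<comment> \<open>This is ln u <= u - 1 at u = x^(-1/2); the exponent -1/2 is integrable at
          0.\<close>
        moreover have "- ln x \<le> 2 * x powr (-1/2)"
          using ln_le_minus_one[of "x powr (-1/2)"] x by (simp add: ln_powr)
        moreover have "x powr (-1/2) \<ge> 0" by simp
        ultimately have "\<bar>ln x\<bar> \<le> 2 * x powr (-1/2) + x"
          using x by (smt (verit))
        then show ?thesis by (auto simp: indicator_def)
      qed (auto simp: indicator_def)
    qed
  qed measurable
qed simp

lemma set_integrable_ln_abs_diff:
  "set_integrable lborel {a..b} (\<lambda>x. ln \<bar>x - r :: real\<bar>)"
proof -
  \<comment> \<open>\<open>B\<close> bounds |x - r| on the interval, so that one of the two shifted
    copies of ln on \<open>{0..B}\<close> equals ln |x - r| and the other vanishes.\<close>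
  define B where "B = max \<bar>a - r\<bar> \<bar>b - r\<bar>"
  have 1: "integrable lborel (\<lambda>x. indicat_real {0..B} x *\<^sub>R ln x)"
    using set_integrable_ln_from_0 by (simp add: set_integrable_def)
  have 2: "integrable lborel (\<lambda>x. indicat_real {0..B} (x - r) *\<^sub>R ln (x - r))"
    using lborel_integrable_real_affine[OF 1, of 1 "-r"] by simp
  have 3: "integrable lborel (\<lambda>x. indicat_real {0..B} (r - x) *\<^sub>R ln (r - x))"
    using lborel_integrable_real_affine[OF 1, of "-1" "r"] by simp
  have 4: "set_integrable lborel {a..b} (\<lambda>x. indicat_real {0..B} (x - r) *\<^sub>R ln (x - r) + indicat_real {0..B} (r - x) *\<^sub>R ln (r - x))"
    unfolding set_integrable_def
    by (rule integrable_mult_indicator[OF _ Bochner_Integration.integrable_add[OF 2 3]]) simp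
  show ?thesis
    using 4 by (rule set_integrable_cong[THEN iffD1, rotated -1]) (auto simp: indicator_def B_def)
qed

text \<open>Here the singularity fills the circle |z| = r. In polar coordinates it is the
  one-dimensional ln |x - r|, and the Jacobian factor x is bounded by R. This serves as a majorant
  in the averaging argument below.\<close>

lemma set_integrable_radial_ln:
  "set_integrable lborel (ball 0 R) (\<lambda>z::complex. ln \<bar>cmod z - r\<bar>)"
proof (cases "R \<ge> 0")
  case True
  have "set_integrable lborel {0..<R} (\<lambda>x. 2 * pi * x * ln \<bar>x - r\<bar>)"
    unfolding set_integrable_def
  proof (rule Bochner_Integration.integrable_bound)
    show "integrable lborel (\<lambda>x. indicat_real {0..R} x *\<^sub>R (2 * pi * R * ln \<bar>x - r\<bar>))"
      using set_integrable_mult_right[of "2 * pi * R" lborel "{0..R}" "\<lambda>x. ln \<bar>x - r\<bar>"] set_integrable_ln_abs_diff[of 0 R r]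
      by (simp add: set_integrable_def)
    show "AE x in lborel. norm (indicat_real {0..<R} x *\<^sub>R (2 * pi * x * ln \<bar>x - r\<bar>)) \<le> norm (indicat_real {0..R} x *\<^sub>R (2 * pi * R * ln \<bar>x - r\<bar>))"
      using True by (intro AE_I2) (auto simp: indicator_def abs_mult intro!: mult_mono)
  qed measurable
  then show ?thesis
    using set_integral_radial(1)[of "\<lambda>x. ln \<bar>x - r\<bar>" R] True by simp
next
  case False
  then have R: "ball (0::complex) R = {}" by simp
  show ?thesis unfolding set_integrable_def R by simp
qed

lemma set_integrable_ln_cmod_diff:
  "set_integrable lborel (ball a R) (\<lambda>z::complex. ln (cmod (z - w)))"
proof -
  define B where "B = R + cmod (a - w) + 1"
  have "integrable lborel (\<lambda>z::complex. indicat_real (ball 0 B) z *\<^sub>R ln (cmod z))"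
    using set_integrable_radial_ln[of B 0] by (simp add: set_integrable_def)
  from integrable_lborel_translation(1)[OF this, of "-w"]
  have 1: "integrable lborel (\<lambda>z::complex. indicat_real (ball 0 B) (z - w) *\<^sub>R ln (cmod (z - w)))"
    by simp
  have "set_integrable lborel (ball a R) (\<lambda>z::complex. indicat_real (ball 0 B) (z - w) *\<^sub>R ln (cmod (z - w)))"
    unfolding set_integrable_def by (rule integrable_mult_indicator[OF _ 1]) simp
  moreover have "cmod (z - w) < B" if "dist a z < R" for z
    using that norm_triangle_ineq[of "z - a" "a - w"] by (simp add: B_def dist_norm norm_minus_commute)
  ultimately show ?thesis
    by (elim set_integrable_cong[THEN iffD1, rotated -1]) (auto simp: indicator_def)
qed

section \<open>The average of ln |z - w| over circles\<close>

lemma set_integrable_bounded_mult: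
  fixes f p :: "'a \<Rightarrow> real"
  assumes "set_integrable M S f" and [measurable]: "p \<in> borel_measurable M"
    and p: "\<And>z. z \<in> S \<Longrightarrow> \<bar>p z\<bar> \<le> C"
  shows "set_integrable M S (\<lambda>z. p z * f z)"
  unfolding set_integrable_def
proof (rule Bochner_Integration.integrable_bound)
  show "integrable M (\<lambda>z. \<bar>C\<bar> *\<^sub>R (indicat_real S z *\<^sub>R f z))"
    using assms(1) by (intro integrable_scaleR_right) (auto simp: set_integrable_def)
  have [measurable]: "(\<lambda>z. indicat_real S z * f z) \<in> borel_measurable M"
    using assms(1) by (auto simp: set_integrable_def dest: borel_measurable_integrable)
  have "(\<lambda>z. p z * (indicat_real S z * f z)) \<in> borel_measurable M" by measurable
  then show "(\<lambda>z. indicat_real S z *\<^sub>R (p z * f z)) \<in> borel_measurable M"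
    by (simp add: mult_ac)
  show "AE z in M. norm (indicat_real S z *\<^sub>R (p z * f z)) \<le> norm (\<bar>C\<bar> *\<^sub>R (indicat_real S z *\<^sub>R f z))"
  proof (rule AE_I2)
    fix z show "norm (indicat_real S z *\<^sub>R (p z * f z)) \<le> norm (\<bar>C\<bar> *\<^sub>R (indicat_real S z *\<^sub>R f z))"
      using p[of z] by (auto simp: indicator_def abs_mult intro!: mult_right_mono)
  qed
qed

text \<open>The mean of \<open>ln \<bar>z - w\<bar>\<close> over the rotations of \<open>z\<close> by the roots of unity of order \<open>2 ^ m\<close>
  is \<open>ln \<bar>z ^ 2 ^ m - w ^ 2 ^ m\<bar> / 2 ^ m\<close>.\<close>

lemma integral_radial_ln_power:
  fixes p :: "real \<Rightarrow> real" and w :: complex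
  assumes p [measurable]: "p \<in> borel_measurable borel" and bd: "\<And>r. \<bar>p r\<bar> \<le> C"
  shows "set_integrable lborel (ball 0 R) (\<lambda>z. p (cmod z) * (ln (cmod (z ^ 2 ^ m - w ^ 2 ^ m)) / 2 ^ m)) \<and>
    (LINT z:ball 0 R|lborel. p (cmod z) * (ln (cmod (z ^ 2 ^ m - w ^ 2 ^ m)) / 2 ^ m)) =
    (LINT z:ball 0 R|lborel. p (cmod z) * ln (cmod (z - w)))"
proof (induction m)
  case 0
  show ?case
    using set_integrable_bounded_mult[OF set_integrable_ln_cmod_diff, of "\<lambda>z. p (cmod z)" 0 R C] bd by simp
next
  case (Suc m)
  \<comment> \<open>Rotation by \<open>c\<close> changes the sign of z^(2^m). Averaging the
    \<open>m\<close>-th integrand with its rotated copy multiplies a - b by -a - b inside the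
    logarithm, which up to sign is the difference of squares needed for
    \<open>Suc m\<close>.\<close>
  define c where "c = cis (pi / 2 ^ m)"
  have c: "cmod c = 1" by (simp add: c_def)
  have cm: "c ^ 2 ^ m = -1" unfolding c_def by (subst Complex.DeMoivre) simp
  define F where "F = (\<lambda>m z. indicat_real (ball 0 R) z *\<^sub>R (p (cmod z) * (ln (cmod (z ^ 2 ^ m - w ^ 2 ^ m)) / 2 ^ m)))"
  have int: "integrable lborel (F m)" and I: "integral\<^sup>L lborel (F m) = (LINT z:ball 0 R|lborel. p (cmod z) * ln (cmod (z - w)))"
    using Suc by (auto simp: F_def set_integrable_def set_lebesgue_integral_def)
  note rot = integrable_lborel_rotation[OF c int]
  have int2: "integrable lborel (\<lambda>z. (F m z + F m (c * z)) / 2)"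
    using int rot(1) by auto
  have I2: "integral\<^sup>L lborel (\<lambda>z. (F m z + F m (c * z)) / 2) = integral\<^sup>L lborel (F m)"
    using int rot by (simp add: Bochner_Integration.integral_add)
  \<comment> \<open>The logarithm of a product splits only where both factors are nonzero, as ln 0 =
    0 here; the exceptional points are finitely many roots.\<close>
  have AE: "AE z in lborel. F (Suc m) z = (F m z + F m (c * z)) / 2"
  proof -
    have "finite {z::complex. z ^ 2 ^ Suc m = w ^ 2 ^ Suc m}"
      by (rule finite_nth_roots) simp
    then have "AE z in lborel. z \<notin> {z::complex. z ^ 2 ^ Suc m = w ^ 2 ^ Suc m}"
      using AE_not_in finite_imp_null_set_lborel by blast
    then show ?thesis
    proof eventually_elim
      case (elim z)
      define a where "a = z ^ 2 ^ m"
      define b where "b = w ^ 2 ^ m"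
      have sq: "z ^ 2 ^ Suc m = a\<^sup>2" "w ^ 2 ^ Suc m = b\<^sup>2"
        by (simp_all add: a_def b_def flip: power_mult) (simp_all add: mult.commute)
      have fac: "a\<^sup>2 - b\<^sup>2 = (a - b) * - (- a - b)"
        by (simp add: power2_eq_square algebra_simps)
      have ne: "a\<^sup>2 - b\<^sup>2 \<noteq> 0" using elim sq by auto
      then have ne': "a - b \<noteq> 0" "- a - b \<noteq> 0" unfolding fac by auto
      have "ln (cmod (a\<^sup>2 - b\<^sup>2)) = ln (cmod (a - b)) + ln (cmod (- a - b))"
        unfolding fac norm_mult norm_minus_cancel using ne' by (intro ln_mult_pos) auto
      moreover have "(c * z) ^ 2 ^ m = - a"
        by (simp add: power_mult_distrib cm a_def)
      ultimately show ?case
        unfolding F_def sq a_def[symmetric] b_def[symmetric]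
        using c by (simp add: norm_mult indicator_def field_simps)
    qed
  qed
  have meas: "F (Suc m) \<in> borel_measurable lborel"
  proof -
    have [measurable]: "(\<lambda>z. ln (cmod (z ^ 2 ^ Suc m - w ^ 2 ^ Suc m))) \<in> borel_measurable borel"
      by (intro borel_measurable_ln borel_measurable_continuous_onI continuous_intros)
    have [measurable]: "ball (0::complex) R \<in> sets borel" by simp
    show ?thesis unfolding F_def by measurable
  qed
  have "integrable lborel (F (Suc m))"
    using int2 AE meas by (subst integrable_cong_AE[OF _ _ AE]) auto
  moreover have "integral\<^sup>L lborel (F (Suc m)) = integral\<^sup>L lborel (F m)"
    using integral_cong_AE[OF meas borel_measurable_integrable[OF int2] AE] I2 by simp
  ultimately show ?case
    using I by (auto simp: F_def set_integrable_def set_lebesgue_integral_def)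
qed

lemma AE_cmod_neq: "AE z in lborel. cmod z \<noteq> r"
proof -
  have "negligible (sphere (0::complex) r)"
    by (simp add: negligible_sphere)
  then have "sphere (0::complex) r \<in> null_sets lborel"
    by (auto simp: negligible_iff_null_sets null_sets_completion_iff)
  then have "AE z in lborel. z \<notin> sphere (0::complex) r"
    by (rule AE_not_in)
  then show ?thesis by (auto simp: dist_norm)
qed

text \<open>With M and \<open>\<mu>\<close> the larger and the smaller modulus and t = \<mu> / M,
  one has M^N (1 - t) <= |z^N - w^N| <= 2 M^N, the lower bound because t^N <= t. After taking
  logarithms and dividing by N, the error is at most (ln 2 - ln (1 - t)) / N; its dependence on z is
  integrable even across the circle |z| = |w|.\<close>

lemma ln_cmod_power_diff_bound:
  fixes z w :: complex
  assumes "cmod z \<noteq> cmod w" "N > 0"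
  defines "M \<equiv> max (cmod z) (cmod w)"
  shows "\<bar>ln (cmod (z ^ N - w ^ N)) / N - ln M\<bar> \<le> (ln 2 + (ln M - ln \<bar>cmod z - cmod w\<bar>)) / N"
    and "ln \<bar>cmod z - cmod w\<bar> \<le> ln M"
proof -
  define \<mu> where "\<mu> = min (cmod z) (cmod w)"
  have M: "M > 0" "0 \<le> \<mu>" "\<mu> < M"
    using assms(1) unfolding M_def \<mu>_def by (auto simp: max_def min_def)
  have d: "\<bar>cmod z - cmod w\<bar> = M - \<mu>"
    by (auto simp: M_def \<mu>_def)
  show "ln \<bar>cmod z - cmod w\<bar> \<le> ln M"
    unfolding d using M by simp
  define t where "t = \<mu> / M"
  have t: "0 \<le> t" "t < 1" using M by (auto simp: t_def)
  have lower: "M ^ N * (1 - t) \<le> cmod (z ^ N - w ^ N)"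
  proof -
    have "t ^ N \<le> t ^ 1"
      using t assms(2) by (intro power_decreasing) auto
    then have "M ^ N * (1 - t) \<le> M ^ N * (1 - t ^ N)"
      using M by (intro mult_left_mono) auto
    also have "\<dots> = M ^ N - \<mu> ^ N"
      using M by (simp add: t_def power_divide algebra_simps)
    also have "\<dots> = \<bar>cmod z ^ N - cmod w ^ N\<bar>"
      unfolding M_def \<mu>_def by (auto simp: max_def min_def abs_if power_mono dest: power_mono[of _ _ N])
        (smt (verit) norm_ge_zero power_mono)+
    also have "\<dots> \<le> cmod (z ^ N - w ^ N)"
      by (metis norm_power norm_triangle_ineq3)
    finally show ?thesis .
  qed
  have upper: "cmod (z ^ N - w ^ N) \<le> M ^ N * 2"
  proof -
    have "cmod (z ^ N - w ^ N) \<le> cmod z ^ N + cmod w ^ N"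
      by (metis norm_power norm_triangle_ineq4)
    also have "\<dots> \<le> M ^ N + M ^ N"
      by (intro add_mono power_mono) (auto simp: M_def)
    finally show ?thesis by simp
  qed
  have pos: "0 < M ^ N * (1 - t)" using M t by simp
  have a: "N * ln M + ln (1 - t) \<le> ln (cmod (z ^ N - w ^ N))"
    using ln_mono[OF lower pos] pos lower M t by (simp add: ln_mult_pos ln_realpow)
  have b: "ln (cmod (z ^ N - w ^ N)) \<le> N * ln M + ln 2"
    using ln_mono[OF upper less_le_trans[OF pos lower]] M by (simp add: ln_mult_pos ln_realpow)
  have e: "ln (1 - t) = ln (M - \<mu>) - ln M"
    using M ln_div[of "M - \<mu>" M] by (simp add: t_def diff_divide_distrib)
  have "ln (M - \<mu>) \<le> ln M" using M by simp
  then have "\<bar>ln (cmod (z ^ N - w ^ N)) - N * ln M\<bar> \<le> ln 2 + (ln M - ln (M - \<mu>))"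
    using a b e ln_gt_zero[of 2] by linarith
  then have "\<bar>ln (cmod (z ^ N - w ^ N)) - N * ln M\<bar> / N \<le> (ln 2 + (ln M - ln (M - \<mu>))) / N"
    by (intro divide_right_mono) auto
  moreover have "\<bar>ln (cmod (z ^ N - w ^ N)) - N * ln M\<bar> / N = \<bar>ln (cmod (z ^ N - w ^ N)) / N - ln M\<bar>"
  proof -
    have "(ln (cmod (z ^ N - w ^ N)) - N * ln M) / N = ln (cmod (z ^ N - w ^ N)) / N - ln M"
      using assms(2) by (simp add: diff_divide_distrib)
    then show ?thesis by (metis abs_divide abs_of_nat)
  qed
  ultimately show "\<bar>ln (cmod (z ^ N - w ^ N)) / N - ln M\<bar> \<le> (ln 2 + (ln M - ln \<bar>cmod z - cmod w\<bar>)) / N"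
    unfolding d by simp
qed

lemma set_integrable_ln_max:
  "set_integrable lborel (ball 0 R) (\<lambda>z::complex. ln (max (cmod z) r))"
proof (cases "r > 0")
  case True
  have "set_integrable lborel (cball 0 R) (\<lambda>z::complex. ln (max (cmod z) r))"
    unfolding set_integrable_def
    by (intro borel_integrable_compact continuous_intros) (use True in auto)
  then show ?thesis by (rule set_integrable_subset) auto
next
  case False
  have "(\<lambda>z::complex. ln (max (cmod z) r)) = (\<lambda>z. ln \<bar>cmod z - 0\<bar>)"
    using False by (auto simp: fun_eq_iff max_def) (smt (verit) norm_ge_zero)+
  then show ?thesis using set_integrable_radial_ln[of R 0] by simp
qed

text \<open>Replacing ln |z - w| by its averages over roots of unity leaves the integral unchanged,
  while the averages tend to ln max(|z|, |w|) with error at most \<open>E\<close> / 2^m. The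
  difference of the two integrals does not depend on m, so it is 0.\<close>

lemma integral_radial_ln_cmod_diff:
  fixes p :: "real \<Rightarrow> real" and w :: complex
  assumes p [measurable]: "p \<in> borel_measurable borel" and bd: "\<And>r. \<bar>p r\<bar> \<le> C"
  shows "(LINT z:ball 0 R|lborel. p (cmod z) * ln (cmod (z - w))) =
         (LINT z:ball 0 R|lborel. p (cmod z) * ln (max (cmod z) (cmod w)))"
proof -
  define M where "M = (\<lambda>z. max (cmod z) (cmod w))"
  define E where "E = (\<lambda>z. ln 2 + (ln (M z) - ln \<bar>cmod z - cmod w\<bar>))"
  have iM: "set_integrable lborel (ball 0 R) (\<lambda>z. p (cmod z) * ln (M z))"
    unfolding M_def by (rule set_integrable_bounded_mult[where C=C, OF set_integrable_ln_max]) (use bd in auto)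
  have iE: "set_integrable lborel (ball 0 R) (\<lambda>z. C * E z)"
  proof -
    have "set_integrable lborel (ball (0::complex) R) (\<lambda>z. ln 2 :: real)"
      using emeasure_lborel_ball_finite[of "0::complex" R] by (simp add: set_integrable_def integrable_indicator_iff)
    then show ?thesis
      unfolding E_def M_def
      by (intro set_integrable_mult_right set_integral_add set_integral_diff set_integrable_ln_max set_integrable_radial_ln)
  qed
  let ?A = "LINT z:ball 0 R|lborel. p (cmod z) * ln (cmod (z - w))"
  let ?B = "LINT z:ball 0 R|lborel. p (cmod z) * ln (M z)"
  let ?C = "LINT z:ball 0 R|lborel. C * E z"
  have le: "\<bar>?A - ?B\<bar> \<le> ?C / 2 ^ m" for m
  proof -
    let ?L = "\<lambda>z. p (cmod z) * (ln (cmod (z ^ 2 ^ m - w ^ 2 ^ m)) / 2 ^ m)"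
    from integral_radial_ln_power[OF p bd, of R m w]
    have iL: "set_integrable lborel (ball 0 R) ?L" and L: "?A = (LINT z:ball 0 R|lborel. ?L z)"
      by auto
    have "\<bar>?A - ?B\<bar> = \<bar>LINT z:ball 0 R|lborel. (?L z - p (cmod z) * ln (M z))\<bar>"
      unfolding L by (subst set_integral_diff(2)[OF iL iM]) simp
    also have "\<dots> \<le> (LINT z:ball 0 R|lborel. \<bar>?L z - p (cmod z) * ln (M z)\<bar>)"
      using set_integral_norm_bound[OF set_integral_diff(1)[OF iL iM]] by simp
    also have "\<dots> \<le> (LINT z:ball 0 R|lborel. (C * E z) / 2 ^ m)"
      unfolding set_lebesgue_integral_def
    proof (rule integral_mono_AE)
      show "integrable lborel (\<lambda>z. indicat_real (ball 0 R) z *\<^sub>R \<bar>?L z - p (cmod z) * ln (M z)\<bar>)"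
        using set_integrable_abs[OF set_integral_diff(1)[OF iL iM]] by (simp add: set_integrable_def)
      show "integrable lborel (\<lambda>z. indicat_real (ball 0 R) z *\<^sub>R (C * E z / 2 ^ m))"
        using set_integrable_divide[OF iE, of "2 ^ m"] by (simp add: set_integrable_def)
      show "AE z in lborel. indicat_real (ball 0 R) z *\<^sub>R \<bar>?L z - p (cmod z) * ln (M z)\<bar> \<le> indicat_real (ball 0 R) z *\<^sub>R (C * E z / 2 ^ m)"
        using AE_cmod_neq[of "cmod w"]
      proof eventually_elim
        case (elim z)
        have b: "\<bar>ln (cmod (z ^ 2 ^ m - w ^ 2 ^ m)) / 2 ^ m - ln (M z)\<bar> \<le> E z / 2 ^ m"
          using ln_cmod_power_diff_bound(1)[OF elim, of "2 ^ m"] by (simp add: E_def M_def)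
        have "\<bar>?L z - p (cmod z) * ln (M z)\<bar> = \<bar>p (cmod z)\<bar> * \<bar>ln (cmod (z ^ 2 ^ m - w ^ 2 ^ m)) / 2 ^ m - ln (M z)\<bar>"
          by (simp add: abs_mult[symmetric] right_diff_distrib)
        also have "\<dots> \<le> C * (E z / 2 ^ m)"
          using bd[of "cmod z"] b by (intro mult_mono) auto
        finally show ?case by (auto simp: indicator_def)
      qed
    qed
    also have "\<dots> = ?C / 2 ^ m"
      by (rule set_integral_divide_zero)
    finally show ?thesis .
  qed
  have "(\<lambda>m. x / 2 ^ m) \<longlonglongrightarrow> 0" for x :: real
    by real_asymp
  from this[of ?C] have "(\<lambda>m. ?C / 2 ^ m) \<longlonglongrightarrow> 0" .
  then have "\<bar>?A - ?B\<bar> \<le> 0"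
    by (rule LIMSEQ_le_const) (use le in auto)
  then show ?thesis by (simp add: M_def)
qed

subsection \<open>Jensen's formula on discs\<close>

lemma set_integral_ball_translate:
  fixes f :: "'a::euclidean_space \<Rightarrow> 'b::{banach, second_countable_topology}"
  shows "set_integrable lborel (ball a R) f \<longleftrightarrow> set_integrable lborel (ball 0 R) (\<lambda>z. f (a + z))"
    and "(LINT z:ball a R|lborel. f z) = (LINT z:ball 0 R|lborel. f (a + z))"
proof -
  define F where "F = (\<lambda>z. indicat_real (ball a R) z *\<^sub>R f z)"
  have 1: "(\<lambda>z. F (a + z)) = (\<lambda>z. indicat_real (ball 0 R) z *\<^sub>R f (a + z))"
    by (auto simp: F_def indicator_def fun_eq_iff dist_norm)
  have 2: "(\<lambda>z. F (a + (- a + z))) = F" by simp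
  have iff: "integrable lborel F \<longleftrightarrow> integrable lborel (\<lambda>z. F (a + z))"
    using integrable_lborel_translation(1)[of F a] integrable_lborel_translation(1)[of "\<lambda>z. F (a + z)" "-a"]
    by auto
  then show "set_integrable lborel (ball a R) f \<longleftrightarrow> set_integrable lborel (ball 0 R) (\<lambda>z. f (a + z))"
    unfolding set_integrable_def 1[symmetric] by (simp add: F_def)
  have "integral\<^sup>L lborel F = integral\<^sup>L lborel (\<lambda>z. F (a + z))"
    using integrable_lborel_translation(2)[of F a] iff by (cases "integrable lborel F") (auto simp: not_integrable_integral_eq)
  then show "(LINT z:ball a R|lborel. f z) = (LINT z:ball 0 R|lborel. f (a + z))"
    unfolding set_lebesgue_integral_def 1[symmetric] by (simp add: F_def)
qed

section \<open>Explicit radial integrals and area means of holomorphic functions\<close>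

lemma set_integral_radial_eq:
  fixes p :: "real \<Rightarrow> real"
  assumes p [measurable]: "p \<in> borel_measurable borel" and "R \<ge> 0"
    and int: "set_integrable lborel (ball (0::complex) R) (\<lambda>z. p (cmod z))"
    and I: "((\<lambda>r. 2 * pi * r * p r) has_integral I) {0..R}"
  shows "(LINT z:ball (0::complex) R|lborel. p (cmod z)) = I"
proof -
  have "(LINT z:ball (0::complex) R|lborel. p (cmod z)) = (LINT r:{0..<R}|lborel. 2 * pi * r * p r)"
    by (rule set_integral_radial(2)[OF p \<open>R \<ge> 0\<close>])
  also have "\<dots> = integral {0..<R} (\<lambda>r. 2 * pi * r * p r)"
    using set_integral_radial(1)[OF p \<open>R \<ge> 0\<close>] int by (intro set_borel_integral_eq_integral) auto
  also have "\<dots> = integral {0..R} (\<lambda>r. 2 * pi * r * p r)"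
  proof (rule integral_spike_set)
    show "negligible {r \<in> {0..<R} - {0..R}. 2 * pi * r * p r \<noteq> 0}" by (rule negligible_subset[of "{}"]) auto
    show "negligible {r \<in> {0..R} - {0..<R}. 2 * pi * r * p r \<noteq> 0}"
      by (rule negligible_subset[of "{R}"]) auto
  qed
  also have "\<dots> = I" using I by (rule integral_unique)
  finally show ?thesis .
qed

lemma set_integral_cmod_power:
  assumes "R \<ge> 0"
  shows "set_integrable lborel (ball (0::complex) R) (\<lambda>z. cmod z ^ n)"
    and "(LINT z:ball (0::complex) R|lborel. cmod z ^ n) = 2 * pi / (n + 2) * R ^ (n + 2)"
proof -
  have "set_integrable lborel (cball (0::complex) R) (\<lambda>z. cmod z ^ n)"
    unfolding set_integrable_def by (intro borel_integrable_compact continuous_intros) auto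
  then show *: "set_integrable lborel (ball (0::complex) R) (\<lambda>z. cmod z ^ n)"
    by (rule set_integrable_subset) auto
  show "(LINT z:ball (0::complex) R|lborel. cmod z ^ n) = 2 * pi / (n + 2) * R ^ (n + 2)"
  proof (rule set_integral_radial_eq[OF _ assms *])
    have "((\<lambda>r. 2 * pi * r * r ^ n) has_integral (2 * pi / (n + 2) * R ^ (n + 2) - 2 * pi / (n + 2) * 0 ^ (n + 2))) {0..R}"
    proof (rule fundamental_theorem_of_calculus[OF assms])
      fix x :: real assume "x \<in> {0..R}"
      have "((\<lambda>r. 2 * pi / (n + 2) * r ^ (n + 2)) has_real_derivative 2 * pi * x * x ^ n) (at x within {0..R})"
        by (rule derivative_eq_intros refl | simp)+
      then show "((\<lambda>r. 2 * pi / (n + 2) * r ^ (n + 2)) has_vector_derivative 2 * pi * x * x ^ n) (at x within {0..R})"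
        by (simp add: has_real_derivative_iff_has_vector_derivative)
    qed
    then show "((\<lambda>r. 2 * pi * r * r ^ n) has_integral 2 * pi / (n + 2) * R ^ (n + 2)) {0..R}"
      by simp
  qed simp
qed

lemma set_integral_cmod_power_ln_max:
  assumes "R > 0" "\<rho> \<ge> 0"
  shows "(LINT z:ball (0::complex) R|lborel. cmod z ^ n * ln (max (cmod z) \<rho>)) =
    2 * pi / (n + 2) * (R ^ (n + 2) * ln (max R \<rho>) - max 0 (R ^ (n + 2) - \<rho> ^ (n + 2)) / (n + 2))"
proof (rule set_integral_radial_eq)
  define m where "m = n + 2"
  \<comment> \<open>An antiderivative on either side of \<open>\<rho>\<close>: up to the factor 2 pi
    / m it is r^m ln \<rho> below and r^m ln r - (r^m - \<rho>^m) / m above. The \<open>max\<close>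
    glues the two continuously, and the corner at \<open>\<rho>\<close> is exempt from
    differentiation.\<close>
  define G where "G = (\<lambda>r. 2 * pi / m * (r ^ m * ln (max r \<rho>) - max 0 (r ^ m - \<rho> ^ m) / m))"
  have m: "real m > 0" "m > 0" by (auto simp: m_def)
  have pw: "x < y \<Longrightarrow> 0 \<le> x \<Longrightarrow> x ^ m < y ^ m" for x y :: real
    using m by (intro power_strict_mono) auto
  have "((\<lambda>r. 2 * pi * r * (r ^ n * ln (max r \<rho>))) has_integral (G R - G 0)) {0..R}"
  proof (rule fundamental_theorem_of_calculus_interior_strong[of "{\<rho>}"])
    fix x assume x: "x \<in> {0<..<R} - {\<rho>}"
    have "(G has_real_derivative 2 * pi * x * (x ^ n * ln (max x \<rho>))) (at x)"
    proof (cases "x < \<rho>")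
      case True
      have "((\<lambda>r. 2 * pi / m * (r ^ m * ln \<rho>)) has_real_derivative 2 * pi / m * (m * x ^ (m - 1) * ln \<rho>)) (at x)"
        by (auto intro!: derivative_eq_intros)
      also have "2 * pi / m * (m * x ^ (m - 1) * ln \<rho>) = 2 * pi * x * (x ^ n * ln (max x \<rho>))"
        using True m by (simp add: m_def max_def)
      finally show ?thesis
      proof (rule has_field_derivative_transform_within_open[of _ _ _ "{0<..<\<rho>}"])
        show "2 * pi / m * (r ^ m * ln \<rho>) = G r" if "r \<in> {0<..<\<rho>}" for r
          using that pw[of r \<rho>] by (simp add: G_def max_def)
      qed (use True x in auto)
    next
      case False
      then have x': "x > \<rho>" "x > 0" using x by auto
      have "((\<lambda>r. 2 * pi / m * (r ^ m * ln r - (r ^ m - \<rho> ^ m) / m)) has_real_derivative 2 * pi / m * (m * x ^ (m - 1) * ln x + x ^ m / x - m * x ^ (m - 1) / m)) (at x)"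
        using x' by (auto intro!: derivative_eq_intros)
      also have "2 * pi / m * (m * x ^ (m - 1) * ln x + x ^ m / x - m * x ^ (m - 1) / m) = 2 * pi * x * (x ^ n * ln (max x \<rho>))"
        using x' m by (simp add: m_def max_def)
      finally show ?thesis
      proof (rule has_field_derivative_transform_within_open[of _ _ _ "{\<rho><..}"])
        show "2 * pi / m * (r ^ m * ln r - (r ^ m - \<rho> ^ m) / m) = G r" if "r \<in> {\<rho><..}" for r
          using that pw[of \<rho> r] assms by (simp add: G_def max_def)
      qed (use x' in auto)
    qed
    then show "(G has_vector_derivative 2 * pi * x * (x ^ n * ln (max x \<rho>))) (at x)"
      by (simp add: has_real_derivative_iff_has_vector_derivative)
  next
    define g where "g = (\<lambda>r. r ^ m * ln (max r \<rho>))"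
    have "continuous_on {0..R} g"
    proof (cases "\<rho> > 0")
      case True
      then show ?thesis unfolding g_def by (intro continuous_intros) auto
    next
      case False
      then have \<rho>: "\<rho> = 0" using assms by simp
      have "((\<lambda>r. r ^ m * ln (max r \<rho>)) \<longlongrightarrow> x ^ m * ln (max x \<rho>)) (at x within {0..R})" if "x \<in> {0..R}" for x
      proof (cases "x = 0")
        case True
        \<comment> \<open>For \<open>\<rho>\<close> = 0, continuity at 0 rests on r ln r -> 0, and
          the value there is 0 because of the factor 0^m.\<close>
        have "((\<lambda>r::real. r * ln r) \<longlongrightarrow> 0) (at_right 0)" by real_asymp
        then have "((\<lambda>r::real. r ^ (n + 1) * (r * ln r)) \<longlongrightarrow> 0 ^ (n + 1) * 0) (at_right 0)"
          by (intro tendsto_intros)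
        then have "((\<lambda>r::real. r ^ (n + 1) * (r * ln r)) \<longlongrightarrow> 0) (at_right 0)"
          by simp
        then have "((\<lambda>r. r ^ m * ln (max r \<rho>)) \<longlongrightarrow> 0) (at_right 0)"
          by (rule Lim_transform_eventually)
            (auto simp: eventually_at_right_less m_def \<rho> max_def intro!: eventually_mono[OF eventually_at_right_less])
        then have lim0: "((\<lambda>r. r ^ m * ln (max r \<rho>)) \<longlongrightarrow> 0) (at 0 within {0..})"
          by (simp add: at_within_Ici_at_right)
        then show ?thesis
          unfolding True using m tendsto_within_subset[OF lim0, of "{0..R}"] by (simp add: power_0_left)
      next
        case False
        then have "x > 0" using that by auto
        then show ?thesis by (intro tendsto_intros) auto
      qed
      then show ?thesis by (simp add: continuous_on_def g_def)
    qed
    moreover have "G = (\<lambda>r. 2 * pi / m * (g r - max 0 (r ^ m - \<rho> ^ m) / m))"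
      by (simp add: G_def g_def)
    ultimately show "continuous_on {0..R} G"
      using m by (auto intro!: continuous_intros)
  qed (use assms in auto)
  also have "G R - G 0 = G R"
    using assms m by (simp add: G_def)
  finally show "((\<lambda>r. 2 * pi * r * (r ^ n * ln (max r \<rho>))) has_integral
      2 * pi / (n + 2) * (R ^ (n + 2) * ln (max R \<rho>) - max 0 (R ^ (n + 2) - \<rho> ^ (n + 2)) / (n + 2))) {0..R}"
    by (simp add: G_def m_def algebra_simps)
  show "set_integrable lborel (ball (0::complex) R) (\<lambda>z. cmod z ^ n * ln (max (cmod z) \<rho>))"
    by (rule set_integrable_bounded_mult[where C="R ^ n", OF set_integrable_ln_max]) (auto intro!: power_mono)
qed (use assms in auto)

text \<open>Integrate the Taylor series of \<open>h\<close> at \<open>a\<close> term by term.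
  Rotation by exp(i pi / n) preserves the radial weight and turns z^n into -z^n, so every term with
  n > 0 vanishes and only the value at the centre is left.\<close>

lemma holomorphic_area_mean:
  fixes p :: "real \<Rightarrow> real"
  assumes hol: "h holomorphic_on ball a R'" and R: "0 < R" "R < R'"
    and p [measurable]: "p \<in> borel_measurable borel" and bd: "\<And>r. \<bar>p r\<bar> \<le> C"
  shows "set_integrable lborel (ball 0 R) (\<lambda>z. p (cmod z) *\<^sub>R h (a + z))"
    and "(LINT z:ball 0 R|lborel. p (cmod z) *\<^sub>R h (a + z)) = (LINT z:ball (0::complex) R|lborel. p (cmod z)) *\<^sub>R h a"
proof -
  define c where "c = (\<lambda>n. (deriv ^^ n) h a / fact n)"
  have sums: "(\<lambda>n. c n * z ^ n) sums h (a + z)" if "cmod z < R'" for z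
    using holomorphic_power_series[OF hol, of "a + z"] that by (simp add: c_def dist_norm)
  define T where "T = (\<lambda>n z. indicat_real (ball 0 R) z *\<^sub>R (p (cmod z) *\<^sub>R (c n * z ^ n)))"
  have C: "C \<ge> 0" using bd[of 0] by auto
  have pint: "integrable lborel (\<lambda>z::complex. indicat_real (ball 0 R) z *\<^sub>R (p (cmod z) *\<^sub>R (1::complex)))"
  proof (rule Bochner_Integration.integrable_bound)
    show "integrable lborel (\<lambda>z::complex. C *\<^sub>R indicat_real (ball 0 R) z)"
      using emeasure_lborel_ball_finite[of "0::complex" R] by (intro integrable_scaleR_right) auto
    show "AE z in lborel. norm (indicat_real (ball 0 R) z *\<^sub>R (p (cmod z) *\<^sub>R (1::complex))) \<le> norm (C *\<^sub>R indicat_real (ball 0 R) z)"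
      using bd C by (intro AE_I2) (auto simp: indicator_def)
    have [measurable]: "ball (0::complex) R \<in> sets borel" by simp
    show "(\<lambda>z::complex. indicat_real (ball 0 R) z *\<^sub>R (p (cmod z) *\<^sub>R (1::complex))) \<in> borel_measurable lborel"
      by measurable
  qed
  have area: "integrable lborel (indicat_real (ball (0::complex) R))"
    using emeasure_lborel_ball_finite[of "0::complex" R] by auto
  have Tb: "norm (T n z) \<le> C * (cmod (c n) * R ^ n) * indicat_real (ball 0 R) z" for n z
    unfolding T_def using bd[of "cmod z"] C R
    by (auto simp: indicator_def norm_mult norm_power intro!: mult_mono power_mono)
  have Tm: "T n \<in> borel_measurable lborel" for n
  proof -
    have [measurable]: "ball (0::complex) R \<in> sets borel" by simp
    have [measurable]: "(\<lambda>z. c n * z ^ n) \<in> borel_measurable borel"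
      by (intro borel_measurable_continuous_onI continuous_intros)
    show ?thesis unfolding T_def by measurable
  qed
  have Ti: "integrable lborel (T n)" for n
    by (rule Bochner_Integration.integrable_bound[OF integrable_mult_right[OF area, of "C * (cmod (c n) * R ^ n)"] Tm])
      (use Tb in \<open>auto intro!: AE_I2 order.trans[OF Tb]\<close>)
  have sumc: "summable (\<lambda>n. cmod (c n) * R ^ n)"
  proof -
    \<comment> \<open>Convergence at a radius strictly beyond \<open>R\<close> gives absolute
      convergence at \<open>R\<close>; this is where the strict inequality R < R' is used.\<close>
    obtain R1 where R1: "R < R1" "R1 < R'" using R(2) dense by blast
    have "summable (\<lambda>n. c n * complex_of_real R1 ^ n)"
      using sums[of "complex_of_real R1"] R R1 by (auto simp: sums_iff)
    from powser_insidea[OF this, of "complex_of_real R"] show ?thesis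
      using R R1 by (simp add: norm_mult norm_power)
  qed
  have T_sums: "(\<lambda>n. T n z) sums (indicat_real (ball 0 R) z *\<^sub>R (p (cmod z) *\<^sub>R h (a + z)))" for z
  proof (cases "z \<in> ball 0 R")
    case True
    then show ?thesis
      unfolding T_def using R by (intro sums_scaleR_right sums) auto
  qed (simp add: T_def)
  have sumT: "summable (\<lambda>n. norm (T n z))" for z
    by (rule summable_comparison_test'[OF summable_mult2[OF summable_mult[OF sumc, of C]], of 0]) (use Tb in auto)
  have sumI: "summable (\<lambda>n. \<integral>z. norm (T n z) \<partial>lborel)"
  proof (rule summable_comparison_test'[of "\<lambda>n. C * (cmod (c n) * R ^ n) * measure lborel (ball (0::complex) R)" 0])
    fix n
    have "(\<integral>z. norm (T n z) \<partial>lborel) \<le> (\<integral>z. C * (cmod (c n) * R ^ n) * indicat_real (ball (0::complex) R) z \<partial>lborel)"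
    proof (rule Bochner_Integration.integral_mono)
      show "integrable lborel (\<lambda>z. C * (cmod (c n) * R ^ n) * indicat_real (ball (0::complex) R) z)"
        using area by (rule integrable_mult_right)
    qed (use Ti Tb in auto)
    also have "\<dots> = C * (cmod (c n) * R ^ n) * measure lborel (ball (0::complex) R)"
      by simp
    finally show "norm (\<integral>z. norm (T n z) \<partial>lborel) \<le> C * (cmod (c n) * R ^ n) * measure lborel (ball (0::complex) R)"
      by simp
  qed (intro summable_mult summable_mult2 sumc)
  note S = integrable_suminf[OF Ti AE_I2[OF sumT] sumI] integral_suminf[OF Ti AE_I2[OF sumT] sumI]
  have eq: "(\<lambda>z. \<Sum>n. T n z) = (\<lambda>z. indicat_real (ball 0 R) z *\<^sub>R (p (cmod z) *\<^sub>R h (a + z)))"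
    using T_sums by (auto simp: sums_iff fun_eq_iff)
  show "set_integrable lborel (ball 0 R) (\<lambda>z. p (cmod z) *\<^sub>R h (a + z))"
    using S(1) unfolding eq set_integrable_def .
  have T0: "integral\<^sup>L lborel (T n) = 0" if "n > 0" for n
  proof -
    define \<omega> where "\<omega> = cis (pi / n)"
    have \<omega>: "cmod \<omega> = 1" "\<omega> ^ n = -1"
      using that by (simp_all add: \<omega>_def Complex.DeMoivre)
    have "integral\<^sup>L lborel (T n) = integral\<^sup>L lborel (\<lambda>z. T n (\<omega> * z))"
      using integrable_lborel_rotation(2)[OF \<omega>(1) Ti[of n]] by simp
    also have "(\<lambda>z. T n (\<omega> * z)) = (\<lambda>z. - T n z)"
      using \<omega> by (auto simp: T_def fun_eq_iff indicator_def norm_mult power_mult_distrib)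
    finally show ?thesis by simp
  qed
  have c0: "c 0 = h a" by (simp add: c_def)
  have "(LINT z:ball 0 R|lborel. p (cmod z) *\<^sub>R h (a + z)) = (\<Sum>n. integral\<^sup>L lborel (T n))"
    using S(2) unfolding eq set_lebesgue_integral_def .
  also have "\<dots> = integral\<^sup>L lborel (T 0)"
    by (subst suminf_finite[of "{0}"]) (use T0 in auto)
  also have "T 0 = (\<lambda>z. (indicat_real (ball 0 R) z *\<^sub>R p (cmod z)) *\<^sub>R h a)"
    by (auto simp: T_def c0 fun_eq_iff)
  also have "integral\<^sup>L lborel \<dots> = (LINT z:ball (0::complex) R|lborel. p (cmod z)) *\<^sub>R h a"
    unfolding set_lebesgue_integral_def
  proof (rule integral_scaleR_left)
    assume "h a \<noteq> 0"
    have "integrable lborel (\<lambda>z::complex. Re (indicat_real (ball 0 R) z *\<^sub>R (p (cmod z) *\<^sub>R (1::complex))))"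
      using pint by (rule integrable_Re)
    then show "integrable lborel (\<lambda>z::complex. indicat_real (ball 0 R) z *\<^sub>R p (cmod z))"
      by simp
  qed
  finally show "(LINT z:ball 0 R|lborel. p (cmod z) *\<^sub>R h (a + z)) = (LINT z:ball (0::complex) R|lborel. p (cmod z)) *\<^sub>R h a" .
qed

section \<open>Factoring out the zeros, and Jensen's formula\<close>

lemma set_integral_sum:
  fixes f :: "'i \<Rightarrow> 'a \<Rightarrow> 'b::{banach, second_countable_topology}"
  assumes "finite I" "\<And>i. i \<in> I \<Longrightarrow> set_integrable M A (f i)"
  shows "set_integrable M A (\<lambda>x. \<Sum>i\<in>I. f i x)"
    and "(LINT x:A|M. (\<Sum>i\<in>I. f i x)) = (\<Sum>i\<in>I. LINT x:A|M. f i x)"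
proof -
  show "set_integrable M A (\<lambda>x. \<Sum>i\<in>I. f i x)"
    using assms unfolding set_integrable_def scaleR_sum_right by (intro Bochner_Integration.integrable_sum) auto
  show "(LINT x:A|M. (\<Sum>i\<in>I. f i x)) = (\<Sum>i\<in>I. LINT x:A|M. f i x)"
    using assms unfolding set_integrable_def set_lebesgue_integral_def scaleR_sum_right
    by (intro Bochner_Integration.integral_sum) auto
qed

lemma finite_zeros_ball:
  assumes "f holomorphic_on S" "open S" "connected S" "cball a R \<subseteq> S" "z0 \<in> S" "f z0 \<noteq> 0"
  shows "finite {w \<in> cball a R. f w = 0}"
proof (cases "f constant_on S")
  case True
  then have "{w \<in> cball a R. f w = 0} = {}"
    using assms(4-6) by (auto simp: constant_on_def)
  then show ?thesis by (metis finite.emptyI)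
qed (use assms in \<open>intro holomorphic_compact_finite_zeros\<close>, auto)

lemma eventually_nonzero_at:
  assumes "f holomorphic_on S" "open S" "connected S" "z0 \<in> S" "f z0 \<noteq> 0" "w \<in> S"
  shows "eventually (\<lambda>z. f z \<noteq> 0) (at w)"
  by (rule eventually_mono[OF non_zero_neighbour_alt[OF assms(1-3) assms(6,4,5)]]) auto

text \<open>Dividing by the polynomial with the same zeros and multiplicities leaves a function
  without zeros on the disc; the disc is contractible, so this function is an exponential. Hence ln
  |f| is the harmonic function Re g plus finitely many multiples of ln |z - w|.\<close>

lemma holomorphic_zero_factorization:
  assumes hol: "f holomorphic_on S" "open S" "connected S" and nz: "z0 \<in> S" "f z0 \<noteq> 0"
    and R: "R > 0" "cball a R \<subseteq> S"
  obtains g where "g holomorphic_on ball a R"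
    "\<And>z. z \<in> ball a R \<Longrightarrow> f z = exp (g z) * (\<Prod>w\<in>{w \<in> ball a R. f w = 0}. (z - w) ^ nat (zorder f w))"
proof -
  define Z where "Z = {w \<in> ball a R. f w = 0}"
  have fin: "finite Z"
    by (rule finite_subset[OF _ finite_zeros_ball[OF hol R(2) nz]]) (auto simp: Z_def)
  define P where "P = (\<lambda>z. \<Prod>w\<in>Z. (z - w) ^ nat (zorder f w))"
  have sub: "ball a R \<subseteq> S" using R(2) by auto
  have holf: "f holomorphic_on ball a R" using hol(1) sub by (rule holomorphic_on_subset)
  have holP: "P holomorphic_on A" for A
    unfolding P_def by (intro holomorphic_intros)
  have ord: "zorder f w > 0" if "w \<in> Z" for w
    using zorder_pos_iff[OF hol(1,2), of w] that sub eventually_frequently[OF _ eventually_nonzero_at[OF hol nz, of w]]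
    by (auto simp: Z_def)
  have P0: "P z = 0 \<longleftrightarrow> z \<in> Z" for z
    using fin ord by (auto simp: P_def)
  have zP: "zorder f z = zorder P z" if "z \<in> ball a R" for z
  proof (cases "z \<in> Z")
    case True
    have "zorder P z = zorder f z"
    proof (rule zorder_eqI[of UNIV z "\<lambda>u. \<Prod>w\<in>Z - {z}. (u - w) ^ nat (zorder f w)"])
      show "(\<Prod>w\<in>Z - {z}. (z - w) ^ nat (zorder f w)) \<noteq> 0"
        using fin by auto
      show "P u = (\<Prod>w\<in>Z - {z}. (u - w) ^ nat (zorder f w)) * (u - z) powi zorder f z" for u
        using fin True ord[OF True] by (simp add: P_def prod.remove[of Z z] power_int_def)
    qed (auto intro!: holomorphic_intros)
    then show ?thesis by simp
  next
    case False
    have "zorder f z = 0"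
      using that False holf by (intro zorder_eq_0I) (auto simp: Z_def analytic_at intro!: exI[of _ "ball a R"])
    moreover have "zorder P z = 0"
      using False P0 holP[of UNIV] by (intro zorder_eq_0I) (auto simp: analytic_on_open analytic_at)
    ultimately show ?thesis by simp
  qed
  obtain h where h: "h holomorphic_on ball a R" "\<And>z. z \<in> ball a R \<Longrightarrow> h z \<noteq> 0"
    "\<And>z. z \<in> ball a R \<Longrightarrow> f z = h z * P z"
  proof (rule holomorphic_zorder_factorization[OF holf _ _ holP[of "ball a R"]])
    show "P z = 0 \<longleftrightarrow> f z = 0" if "z \<in> ball a R" for z
      using that P0 by (auto simp: Z_def)
    show "zorder P z = zorder f z" if "z \<in> ball a R" for z
      using zP[OF that] by simp
  qed auto
  obtain g where "g holomorphic_on ball a R" "\<And>z. z \<in> ball a R \<Longrightarrow> h z = exp (g z)"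
    using contractible_imp_holomorphic_log[OF h(1) _ h(2)] by (auto intro: convex_imp_contractible)
  then show ?thesis
    using that h by (auto simp: P_def Z_def)
qed

text \<open>Room beyond the closed disc: the factorization can then take place on a larger open
  disc, where zeros on the circle of radius \<open>R\<close> are interior.\<close>

lemma cball_subset_open_enlarge:
  fixes a :: "'a::euclidean_space"
  assumes hol: "open S" and R: "R > 0" "cball a R \<subseteq> S"
  obtains e where "e > 0" "cball a (R + e) \<subseteq> S"
proof -
  obtain e where e: "e > 0" "(\<Union>x\<in>cball a R. cball x e) \<subseteq> S"
    using compact_subset_open_imp_cball_epsilon_subset[OF compact_cball hol R(2)] by auto
  have "cball a (R + e) \<subseteq> (\<Union>x\<in>cball a R. cball x e)"
  proof
    fix z assume z: "z \<in> cball a (R + e)"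
    show "z \<in> (\<Union>x\<in>cball a R. cball x e)"
    proof (cases "z \<in> cball a R")
      case True
      then show ?thesis using e by (intro UN_I[of z]) auto
    next
      case False
      then have d: "dist a z > R" by auto
      \<comment> \<open>The radial projection of \<open>z\<close> onto the sphere of radius
        \<open>R\<close>.\<close>
      define x where "x = a + (R / dist a z) *\<^sub>R (z - a)"
      have "dist a x = R" using d R by (cases "z = a") (simp_all add: x_def dist_norm norm_minus_commute)
      have "z - x = (1 - R / dist a z) *\<^sub>R (z - a)" by (simp add: x_def algebra_simps)
      then have "dist x z = \<bar>1 - R / dist a z\<bar> * dist a z"
        by (metis dist_norm norm_minus_commute norm_scaleR)
      moreover have "R / dist a z < 1" using d R by (subst divide_less_eq_1_pos) linarith+
      ultimately have "dist x z = (1 - R / dist a z) * dist a z" by (simp add: mult.commute)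
      also have "\<dots> = dist a z - R" using d R by (cases "z = a") (simp_all add: left_diff_distrib)
      finally have "dist x z = dist a z - R" .
      with \<open>dist a x = R\<close> show ?thesis using z by (auto intro!: bexI[of _ x])
    qed
  qed
  then show ?thesis using e that[of e] by auto
qed

text \<open>In the factored form Re g averages to its central value \<open>u\<close>, and every ln
  |z - w| averages to ln max(|z - a|, |w - a|). \<open>Z\<close> and \<open>u\<close> do not depend
  on the weight \<open>p\<close>, so that ln |f a| can be compared with the integrals.
  \<open>Z\<close> may contain zeros just outside the disc; there the maximum is the constant |w -
  a|.\<close>

lemma jensen_radial:
  assumes hol: "f holomorphic_on S" "open S" "connected S" and nz: "z0 \<in> S" "f z0 \<noteq> 0"
    and R: "R > 0" "cball a R \<subseteq> S"
  obtains Z u where "finite Z" "{w \<in> cball a R. f w = 0} \<subseteq> Z" "\<forall>w\<in>Z. f w = 0 \<and> zorder f w > 0"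
    "\<forall>p C. p \<in> borel_measurable borel \<longrightarrow> (\<forall>r. \<bar>p r\<bar> \<le> C) \<longrightarrow>
       set_integrable lborel (ball a R) (\<lambda>z. p (cmod (z - a)) * ln (cmod (f z))) \<and>
       (LINT z:ball a R|lborel. p (cmod (z - a)) * ln (cmod (f z))) =
         u * (LINT z:ball (0::complex) R|lborel. p (cmod z)) +
         (\<Sum>w\<in>Z. zorder f w * (LINT z:ball (0::complex) R|lborel. p (cmod z) * ln (max (cmod z) (cmod (w - a)))))"
    "f a \<noteq> 0 \<longrightarrow> ln (cmod (f a)) = u + (\<Sum>w\<in>Z. zorder f w * ln (cmod (w - a)))"
proof -
  obtain e where e: "e > 0" "cball a (R + e) \<subseteq> S"
    using cball_subset_open_enlarge[OF hol(2) R] .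
  define Z where "Z = {w \<in> ball a (R + e). f w = 0}"
  have fin: "finite Z"
    by (rule finite_subset[OF _ finite_zeros_ball[OF hol e(2) nz]]) (auto simp: Z_def)
  have ord: "f w = 0 \<and> zorder f w > 0" if "w \<in> Z" for w
  proof -
    have "w \<in> S" using that e(2) by (auto simp: Z_def)
    then show ?thesis
      using zorder_pos_iff[OF hol(1,2), of w] that eventually_frequently[OF _ eventually_nonzero_at[OF hol nz, of w]]
      by (auto simp: Z_def)
  qed
  obtain g where g: "g holomorphic_on ball a (R + e)"
    "\<And>z. z \<in> ball a (R + e) \<Longrightarrow> f z = exp (g z) * (\<Prod>w\<in>Z. (z - w) ^ nat (zorder f w))"
    using holomorphic_zero_factorization[OF hol nz _ e(2)] R e unfolding Z_def by auto
  have lnf: "ln (cmod (f z)) = Re (g z) + (\<Sum>w\<in>Z. zorder f w * ln (cmod (z - w)))"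
    if "z \<in> ball a (R + e)" "z \<notin> Z" for z
  proof -
    have "ln (cmod (f z)) = ln (exp (Re (g z))) + ln (\<Prod>w\<in>Z. cmod (z - w) ^ nat (zorder f w))"
      unfolding g(2)[OF that(1)] norm_mult norm_exp_eq_Re prod_norm[symmetric] norm_power
      using that fin by (intro ln_mult_pos) (auto intro!: prod_pos zero_less_power simp: zero_less_norm_iff)
    also have "ln (\<Prod>w\<in>Z. cmod (z - w) ^ nat (zorder f w)) = (\<Sum>w\<in>Z. ln (cmod (z - w) ^ nat (zorder f w)))"
      using that fin by (intro ln_prod) auto
    also have "\<dots> = (\<Sum>w\<in>Z. zorder f w * ln (cmod (z - w)))"
    proof (intro sum.cong refl)
      fix w assume w: "w \<in> Z"
      with that ord[OF w] have "z \<noteq> w" "real (nat (zorder f w)) = zorder f w" by auto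
      then show "ln (cmod (z - w) ^ nat (zorder f w)) = zorder f w * ln (cmod (z - w))"
        by (simp add: ln_realpow)
    qed
    finally show ?thesis by simp
  qed
  show ?thesis
  proof (rule that[of Z "Re (g a)"])
    show "{w \<in> cball a R. f w = 0} \<subseteq> Z" using e by (auto simp: Z_def)
    show "f a \<noteq> 0 \<longrightarrow> ln (cmod (f a)) = Re (g a) + (\<Sum>w\<in>Z. zorder f w * ln (cmod (w - a)))"
      using lnf[of a] R e by (auto simp: Z_def norm_minus_commute)
  next
    show "\<forall>p C. p \<in> borel_measurable borel \<longrightarrow> (\<forall>r. \<bar>p r\<bar> \<le> C) \<longrightarrow>
       set_integrable lborel (ball a R) (\<lambda>z. p (cmod (z - a)) * ln (cmod (f z))) \<and>
       (LINT z:ball a R|lborel. p (cmod (z - a)) * ln (cmod (f z))) =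
         Re (g a) * (LINT z:ball (0::complex) R|lborel. p (cmod z)) +
         (\<Sum>w\<in>Z. zorder f w * (LINT z:ball (0::complex) R|lborel. p (cmod z) * ln (max (cmod z) (cmod (w - a)))))"
    proof (intro allI impI)
    fix p :: "real \<Rightarrow> real" and C
    assume p [measurable]: "p \<in> borel_measurable borel" and "\<forall>r. \<bar>p r\<bar> \<le> C"
    then have bd: "\<bar>p r\<bar> \<le> C" for r by blast
    note am = holomorphic_area_mean[OF g(1) R(1) _ p bd]
    have i1: "set_integrable lborel (ball 0 R) (\<lambda>z. p (cmod z) * Re (g (a + z)))"
      using integrable_Re[OF am(1)[unfolded set_integrable_def]] e by (simp add: set_integrable_def mult.assoc)
    have v1: "(LINT z:ball 0 R|lborel. p (cmod z) * Re (g (a + z))) = Re (g a) * (LINT z:ball (0::complex) R|lborel. p (cmod z))"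
      using arg_cong[OF am(2), of Re] integral_Re[OF am(1)[unfolded set_integrable_def]] e
      by (simp add: set_lebesgue_integral_def mult.assoc) (simp add: mult_ac)?
    have i2: "set_integrable lborel (ball 0 R) (\<lambda>z. p (cmod z) * ln (cmod (z - (w - a))))" for w
      by (rule set_integrable_bounded_mult[where C=C, OF set_integrable_ln_cmod_diff]) (use bd in auto)
    have v2: "(LINT z:ball 0 R|lborel. p (cmod z) * ln (cmod (z - (w - a)))) =
       (LINT z:ball (0::complex) R|lborel. p (cmod z) * ln (max (cmod z) (cmod (w - a))))" for w
      by (rule integral_radial_ln_cmod_diff[OF p bd])
    define Q where "Q = (\<lambda>z. p (cmod z) * Re (g (a + z)) + (\<Sum>w\<in>Z. zorder f w * (p (cmod z) * ln (cmod (z - (w - a))))))"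
    have i3: "set_integrable lborel (ball 0 R) Q"
      unfolding Q_def by (intro set_integral_add i1 set_integrable_mult_right i2 set_integral_sum(1) fin)
    have v3: "(LINT z:ball 0 R|lborel. Q z) = Re (g a) * (LINT z:ball (0::complex) R|lborel. p (cmod z)) +
         (\<Sum>w\<in>Z. zorder f w * (LINT z:ball (0::complex) R|lborel. p (cmod z) * ln (max (cmod z) (cmod (w - a)))))"
    proof -
      have "(LINT z:ball 0 R|lborel. Q z) = (LINT z:ball 0 R|lborel. p (cmod z) * Re (g (a + z))) +
         (LINT z:ball 0 R|lborel. (\<Sum>w\<in>Z. zorder f w * (p (cmod z) * ln (cmod (z - (w - a))))))"
        unfolding Q_def by (intro set_integral_add i1 set_integrable_mult_right i2 set_integral_sum(1) fin)
      also have "(LINT z:ball 0 R|lborel. (\<Sum>w\<in>Z. zorder f w * (p (cmod z) * ln (cmod (z - (w - a)))))) =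
        (\<Sum>w\<in>Z. (LINT z:ball 0 R|lborel. zorder f w * (p (cmod z) * ln (cmod (z - (w - a))))))"
        by (intro set_integral_sum(2) fin set_integrable_mult_right i2)
      finally show ?thesis by (simp add: v1 v2)
    qed
    define L where "L = (\<lambda>z. indicat_real (ball 0 R) z *\<^sub>R (p (cmod z) * ln (cmod (f (a + z)))))"
    have eq: "L z = indicat_real (ball 0 R) z *\<^sub>R Q z" if "z \<notin> (\<lambda>w. w - a) ` Z" for z
    proof (cases "z \<in> ball 0 R")
      case True
      have "a + z \<notin> Z" using that by (force simp: image_iff)
      moreover have "a + z \<in> ball a (R + e)" using True e by (auto simp: dist_norm)
      ultimately have "ln (cmod (f (a + z))) = Re (g (a + z)) + (\<Sum>w\<in>Z. zorder f w * ln (cmod (z - (w - a))))"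
        using lnf[of "a + z"] by (simp add: algebra_simps)
      then show ?thesis
        using True by (simp add: L_def Q_def distrib_left sum_distrib_left mult_ac)
    qed (simp add: L_def)
    have AE: "AE z in lborel. L z = indicat_real (ball 0 R) z *\<^sub>R Q z"
    proof -
      have "AE z in lborel. z \<notin> (\<lambda>w. w - a) ` Z"
        using AE_not_in[OF finite_imp_null_set_lborel[OF finite_imageI[OF fin]]] .
      then show ?thesis by eventually_elim (rule eq)
    qed
    have Lm: "L \<in> borel_measurable lborel"
    proof -
      have "(\<lambda>z. f (a + z)) holomorphic_on ball 0 R"
      proof (rule holomorphic_on_compose_gen[of "\<lambda>z. a + z" "ball 0 R" f S, unfolded o_def])
        show "(\<lambda>z. a + z) ` ball 0 R \<subseteq> S" using R(2) by (auto simp: dist_norm)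
      qed (use hol(1) in \<open>auto intro!: holomorphic_intros\<close>)
      then have "continuous_on (ball 0 R) (\<lambda>z. f (a + z))"
        by (rule holomorphic_on_imp_continuous_on)
      then have m: "(\<lambda>z. indicat_real (ball 0 R) z *\<^sub>R f (a + z)) \<in> borel_measurable borel"
        by (intro borel_measurable_continuous_on_indicator) auto
      have [measurable]: "ball (0::complex) R \<in> sets borel" by simp
      have "L = (\<lambda>z. indicat_real (ball 0 R) z *\<^sub>R (p (cmod z) * ln (cmod (indicat_real (ball 0 R) z *\<^sub>R f (a + z)))))"
        by (auto simp: L_def indicator_def fun_eq_iff)
      also have "\<dots> \<in> borel_measurable lborel" using m by measurable
      finally show ?thesis .
    qed
    have iL: "integrable lborel L"
      using i3 integrable_cong_AE[OF Lm _ AE] borel_measurable_integrable[OF i3[unfolded set_integrable_def]]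
      unfolding set_integrable_def by auto
    have vL: "integral\<^sup>L lborel L = (LINT z:ball 0 R|lborel. Q z)"
      using integral_cong_AE[OF Lm borel_measurable_integrable[OF i3[unfolded set_integrable_def]] AE]
      unfolding set_lebesgue_integral_def .
    show "set_integrable lborel (ball a R) (\<lambda>z. p (cmod (z - a)) * ln (cmod (f z))) \<and>
       (LINT z:ball a R|lborel. p (cmod (z - a)) * ln (cmod (f z))) =
         Re (g a) * (LINT z:ball (0::complex) R|lborel. p (cmod z)) +
         (\<Sum>w\<in>Z. zorder f w * (LINT z:ball (0::complex) R|lborel. p (cmod z) * ln (max (cmod z) (cmod (w - a)))))"
      using iL vL v3 unfolding set_integral_ball_translate[of a]
      by (simp add: set_integrable_def set_lebesgue_integral_def L_def)
    qed
  qed (use fin ord in auto)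
qed

text \<open>Compared with the central value, Re g contributes equally, and a zero at distance
  \<open>\<rho>\<close> contributes at least area times ln \<rho>, because ln max(|z|, \<rho>) >= ln
  \<rho>; multiplicities are positive.\<close>

lemma jensen_submean:
  assumes hol: "f holomorphic_on S" "open S" "connected S"
    and R: "R > 0" "cball a R \<subseteq> S" and fa: "f a \<noteq> 0"
  shows "set_integrable lborel (ball a R) (\<lambda>z. ln (cmod (f z)))"
    and "pi * R\<^sup>2 * ln (cmod (f a)) \<le> (LINT z:ball a R|lborel. ln (cmod (f z)))"
proof -
  have aS: "a \<in> S" using R by auto
  obtain Z u where Z: "finite Z" "{w \<in> cball a R. f w = 0} \<subseteq> Z" "\<forall>w\<in>Z. f w = 0 \<and> zorder f w > 0"
    and p: "\<forall>p C. p \<in> borel_measurable borel \<longrightarrow> (\<forall>r. \<bar>p r\<bar> \<le> C) \<longrightarrow>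
       set_integrable lborel (ball a R) (\<lambda>z. p (cmod (z - a)) * ln (cmod (f z))) \<and>
       (LINT z:ball a R|lborel. p (cmod (z - a)) * ln (cmod (f z))) =
         u * (LINT z:ball (0::complex) R|lborel. p (cmod z)) +
         (\<Sum>w\<in>Z. zorder f w * (LINT z:ball (0::complex) R|lborel. p (cmod z) * ln (max (cmod z) (cmod (w - a)))))"
    and u: "f a \<noteq> 0 \<longrightarrow> ln (cmod (f a)) = u + (\<Sum>w\<in>Z. zorder f w * ln (cmod (w - a)))"
    by (rule jensen_radial[OF hol aS fa R])
  note p1 = p[rule_format, of "\<lambda>_. 1" 1, simplified]
  show "set_integrable lborel (ball a R) (\<lambda>z. ln (cmod (f z)))" using p1 by simp
  have area: "(LINT z:ball (0::complex) R|lborel. 1) = pi * R\<^sup>2"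
    using set_integral_cmod_power(2)[of R 0] R by (simp add: power2_eq_square)
  have ln_le: "pi * R\<^sup>2 * ln \<rho> \<le> (LINT z:ball (0::complex) R|lborel. ln (max (cmod z) \<rho>))" if "\<rho> > 0" for \<rho>
  proof -
    have eq: "(LINT z:ball (0::complex) R|lborel. ln (max (cmod z) \<rho>)) = pi * (R\<^sup>2 * ln (max R \<rho>) - max 0 (R\<^sup>2 - \<rho>\<^sup>2) / 2)"
      using set_integral_cmod_power_ln_max[of R \<rho> 0] R that by (simp add: power2_eq_square)
    have "R\<^sup>2 * ln \<rho> \<le> R\<^sup>2 * ln (max R \<rho>) - max 0 (R\<^sup>2 - \<rho>\<^sup>2) / 2"
    proof (cases "R \<le> \<rho>")
      case True
      then have "R\<^sup>2 \<le> \<rho>\<^sup>2" using R by (intro power_mono) auto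
      then show ?thesis using True by (simp add: max_def)
    next
      case False
      then have "\<rho>\<^sup>2 < R\<^sup>2" using that by (intro power_strict_mono) auto
      \<comment> \<open>For \<rho> < R the closed form of the integral leaves the inequality ln t <=
        t - 1 at t = (\<rho> / R)^2.\<close>
      have "ln ((\<rho> / R)\<^sup>2) \<le> (\<rho> / R)\<^sup>2 - 1"
        using that R by (intro ln_le_minus_one) auto
      also have "ln ((\<rho> / R)\<^sup>2) = 2 * (ln \<rho> - ln R)"
        using that R by (simp add: ln_realpow ln_div)
      finally have "R\<^sup>2 * (2 * (ln \<rho> - ln R)) \<le> R\<^sup>2 * ((\<rho> / R)\<^sup>2 - 1)"
        by (intro mult_left_mono) auto
      also have "\<dots> = \<rho>\<^sup>2 - R\<^sup>2" using R by (simp add: power_divide algebra_simps)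
      finally show ?thesis using False \<open>\<rho>\<^sup>2 < R\<^sup>2\<close> by (simp add: max_def field_simps)
    qed
    then show ?thesis unfolding eq by (simp add: mult.assoc)
  qed
  have "pi * R\<^sup>2 * ln (cmod (f a)) = pi * R\<^sup>2 * u + (\<Sum>w\<in>Z. zorder f w * (pi * R\<^sup>2 * ln (cmod (w - a))))"
    unfolding u[rule_format, OF fa] distrib_left sum_distrib_left by (simp add: mult_ac)
  also have "\<dots> \<le> pi * R\<^sup>2 * u + (\<Sum>w\<in>Z. zorder f w * (LINT z:ball (0::complex) R|lborel. ln (max (cmod z) (cmod (w - a)))))"
    using Z(3) fa by (intro add_left_mono sum_mono mult_left_mono ln_le) (auto intro: less_imp_le)
  also have "\<dots> = (LINT z:ball a R|lborel. ln (cmod (f z)))"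
    using p1 area by (simp add: mult.commute)
  finally show "pi * R\<^sup>2 * ln (cmod (f a)) \<le> (LINT z:ball a R|lborel. ln (cmod (f z)))" .
qed

text \<open>The weight \<open>16 r\<^sup>2 - 8 R\<^sup>2\<close> is the Laplacian of \<open>(R\<^sup>2 - r\<^sup>2)\<^sup>2\<close>.\<close>

lemma jensen_test_function:
  assumes hol: "f holomorphic_on S" "open S" "connected S" and nz: "z0 \<in> S" "f z0 \<noteq> 0"
    and R: "R > 0" "cball a R \<subseteq> S"
  shows "set_integrable lborel (ball a R) (\<lambda>z. (16 * (cmod (z - a))\<^sup>2 - 8 * R\<^sup>2) * ln (cmod (f z)))"
    and "(LINT z:ball a R|lborel. (16 * (cmod (z - a))\<^sup>2 - 8 * R\<^sup>2) * ln (cmod (f z))) =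
      2 * pi * (\<Sum>w\<in>{w \<in> ball a R. f w = 0}. zorder f w * (R\<^sup>2 - (cmod (w - a))\<^sup>2)\<^sup>2)"
proof -
  obtain Z u where Z: "finite Z" "{w \<in> cball a R. f w = 0} \<subseteq> Z" "\<forall>w\<in>Z. f w = 0 \<and> zorder f w > 0"
    and p: "\<forall>p C. p \<in> borel_measurable borel \<longrightarrow> (\<forall>r. \<bar>p r\<bar> \<le> C) \<longrightarrow>
       set_integrable lborel (ball a R) (\<lambda>z. p (cmod (z - a)) * ln (cmod (f z))) \<and>
       (LINT z:ball a R|lborel. p (cmod (z - a)) * ln (cmod (f z))) =
         u * (LINT z:ball (0::complex) R|lborel. p (cmod z)) +
         (\<Sum>w\<in>Z. zorder f w * (LINT z:ball (0::complex) R|lborel. p (cmod z) * ln (max (cmod z) (cmod (w - a)))))"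
    by (rule jensen_radial[OF hol nz R])
  \<comment> \<open>Cutting the weight off outside the disc makes it bounded on the whole line, as
    \<open>jensen_radial\<close> asks.\<close>
  define k where "k = (\<lambda>r::real. if \<bar>r\<bar> \<le> R then 16 * r\<^sup>2 - 8 * R\<^sup>2 else 0)"
  have kb: "\<bar>k r\<bar> \<le> 24 * R\<^sup>2" for r
  proof (cases "\<bar>r\<bar> \<le> R")
    case True
    then have "r\<^sup>2 \<le> R\<^sup>2" using R by (intro abs_le_square_iff[THEN iffD1]) auto
    then show ?thesis using True by (auto simp: k_def abs_if)
  qed (simp add: k_def)
  have km: "k \<in> borel_measurable borel" unfolding k_def by measurable
  have cong: "(LINT z:ball a R|lborel. (16 * (cmod (z - a))\<^sup>2 - 8 * R\<^sup>2) * ln (cmod (f z))) = (LINT z:ball a R|lborel. k (cmod (z - a)) * ln (cmod (f z)))"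
    by (rule set_lebesgue_integral_cong) (auto simp: k_def dist_norm norm_minus_commute)
  show "set_integrable lborel (ball a R) (\<lambda>z. (16 * (cmod (z - a))\<^sup>2 - 8 * R\<^sup>2) * ln (cmod (f z)))"
    using p[rule_format, OF km kb] by (elim conjE set_integrable_cong[THEN iffD1, rotated -1]) (auto simp: k_def dist_norm norm_minus_commute)
  have kcong: "(LINT z:ball 0 R|lborel. k (cmod z) * F z) = 16 * (LINT z:ball 0 R|lborel. cmod z ^ 2 * F z) - 8 * R\<^sup>2 * (LINT z:ball 0 R|lborel. F z)"
    if "set_integrable lborel (ball 0 R) F" for F :: "complex \<Rightarrow> real"
  proof -
    have i: "set_integrable lborel (ball 0 R) (\<lambda>z. cmod z ^ 2 * F z)"
    proof -
      have "set_integrable lborel (ball 0 R) (\<lambda>z. (min (cmod z) R) ^ 2 * F z)"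
        by (rule set_integrable_bounded_mult[where C="R\<^sup>2", OF that]) (use R in \<open>auto intro!: power_mono\<close>)
      then show ?thesis by (rule set_integrable_cong[THEN iffD1, rotated -1]) auto
    qed
    have "(LINT z:ball 0 R|lborel. k (cmod z) * F z) = (LINT z:ball 0 R|lborel. 16 * (cmod z ^ 2 * F z) - 8 * R\<^sup>2 * F z)"
      by (rule set_lebesgue_integral_cong) (auto simp: k_def left_diff_distrib)
    also have "\<dots> = 16 * (LINT z:ball 0 R|lborel. cmod z ^ 2 * F z) - 8 * R\<^sup>2 * (LINT z:ball 0 R|lborel. F z)"
      using i that by (subst set_integral_diff) auto
    finally show ?thesis .
  qed
  have one: "set_integrable lborel (ball (0::complex) R) (\<lambda>z. 1::real)"
    using set_integral_cmod_power(1)[of R 0] R by simp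
  \<comment> \<open>The weight has mean zero over the disc, so the unknown central value
    \<open>u\<close> disappears.\<close>
  have k0: "(LINT z:ball (0::complex) R|lborel. k (cmod z)) = 0"
    using kcong[OF one] set_integral_cmod_power(2)[of R 2] set_integral_cmod_power(2)[of R 0] R
    by (simp add: eval_nat_numeral) (simp add: mult_ac)
  \<comment> \<open>The function (R^2 - r^2)^2 vanishes together with its derivative at r = R, so no
    boundary terms arise. For \<rho> >= R the logarithm is constant on the disc and is killed by the
    mean zero.\<close>
  have kl: "(LINT z:ball (0::complex) R|lborel. k (cmod z) * ln (max (cmod z) \<rho>)) = 2 * pi * (if \<rho> < R then (R\<^sup>2 - \<rho>\<^sup>2)\<^sup>2 else 0)"
    if \<rho>: "\<rho> \<ge> 0" for \<rho>
  proof -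
    have "(LINT z:ball (0::complex) R|lborel. k (cmod z) * ln (max (cmod z) \<rho>)) =
      16 * (2 * pi / 4 * (R ^ 4 * ln (max R \<rho>) - max 0 (R ^ 4 - \<rho> ^ 4) / 4)) - 8 * R\<^sup>2 * (2 * pi / 2 * (R ^ 2 * ln (max R \<rho>) - max 0 (R ^ 2 - \<rho> ^ 2) / 2))"
      using kcong[OF set_integrable_ln_max[of R \<rho>]] set_integral_cmod_power_ln_max[OF R(1) \<rho>, of 2] set_integral_cmod_power_ln_max[OF R(1) \<rho>, of 0]
      by (simp add: eval_nat_numeral)
    also have "\<dots> = 2 * pi * (if \<rho> < R then (R\<^sup>2 - \<rho>\<^sup>2)\<^sup>2 else 0)"
    proof (cases "\<rho> < R")
      case True
      have "\<rho> ^ 4 < R ^ 4" "\<rho>\<^sup>2 < R\<^sup>2" using True \<rho> by (intro power_strict_mono; simp)+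
      then show ?thesis using True
        by (simp add: max_def; simp add: field_simps power2_eq_square eval_nat_numeral)
    next
      case False
      have "\<rho> ^ 4 \<ge> R ^ 4" "\<rho>\<^sup>2 \<ge> R\<^sup>2" using False R by (intro power_mono; simp)+
      then show ?thesis using False
        by (simp add: max_def; simp add: field_simps power2_eq_square eval_nat_numeral)
    qed
    finally show ?thesis .
  qed
  have "(LINT z:ball a R|lborel. k (cmod (z - a)) * ln (cmod (f z))) = (\<Sum>w\<in>Z. zorder f w * (2 * pi * (if cmod (w - a) < R then (R\<^sup>2 - (cmod (w - a))\<^sup>2)\<^sup>2 else 0)))"
    using p[rule_format, OF km kb] by (simp add: k0 kl)
  also have "\<dots> = (\<Sum>w\<in>{w \<in> ball a R. f w = 0}. zorder f w * (2 * pi * (R\<^sup>2 - (cmod (w - a))\<^sup>2)\<^sup>2))"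
    using Z by (intro sum.mono_neutral_cong_right) (auto simp: dist_norm norm_minus_commute)
  finally show "(LINT z:ball a R|lborel. (16 * (cmod (z - a))\<^sup>2 - 8 * R\<^sup>2) * ln (cmod (f z))) =
      2 * pi * (\<Sum>w\<in>{w \<in> ball a R. f w = 0}. zorder f w * (R\<^sup>2 - (cmod (w - a))\<^sup>2)\<^sup>2)"
    unfolding cong by (simp add: sum_distrib_left mult_ac)
qed

text \<open>The mean value property of the holomorphic function f^2, followed by the triangle
  inequality for integrals.\<close>

lemma submean_cmod_square:
  assumes hol: "f holomorphic_on S" "open S" and R: "R > 0" "cball a R \<subseteq> S"
  shows "set_integrable lborel (ball a R) (\<lambda>z. (cmod (f z))\<^sup>2)"
    and "pi * R\<^sup>2 * (cmod (f a))\<^sup>2 \<le> (LINT z:ball a R|lborel. (cmod (f z))\<^sup>2)"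
proof -
  obtain e where e: "e > 0" "cball a (R + e) \<subseteq> S"
    using cball_subset_open_enlarge[OF hol(2) R] .
  show i: "set_integrable lborel (ball a R) (\<lambda>z. (cmod (f z))\<^sup>2)"
  proof -
    have "continuous_on (cball a R) f"
      using hol(1) R(2) holomorphic_on_imp_continuous_on continuous_on_subset by blast
    then have "set_integrable lborel (cball a R) (\<lambda>z. (cmod (f z))\<^sup>2)"
      unfolding set_integrable_def by (intro borel_integrable_compact continuous_intros) auto
    then show ?thesis by (rule set_integrable_subset) auto
  qed
  have h: "(\<lambda>z. (f z)\<^sup>2) holomorphic_on ball a (R + e)"
    using holomorphic_on_subset[OF hol(1), of "ball a (R + e)"] e(2) ball_subset_cball by (intro holomorphic_intros) blast
  have area: "(LINT z:ball (0::complex) R|lborel. 1) = pi * R\<^sup>2"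
    using set_integral_cmod_power(2)[of R 0] R by (simp add: power2_eq_square)
  have mean: "(LINT z:ball a R|lborel. (f z)\<^sup>2) = (pi * R\<^sup>2) *\<^sub>R (f a)\<^sup>2"
    using holomorphic_area_mean(2)[OF h R(1) _, of "\<lambda>_. 1" 1] e area by (simp add: set_integral_ball_translate[of a])
  have int: "set_integrable lborel (ball a R) (\<lambda>z. (f z)\<^sup>2)"
    using holomorphic_area_mean(1)[OF h R(1) _, of "\<lambda>_. 1" 1] e by (simp add: set_integral_ball_translate[of a])
  have "pi * R\<^sup>2 * (cmod (f a))\<^sup>2 = norm (LINT z:ball a R|lborel. (f z)\<^sup>2)"
    unfolding mean by (simp add: norm_power)
  also have "\<dots> \<le> (LINT z:ball a R|lborel. (cmod (f z))\<^sup>2)"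
    using set_integral_norm_bound[OF int] by (simp add: norm_power)
  finally show "pi * R\<^sup>2 * (cmod (f a))\<^sup>2 \<le> (LINT z:ball a R|lborel. (cmod (f z))\<^sup>2)" .
qed

subsection \<open>Equidistribution of mass forces equidistribution of zeros\<close>

lemma compact_cball_neighbourhood:
  fixes K :: "'a::euclidean_space set"
  assumes "compact K" "open S" "K \<subseteq> S"
  obtains \<delta> K' where "\<delta> > 0" "compact K'" "K' \<subseteq> S" "\<And>a. a \<in> K \<Longrightarrow> cball a \<delta> \<subseteq> K'"
proof -
  obtain \<delta> where \<delta>: "\<delta> > 0" "(\<Union>x\<in>K. cball x \<delta>) \<subseteq> S"
    using compact_subset_open_imp_cball_epsilon_subset[OF assms] .
  define K' where "K' = {x + y |x y. x \<in> K \<and> y \<in> cball 0 \<delta>}"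
  have "K' = (\<Union>x\<in>K. cball x \<delta>)"
    unfolding K'_def
  proof (intro equalityI subsetI)
    fix z assume "z \<in> (\<Union>x\<in>K. cball x \<delta>)"
    then obtain x where "x \<in> K" "dist x z \<le> \<delta>" by auto
    then show "z \<in> {x + y |x y. x \<in> K \<and> y \<in> cball 0 \<delta>}"
      by (intro CollectI exI[of _ x] exI[of _ "z - x"]) (auto simp: dist_norm norm_minus_commute)
  next
    fix z assume "z \<in> {x + y |x y. x \<in> K \<and> y \<in> cball 0 \<delta>}"
    then obtain x y where "z = x + y" "x \<in> K" "norm y \<le> \<delta>" by auto
    then show "z \<in> (\<Union>x\<in>K. cball x \<delta>)" by (intro UN_I[of x]) (auto simp: dist_norm)
  qed
  moreover have "compact K'" unfolding K'_def by (intro compact_sums assms compact_cball)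
  ultimately show ?thesis using that[of \<delta> K'] \<delta> by auto
qed

text \<open>A piecewise linear function of the distance to \<open>K\<close> will do, since the weak
  limits are tested on continuous functions.\<close>

lemma bump_function:
  fixes K :: "'a::euclidean_space set"
  assumes "compact K" "open S" "K \<subseteq> S"
  obtains \<eta> :: "'a \<Rightarrow> real" and K' where "continuous_on UNIV \<eta>" "\<And>z. 0 \<le> \<eta> z" "\<And>z. z \<in> K \<Longrightarrow> \<eta> z = 1"
    "compact K'" "K' \<subseteq> S" "\<And>z. z \<notin> K' \<Longrightarrow> \<eta> z = 0"
proof (cases "K = {}")
  case True
  then show ?thesis using that[of "\<lambda>_. 0" "{}"] by auto
next
  case False
  obtain \<delta> K' where \<delta>: "\<delta> > 0" "compact K'" "K' \<subseteq> S" "\<And>a. a \<in> K \<Longrightarrow> cball a \<delta> \<subseteq> K'"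
    using compact_cball_neighbourhood[OF assms] by metis
  show ?thesis
  proof (rule that[of "\<lambda>z. max 0 (1 - infdist z K / \<delta>)" K'])
    show "continuous_on UNIV (\<lambda>z. max 0 (1 - infdist z K / \<delta>))"
      using \<delta>(1) by (intro continuous_intros) auto
    fix z assume "z \<notin> K'"
    obtain x where "x \<in> K" "infdist z K = dist z x"
      using infdist_attains_inf[OF compact_imp_closed[OF assms(1)] False] by metis
    moreover have "\<not> dist x z \<le> \<delta>" using \<delta>(4)[OF \<open>x \<in> K\<close>] \<open>z \<notin> K'\<close> by auto
    ultimately have "infdist z K \<ge> \<delta>" by (simp add: dist_commute)
    then show "max 0 (1 - infdist z K / \<delta>) = 0" using \<delta>(1) by simp
  qed (use \<delta> in auto)
qed

lemma ln_one_plus_lower: "\<bar>x\<bar> \<le> 1 / 2 \<Longrightarrow> x - 2 * x\<^sup>2 \<le> ln (1 + x)" for x :: real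
  using abs_ln_one_plus_x_minus_x_bound[of x] by (simp add: abs_le_iff)

text \<open>The derivative of the remainder is t^2 / (1 + t), at most 2 x^2 for |t| <= |x| <= 1/2.
  The expansion must reach second order: the quadratic term carries the Laplacian of ln y, and only
  the cubic rest may be discarded.\<close>

lemma ln_one_plus_third_order:
  fixes x :: real
  assumes "\<bar>x\<bar> \<le> 1 / 2"
  shows "\<bar>ln (1 + x) - (x - x\<^sup>2 / 2)\<bar> \<le> 2 * \<bar>x\<bar> ^ 3"
proof -
  define g where "g = (\<lambda>t::real. ln (1 + t) - (t - t\<^sup>2 / 2))"
  define I where "I = {- \<bar>x\<bar>..\<bar>x\<bar>}"
  have "norm (g x - g 0) \<le> (2 * x\<^sup>2) * norm (x - 0)"
  proof (rule field_differentiable_bound[of I])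
    fix t assume t: "t \<in> I"
    then have t2: "\<bar>t\<bar> \<le> \<bar>x\<bar>" "1 + t \<ge> 1 / 2" using assms by (auto simp: I_def abs_le_iff)
    have "(g has_field_derivative (1 / (1 + t) - (1 - t))) (at t within I)"
      unfolding g_def using t2 by (auto intro!: derivative_eq_intros)
    also have "1 / (1 + t) - (1 - t) = t\<^sup>2 / (1 + t)"
      using t2 by (simp add: field_simps power2_eq_square)
    finally show "(g has_field_derivative t\<^sup>2 / (1 + t)) (at t within I)" .
    have "t\<^sup>2 \<le> x\<^sup>2" using t2 by (simp add: abs_le_square_iff)
    have "t\<^sup>2 / (1 + t) \<le> t\<^sup>2 / (1 / 2)" using t2 by (intro divide_left_mono) auto
    also have "\<dots> \<le> 2 * x\<^sup>2" using \<open>t\<^sup>2 \<le> x\<^sup>2\<close> by simp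
    finally show "norm (t\<^sup>2 / (1 + t)) \<le> 2 * x\<^sup>2" using t2 by simp
  qed (auto simp: I_def)
  moreover have "(2 * x\<^sup>2) * norm (x - 0) = 2 * \<bar>x\<bar> ^ 3"
    by (simp add: power2_eq_square power3_eq_cube abs_mult)
  ultimately show ?thesis by (simp add: g_def)
qed

text \<open>Rotation by -1 changes the sign of Im z; rotation by i exchanges the integrals of the
  squares of Re z and Im z, whose sum is |z|^2.\<close>

lemma set_integral_radial_odd_even:
  fixes p :: "real \<Rightarrow> real"
  assumes p: "continuous_on UNIV p" and "R \<ge> 0"
  shows "(LINT z:ball 0 R|lborel. p (cmod z) * Im z) = 0"
    and "(LINT z:ball 0 R|lborel. p (cmod z) * (Im z)\<^sup>2) = (LINT z:ball 0 R|lborel. p (cmod z) * (cmod z)\<^sup>2) / 2"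
proof -
  have int: "set_integrable lborel (ball 0 R) (\<lambda>z. p (cmod z) * q z)" if "continuous_on UNIV q" for q :: "complex \<Rightarrow> real"
  proof -
    have "set_integrable lborel (cball 0 R) (\<lambda>z. p (cmod z) * q z)"
      unfolding set_integrable_def
      by (intro borel_integrable_compact continuous_on_mult continuous_on_compose2[OF p] continuous_on_subset[OF that] continuous_intros) auto
    then show ?thesis by (rule set_integrable_subset) auto
  qed
  have "(LINT z:ball 0 R|lborel. p (cmod z) * Im z) = - (LINT z:ball 0 R|lborel. p (cmod z) * Im z)"
    using integrable_lborel_rotation(2)[of "-1" "\<lambda>z. indicat_real (ball 0 R) z *\<^sub>R (p (cmod z) * Im z)"] int[of Im]
    by (simp add: set_integrable_def set_lebesgue_integral_def indicator_def continuous_intros)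
  then show "(LINT z:ball 0 R|lborel. p (cmod z) * Im z) = 0" by simp
  have "(LINT z:ball 0 R|lborel. p (cmod z) * (Re z)\<^sup>2) = (LINT z:ball 0 R|lborel. p (cmod z) * (Im z)\<^sup>2)"
    using integrable_lborel_rotation(2)[of "\<i>" "\<lambda>z. indicat_real (ball 0 R) z *\<^sub>R (p (cmod z) * (Im z)\<^sup>2)"] int[of "\<lambda>z. (Im z)\<^sup>2"]
    by (simp add: set_integrable_def set_lebesgue_integral_def indicator_def continuous_intros norm_mult)
  moreover have "(LINT z:ball 0 R|lborel. p (cmod z) * (cmod z)\<^sup>2) = (LINT z:ball 0 R|lborel. p (cmod z) * (Re z)\<^sup>2 + p (cmod z) * (Im z)\<^sup>2)"
    by (rule set_lebesgue_integral_cong) (auto simp: cmod_power2 distrib_left)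
  moreover have "\<dots> = (LINT z:ball 0 R|lborel. p (cmod z) * (Re z)\<^sup>2) + (LINT z:ball 0 R|lborel. p (cmod z) * (Im z)\<^sup>2)"
    by (intro set_integral_add int continuous_intros)
  ultimately show "(LINT z:ball 0 R|lborel. p (cmod z) * (Im z)\<^sup>2) = (LINT z:ball 0 R|lborel. p (cmod z) * (cmod z)\<^sup>2) / 2"
    by simp
qed

section \<open>The upper half-plane and means of ln y\<close>

lemma open_upper_half_plane: "open upper_half_plane"
  using open_halfspace_Im_gt[of 0] by (simp add: upper_half_plane_def)

lemma convex_upper_half_plane: "convex upper_half_plane"
  using convex_halfspace_Im_gt[of 0] by (simp add: upper_half_plane_def)

lemma connected_upper_half_plane: "connected upper_half_plane"
  by (rule convex_connected[OF convex_upper_half_plane])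

lemma compact_upper_half_plane_Im_bound:
  assumes "compact K" "K \<subseteq> upper_half_plane"
  obtains y where "y > 0" "\<And>z. z \<in> K \<Longrightarrow> y \<le> Im z"
proof (cases "K = {}")
  case False
  obtain w where "w \<in> K" "\<And>z. z \<in> K \<Longrightarrow> Im w \<le> Im z"
    using continuous_attains_inf[OF assms(1) False, of Im] continuous_on_Im[OF continuous_on_id] by auto
  then show ?thesis using that[of "Im w"] assms(2) by (auto simp: upper_half_plane_def)
qed (use that[of 1] in auto)

text \<open>ln y is superharmonic, hence its mean can fall below the central value. The linear
  Taylor term integrates to 0 by symmetry, so the deficit is only quadratic, at most 2 (r / y)^2 per
  unit area.\<close>

lemma set_integral_ln_Im_ball_lower:
  assumes y: "0 < y" "y \<le> Im a" and r: "0 < r" "r \<le> y / 2"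
  shows "pi * r\<^sup>2 * (ln (Im a) - 2 * r\<^sup>2 / y\<^sup>2) \<le> (LINT z:ball a r|lborel. ln (Im z))"
    and "set_integrable lborel (ball a r) (\<lambda>z. ln (Im z))"
proof -
  have Im: "\<bar>Im z - Im a\<bar> \<le> r" if "z \<in> cball a r" for z
    using abs_Im_le_cmod[of "z - a"] that by (simp add: dist_norm norm_minus_commute)
  have "set_integrable lborel (cball a r) (\<lambda>z. ln (Im z))"
    unfolding set_integrable_def
  proof (intro borel_integrable_compact continuous_intros)
    show "\<forall>z\<in>cball a r. Im z \<noteq> 0" using Im y r by fastforce
  qed auto
  then show int: "set_integrable lborel (ball a r) (\<lambda>z. ln (Im z))"
    by (rule set_integrable_subset) auto
  define L where "L = (\<lambda>z. ln (Im a) + Im (z - a) / Im a - 2 * r\<^sup>2 / y\<^sup>2)"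
  have area: "(LINT z:ball (0::complex) r|lborel. 1) = pi * r\<^sup>2"
    using set_integral_cmod_power(2)[of r 0] r by (simp add: power2_eq_square)
  have one: "set_integrable lborel (ball (0::complex) r) (\<lambda>z. 1::real)"
    using set_integral_cmod_power(1)[of r 0] r by simp
  have im: "set_integrable lborel (ball (0::complex) r) Im"
  proof -
    have "set_integrable lborel (cball (0::complex) r) Im"
      unfolding set_integrable_def by (intro borel_integrable_compact continuous_intros) auto
    then show ?thesis by (rule set_integrable_subset) auto
  qed
  have "(LINT z:ball a r|lborel. L z) = (LINT z:ball 0 r|lborel. (ln (Im a) - 2 * r\<^sup>2 / y\<^sup>2) * 1 + (1 / Im a) * Im z)"
    unfolding set_integral_ball_translate(2)[of a] by (rule set_lebesgue_integral_cong) (auto simp: L_def)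
  also have "\<dots> = (ln (Im a) - 2 * r\<^sup>2 / y\<^sup>2) * (pi * r\<^sup>2) + (1 / Im a) * (LINT z:ball 0 r|lborel. Im z)"
    unfolding area[symmetric] set_integral_mult_right[symmetric]
    by (intro set_integral_add(2) set_integrable_mult_right one im)
  also have "(LINT z:ball 0 r|lborel. Im z) = 0"
    using set_integral_radial_odd_even(1)[of "\<lambda>_. 1" r] r by simp
  finally have "pi * r\<^sup>2 * (ln (Im a) - 2 * r\<^sup>2 / y\<^sup>2) = (LINT z:ball a r|lborel. L z)" by simp
  also have "\<dots> \<le> (LINT z:ball a r|lborel. ln (Im z))"
  proof (rule set_integral_mono[OF _ int])
    have "set_integrable lborel (ball 0 r) (\<lambda>z. (ln (Im a) - 2 * r\<^sup>2 / y\<^sup>2) * 1 + (1 / Im a) * Im z)"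
      using one im by (intro set_integral_add set_integrable_mult_right)
    then show "set_integrable lborel (ball a r) L"
      unfolding set_integral_ball_translate(1)[of a]
      by (rule set_integrable_cong[THEN iffD1, rotated -1]) (auto simp: L_def)
    fix z assume "z \<in> ball a r"
    define x where "x = (Im z - Im a) / Im a"
    have v: "\<bar>Im z - Im a\<bar> \<le> r" using Im[of z] \<open>z \<in> ball a r\<close> by auto
    have "\<bar>x\<bar> = \<bar>Im z - Im a\<bar> / Im a" using y by (simp add: x_def)
    also have "\<dots> \<le> r / y" using v y r by (intro frac_le) auto
    finally have x: "\<bar>x\<bar> \<le> r / y" .
    also have "r / y \<le> 1 / 2" using r y by (simp add: field_simps)
    finally have x2: "\<bar>x\<bar> \<le> 1 / 2" .
    have "x\<^sup>2 \<le> (r / y)\<^sup>2" using x r y by (simp add: abs_le_square_iff[symmetric])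
    then have "ln (Im a) + x - 2 * r\<^sup>2 / y\<^sup>2 \<le> ln (Im a) + ln (1 + x)"
      using ln_one_plus_lower[OF x2] by (simp add: power_divide)
    also have "\<dots> = ln (Im a * (1 + x))" using y x2 by (intro ln_mult_pos[symmetric]) auto
    also have "Im a * (1 + x) = Im z" using y by (simp add: x_def field_simps)
    finally show "L z \<le> ln (Im z)" by (simp add: L_def x_def)
  qed
  finally show "pi * r\<^sup>2 * (ln (Im a) - 2 * r\<^sup>2 / y\<^sup>2) \<le> (LINT z:ball a r|lborel. ln (Im z))" .
qed

text \<open>The analytic half on its own: no group acts, and the weak limit is tested on compactly
  supported continuous functions on the upper half-plane against Lebesgue measure. The factor 1 /
  y^2 of the hyperbolic measure can be absorbed into \<open>\<eta>\<close>.\<close>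

locale equidistributed_mass =
  fixes k :: "nat \<Rightarrow> nat" and f :: "nat \<Rightarrow> complex \<Rightarrow> complex" and c :: real
  assumes weight: "filterlim k at_top sequentially"
    and hol: "\<And>n. f n holomorphic_on upper_half_plane"
    and nonzero: "\<And>n. \<exists>z\<in>upper_half_plane. f n z \<noteq> 0"
    and c_pos: "c > 0"
    and mass: "\<And>(\<eta>::complex \<Rightarrow> real) K. \<lbrakk>continuous_on UNIV \<eta>; compact K; K \<subseteq> upper_half_plane; \<And>z. z \<notin> K \<Longrightarrow> \<eta> z = 0\<rbrakk> \<Longrightarrow>
      (\<lambda>n. LINT z|lborel. \<eta> z * (Im z ^ k n * (cmod (f n z))\<^sup>2)) \<longlonglongrightarrow> c * (LINT z|lborel. \<eta> z)"
begin

section \<open>The density, its normalized logarithm, and bounds from above and below\<close>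

definition density_at :: "nat \<Rightarrow> complex \<Rightarrow> real" where
  "density_at n z = Im z ^ k n * (cmod (f n z))\<^sup>2"

text \<open>Since ln 0 = 0, the value at a zero of \<open>f n\<close> is 0 rather than minus
  infinity; in a compact set this concerns finitely many points and no integral.\<close>

definition log_density :: "nat \<Rightarrow> complex \<Rightarrow> real" where
  "log_density n z = ln (density_at n z) / k n"

lemma density_nonneg: "z \<in> upper_half_plane \<Longrightarrow> 0 \<le> density_at n z"
  by (simp add: density_at_def upper_half_plane_def)

lemma continuous_on_f: "continuous_on upper_half_plane (f n)"
  by (rule holomorphic_on_imp_continuous_on[OF hol])

lemma continuous_on_density: "continuous_on upper_half_plane (density_at n)"
  unfolding density_at_def by (intro continuous_intros continuous_on_f)

lemma eventually_weight: "eventually (\<lambda>n. P (k n)) sequentially" if "eventually P at_top"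
  using weight that by (auto simp: filterlim_iff)

lemma weight_pos: "eventually (\<lambda>n. k n > 0) sequentially"
  by (rule eventually_weight) (rule eventually_gt_at_top)

lemma integrable_density:
  assumes "continuous_on UNIV \<eta>" "compact K" "K \<subseteq> upper_half_plane" "\<And>z. z \<notin> K \<Longrightarrow> \<eta> z = 0"
  shows "integrable lborel (\<lambda>z. \<eta> z * density_at n z)"
proof -
  have "integrable lborel (\<lambda>z. indicator K z *\<^sub>R (\<eta> z * density_at n z))"
    by (intro borel_integrable_compact continuous_intros assms continuous_on_subset[OF continuous_on_density]
      continuous_on_subset[OF assms(1)]) (use assms in auto)
  also have "(\<lambda>z. indicator K z *\<^sub>R (\<eta> z * density_at n z)) = (\<lambda>z. \<eta> z * density_at n z)"
    using assms(4) by (auto simp: indicator_def fun_eq_iff)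
  finally show ?thesis .
qed

text \<open>The factor y^k varies too fast for a fixed radius. On discs of radius about 1 / k it
  changes by at most a factor 2 in the direction needed, and there the sub-mean value property of
  |f|^2 applies; the small area costs a factor k^2, which exp(\<epsilon> k) absorbs.\<close>

lemma density_upper_bound:
  fixes \<epsilon> :: real
  assumes K: "compact K" "K \<subseteq> upper_half_plane" and "\<epsilon> > 0"
  shows "eventually (\<lambda>n. \<forall>z\<in>K. density_at n z \<le> exp (\<epsilon> * k n)) sequentially"
proof -
  obtain \<delta> K' where \<delta>: "\<delta> > 0" and K': "compact K'" "K' \<subseteq> upper_half_plane" "\<And>a. a \<in> K \<Longrightarrow> cball a \<delta> \<subseteq> K'"
    using compact_cball_neighbourhood[OF K(1) open_upper_half_plane K(2)] by metis
  obtain y where y: "y > 0" "\<And>z. z \<in> K' \<Longrightarrow> y \<le> Im z"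
    using compact_upper_half_plane_Im_bound[OF K'(1,2)] by metis
  obtain \<eta> :: "complex \<Rightarrow> real" and L where \<eta>: "continuous_on UNIV \<eta>" "\<And>z. 0 \<le> \<eta> z" "\<And>z. z \<in> K' \<Longrightarrow> \<eta> z = 1"
    "compact L" "L \<subseteq> upper_half_plane" "\<And>z. z \<notin> L \<Longrightarrow> \<eta> z = 0"
    using bump_function[OF K'(1) open_upper_half_plane K'(2)] by metis
  define M where "M = c * (LINT z|lborel. \<eta> z) + 1"
  have "eventually (\<lambda>n. (LINT z|lborel. \<eta> z * density_at n z) < M) sequentially"
    using order_tendstoD(2)[OF mass[OF \<eta>(1,4,5,6)], of M] by (simp add: M_def density_at_def)
  \<comment> \<open>\<open>\<delta>\<close> keeps the discs inside \<open>K'\<close>, and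
    \<open>y\<close> makes the radius t / (2 k) at most Im z / (2 k).\<close>
  moreover define t where "t = min \<delta> y"
  have t: "t > 0" using \<delta> y by (simp add: t_def)
  have "eventually (\<lambda>m::nat. 8 * M / (pi * t\<^sup>2) * real m ^ 2 \<le> exp (\<epsilon> * m)) at_top"
    using \<open>\<epsilon> > 0\<close> by real_asymp
  then have "eventually (\<lambda>n. 8 * M / (pi * t\<^sup>2) * real (k n) ^ 2 \<le> exp (\<epsilon> * k n)) sequentially"
    by (rule eventually_weight)
  ultimately show ?thesis using weight_pos
  proof eventually_elim
    case (elim n)
    show ?case
    proof
      fix z assume z: "z \<in> K"
      define r where "r = t / (2 * k n)"
      have r: "r > 0" "r \<le> t" using t elim(3) by (auto simp: r_def field_simps)
      have sub: "cball z r \<subseteq> K'" using K'(3)[OF z] r by (auto simp: t_def)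
      have zK': "z \<in> K'" using sub r by auto
      have half: "Im z ^ k n \<le> 2 * Im w ^ k n" if "w \<in> ball z r" for w
      proof -
        have "\<bar>Im w - Im z\<bar> \<le> r"
          using abs_Im_le_cmod[of "w - z"] that by (simp add: dist_norm norm_minus_commute)
        moreover have "r \<le> Im z / (2 * k n)"
          unfolding r_def using y(2)[OF zK'] by (intro divide_right_mono) (auto simp: t_def)
        ultimately have w: "Im z * (1 - 1 / (2 * k n)) \<le> Im w" by (simp add: algebra_simps)
        have "1 / (2 * real (k n)) \<le> 1" using elim(3) by (simp add: field_simps)
        then have nn: "0 \<le> 1 - 1 / (2 * real (k n))" by simp
        \<comment> \<open>Bernoulli's inequality: (1 - 1 / (2 k))^k >= 1 - 1/2.\<close>
        have "1 / 2 = 1 + real (k n) * (- (1 / (2 * k n)))" using elim(3) by simp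
        also have "\<dots> \<le> (1 + (- (1 / (2 * k n)))) ^ k n"
          using nn by (intro Bernoulli_inequality) auto
        finally have "1 / 2 \<le> (1 - 1 / (2 * k n)) ^ k n" by simp
        then have "Im z ^ k n * (1 / 2) \<le> Im z ^ k n * (1 - 1 / (2 * k n)) ^ k n"
          using y zK' by (intro mult_left_mono zero_le_power) (auto intro: order.trans[of _ y] less_imp_le)
        also have "\<dots> = (Im z * (1 - 1 / (2 * k n))) ^ k n" by (simp add: power_mult_distrib)
        also have "\<dots> \<le> Im w ^ k n"
          using w nn y zK' by (intro power_mono mult_nonneg_nonneg) (auto intro: order.trans[of _ y] less_imp_le)
        finally show ?thesis by simp
      qed
      have sub': "cball z r \<subseteq> upper_half_plane" using sub K'(2) by auto
      note sm = submean_cmod_square[OF hol open_upper_half_plane r(1) sub']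
      have y0: "0 \<le> Im z ^ k n" using y zK' by (intro zero_le_power) (auto intro: order.trans[of _ y] less_imp_le)
      have i: "integrable lborel (\<lambda>z. \<eta> z * density_at n z)"
        by (rule integrable_density[OF \<eta>(1,4,5,6)])
      have "pi * r\<^sup>2 * density_at n z = Im z ^ k n * (pi * r\<^sup>2 * (cmod (f n z))\<^sup>2)"
        by (simp add: density_at_def)
      also have "\<dots> \<le> Im z ^ k n * (LINT w:ball z r|lborel. (cmod (f n w))\<^sup>2)"
        using y0 sm(2) by (rule mult_left_mono[rotated])
      also have "\<dots> = (LINT w:ball z r|lborel. Im z ^ k n * (cmod (f n w))\<^sup>2)"
        by simp
      also have "\<dots> \<le> (LINT w|lborel. 2 * (\<eta> w * density_at n w))"
        unfolding set_lebesgue_integral_def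
      proof (rule Bochner_Integration.integral_mono)
        show "integrable lborel (\<lambda>w. indicat_real (ball z r) w *\<^sub>R (Im z ^ k n * (cmod (f n w))\<^sup>2))"
          using set_integrable_mult_right[OF sm(1)] by (simp add: set_integrable_def)
        show "integrable lborel (\<lambda>w. 2 * (\<eta> w * density_at n w))" using i by simp
        fix w
        show "indicat_real (ball z r) w *\<^sub>R (Im z ^ k n * (cmod (f n w))\<^sup>2) \<le> 2 * (\<eta> w * density_at n w)"
        proof (cases "w \<in> ball z r")
          case True
          then have "w \<in> K'" using sub by auto
          then show ?thesis
            using mult_right_mono[OF half[OF True], of "(cmod (f n w))\<^sup>2"] True \<eta>(3)[of w]
            by (simp add: density_at_def)
        next
          case False
          have "0 \<le> \<eta> w * density_at n w"
          proof (cases "w \<in> L")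
            case True
            then show ?thesis using \<eta>(2,5) density_nonneg by (intro mult_nonneg_nonneg) auto
          qed (simp add: \<eta>(6))
          then show ?thesis using False by simp
        qed
      qed
      also have "\<dots> \<le> 2 * M" using elim(1) by simp
      finally have "density_at n z \<le> 2 * M / (pi * r\<^sup>2)"
        using r by (simp add: field_simps)
      also have "\<dots> = 8 * M / (pi * t\<^sup>2) * real (k n) ^ 2"
        using elim(3) t by (simp add: r_def field_simps power2_eq_square)
      also have "\<dots> \<le> exp (\<epsilon> * k n)" by (rule elim(2))
      finally show "density_at n z \<le> exp (\<epsilon> * k n)" .
    qed
  qed
qed

lemma log_density_eq:
  assumes "z \<in> upper_half_plane" "f n z \<noteq> 0" "k n > 0"
  shows "log_density n z = 2 / k n * ln (cmod (f n z)) + ln (Im z)"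
proof -
  have "Im z > 0" using assms(1) by (simp add: upper_half_plane_def)
  then have "ln (density_at n z) = k n * ln (Im z) + 2 * ln (cmod (f n z))"
    using assms(2) unfolding density_at_def by (subst ln_mult_pos) (auto simp: ln_realpow)
  then show ?thesis using assms(3) by (simp add: log_density_def field_simps)
qed

text \<open>Nothing is known about \<open>f n\<close> off the upper half-plane, hence the
  restriction to it.\<close>

lemma log_density_measurable:
  "set_borel_measurable borel upper_half_plane (log_density n)"
proof -
  have [measurable]: "(\<lambda>z. indicator upper_half_plane z *\<^sub>R density_at n z) \<in> borel_measurable borel"
    using continuous_on_density open_upper_half_plane by (intro borel_measurable_continuous_on_indicator) auto
  have [measurable]: "upper_half_plane \<in> sets borel" using open_upper_half_plane by simp
  have "(\<lambda>z. indicator upper_half_plane z *\<^sub>R (ln (indicator upper_half_plane z *\<^sub>R density_at n z) / k n)) \<in> borel_measurable borel"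
    by measurable
  also have "(\<lambda>z. indicator upper_half_plane z *\<^sub>R (ln (indicator upper_half_plane z *\<^sub>R density_at n z) / k n)) =
     (\<lambda>z. indicator upper_half_plane z *\<^sub>R log_density n z)"
    by (auto simp: indicator_def log_density_def fun_eq_iff)
  finally show ?thesis by (simp add: set_borel_measurable_def)
qed

lemma finite_zeros:
  assumes "compact K" "K \<subseteq> upper_half_plane"
  shows "finite {w \<in> K. f n w = 0}"
proof -
  obtain z0 where z0: "z0 \<in> upper_half_plane" "f n z0 \<noteq> 0" using nonzero by blast
  show ?thesis
  proof (cases "f n constant_on upper_half_plane")
    case True
    then have "{w \<in> K. f n w = 0} = {}" using z0 assms(2) by (auto simp: constant_on_def)
    then show ?thesis by (metis finite.emptyI)
  qed (intro holomorphic_compact_finite_zeros[OF hol open_upper_half_plane connected_upper_half_plane] assms)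
qed

lemma zorder_nonneg:
  assumes "w \<in> upper_half_plane"
  shows "0 \<le> zorder (f n) w"
proof -
  obtain z0 where z0: "z0 \<in> upper_half_plane" "f n z0 \<noteq> 0" using nonzero by blast
  show ?thesis
    using eventually_nonzero_at[OF hol open_upper_half_plane connected_upper_half_plane z0 assms] hol open_upper_half_plane assms
    by (intro zorder_ge_0) (auto simp: analytic_at intro: eventually_frequently)
qed

text \<open>Off the finitely many zeros the logarithm splits into (2 / k) ln |f| and ln y; Jensen's
  formula handles the former, Taylor expansion the latter.\<close>

lemma ball_weighted_log_density:
  fixes p :: "complex \<Rightarrow> real"
  assumes a: "cball a r \<subseteq> upper_half_plane" and k: "k n > 0"
    and i1: "set_integrable lborel (ball a r) (\<lambda>z. p z * ln (cmod (f n z)))"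
    and i2: "set_integrable lborel (ball a r) (\<lambda>z. p z * ln (Im z))"
    and p [measurable]: "p \<in> borel_measurable borel"
  shows "set_integrable lborel (ball a r) (\<lambda>z. p z * log_density n z)"
    and "(LINT z:ball a r|lborel. p z * log_density n z) =
      2 / k n * (LINT z:ball a r|lborel. p z * ln (cmod (f n z))) + (LINT z:ball a r|lborel. p z * ln (Im z))"
proof -
  let ?F = "\<lambda>z. 2 / k n * (p z * ln (cmod (f n z))) + p z * ln (Im z)"
  have iF: "set_integrable lborel (ball a r) ?F"
    by (intro set_integral_add set_integrable_mult_right i1 i2)
  have "finite {w \<in> cball a r. f n w = 0}"
    by (rule finite_zeros) (use a in auto)
  then have "AE z in lborel. z \<notin> {w \<in> cball a r. f n w = 0}"
    by (intro AE_not_in finite_imp_null_set_lborel)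
  then have AE: "AE z in lborel. indicat_real (ball a r) z *\<^sub>R (p z * log_density n z) = indicat_real (ball a r) z *\<^sub>R ?F z"
  proof eventually_elim
    case (elim z)
    show ?case
    proof (cases "z \<in> ball a r")
      case True
      then have "z \<in> upper_half_plane" "f n z \<noteq> 0" using a elim by (auto simp: subset_iff)
      then show ?thesis using log_density_eq[of z n] k by (simp add: distrib_left)
    qed simp
  qed
  have m: "(\<lambda>z. indicat_real (ball a r) z *\<^sub>R (p z * log_density n z)) \<in> borel_measurable lborel"
  proof -
    have [measurable]: "(\<lambda>z. indicator upper_half_plane z *\<^sub>R log_density n z) \<in> borel_measurable borel"
      using log_density_measurable by (simp add: set_borel_measurable_def)
    have [measurable]: "ball a r \<in> sets borel" by simp
    have "(\<lambda>z. indicat_real (ball a r) z *\<^sub>R (p z * (indicator upper_half_plane z *\<^sub>R log_density n z))) \<in> borel_measurable lborel"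
      by measurable
    also have "(\<lambda>z. indicat_real (ball a r) z *\<^sub>R (p z * (indicator upper_half_plane z *\<^sub>R log_density n z))) =
      (\<lambda>z. indicat_real (ball a r) z *\<^sub>R (p z * log_density n z))"
      using a by (auto simp: indicator_def fun_eq_iff subset_iff)
    finally show ?thesis .
  qed
  note iF' = iF[unfolded set_integrable_def]
  show "set_integrable lborel (ball a r) (\<lambda>z. p z * log_density n z)"
    unfolding set_integrable_def using integrable_cong_AE[OF m borel_measurable_integrable[OF iF'] AE] iF' by simp
  have "(LINT z:ball a r|lborel. p z * log_density n z) = (LINT z:ball a r|lborel. ?F z)"
    unfolding set_lebesgue_integral_def by (rule integral_cong_AE[OF m borel_measurable_integrable[OF iF'] AE])
  also have "\<dots> = 2 / k n * (LINT z:ball a r|lborel. p z * ln (cmod (f n z))) + (LINT z:ball a r|lborel. p z * ln (Im z))"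
    using set_integrable_mult_right[OF i1, of "2 / k n"] i2 by (subst set_integral_add) (simp_all only: set_integral_mult_right)
  finally show "(LINT z:ball a r|lborel. p z * log_density n z) =
      2 / k n * (LINT z:ball a r|lborel. p z * ln (cmod (f n z))) + (LINT z:ball a r|lborel. p z * ln (Im z))" .
qed

lemma ball_log_density:
  assumes a: "cball a r \<subseteq> upper_half_plane" and k: "k n > 0" and r: "r > 0"
  shows "set_integrable lborel (ball a r) (log_density n)"
    and "(LINT z:ball a r|lborel. log_density n z) =
      2 / k n * (LINT z:ball a r|lborel. ln (cmod (f n z))) + (LINT z:ball a r|lborel. ln (Im z))"
proof -
  obtain z0 where z0: "z0 \<in> upper_half_plane" "f n z0 \<noteq> 0" using nonzero by blast
  obtain Z u where "finite Z" "{w \<in> cball a r. f n w = 0} \<subseteq> Z" "\<forall>w\<in>Z. f n w = 0 \<and> zorder (f n) w > 0"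
    and p: "\<forall>p C. p \<in> borel_measurable borel \<longrightarrow> (\<forall>r. \<bar>p r\<bar> \<le> C) \<longrightarrow>
       set_integrable lborel (ball a r) (\<lambda>z. p (cmod (z - a)) * ln (cmod (f n z))) \<and>
       (LINT z:ball a r|lborel. p (cmod (z - a)) * ln (cmod (f n z))) =
         u * (LINT z:ball (0::complex) r|lborel. p (cmod z)) +
         (\<Sum>w\<in>Z. zorder (f n) w * (LINT z:ball (0::complex) r|lborel. p (cmod z) * ln (max (cmod z) (cmod (w - a)))))"
    and "f n a \<noteq> 0 \<longrightarrow> ln (cmod (f n a)) = u + (\<Sum>w\<in>Z. zorder (f n) w * ln (cmod (w - a)))"
    by (rule jensen_radial[OF hol open_upper_half_plane connected_upper_half_plane z0 r a])
  have i1: "set_integrable lborel (ball a r) (\<lambda>z. 1 * ln (cmod (f n z)))"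
    using p[rule_format, of "\<lambda>_. 1" 1] by simp
  have "set_integrable lborel (cball a r) (\<lambda>z. ln (Im z))"
    unfolding set_integrable_def
  proof (intro borel_integrable_compact continuous_intros)
    show "\<forall>z\<in>cball a r. Im z \<noteq> 0" using a by (fastforce simp: upper_half_plane_def)
  qed auto
  then have i2: "set_integrable lborel (ball a r) (\<lambda>z. 1 * ln (Im z))"
    by simp (rule set_integrable_subset, auto)
  note * = ball_weighted_log_density[of a r n "\<lambda>_. 1", OF a k i1 i2]
  show "set_integrable lborel (ball a r) (log_density n)"
    and "(LINT z:ball a r|lborel. log_density n z) =
      2 / k n * (LINT z:ball a r|lborel. ln (cmod (f n z))) + (LINT z:ball a r|lborel. ln (Im z))"
    using * by simp_all
qed

text \<open>If the density stayed below c / 2 on the disc, the integral of a tent function supported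
  there would be at most half of its limit. The point found may move with \<open>n\<close>; only its
  existence matters.\<close>

lemma exists_density_lower_bound:
  assumes "cball a s \<subseteq> upper_half_plane" "s > 0"
  shows "eventually (\<lambda>n. \<exists>z\<in>ball a s. c / 2 \<le> density_at n z) sequentially"
proof -
  define \<eta> where "\<eta> = (\<lambda>z. max 0 (1 - dist a z / s))"
  have \<eta>: "continuous_on UNIV \<eta>" unfolding \<eta>_def using assms by (intro continuous_intros) auto
  have supp: "\<eta> z = 0" if "z \<notin> ball a s" for z using that assms by (auto simp: \<eta>_def)
  have supp': "\<eta> z = 0" if "z \<notin> cball a s" for z using that supp[of z] by auto
  have int: "integrable lborel \<eta>"
  proof -
    have "integrable lborel (\<lambda>z. indicator (cball a s) z *\<^sub>R \<eta> z)"
      by (intro borel_integrable_compact compact_cball continuous_on_subset[OF \<eta>]) auto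
    also have "(\<lambda>z. indicator (cball a s) z *\<^sub>R \<eta> z) = \<eta>" using supp' by (auto simp: indicator_def fun_eq_iff)
    finally show ?thesis .
  qed
  have pos: "0 < (LINT z|lborel. \<eta> z)"
  proof -
    have "0 < measure lborel (ball a (s / 2)) * (1 / 2)" using assms by simp
    also have "\<dots> = (LINT z|lborel. indicat_real (ball a (s / 2)) z * (1 / 2))" by simp
    also have "\<dots> \<le> (LINT z|lborel. \<eta> z)"
    proof (rule Bochner_Integration.integral_mono[OF _ int])
      show "integrable lborel (\<lambda>z. indicat_real (ball a (s / 2)) z * (1 / 2))"
        using emeasure_lborel_ball_finite[of a "s / 2"] by (intro integrable_mult_left) auto
      show "indicat_real (ball a (s / 2)) z * (1 / 2) \<le> \<eta> z" for z
        using assms by (auto simp: indicator_def \<eta>_def field_simps max_def)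
    qed
    finally show ?thesis .
  qed
  have "(\<lambda>n. LINT z|lborel. \<eta> z * density_at n z) \<longlonglongrightarrow> c * (LINT z|lborel. \<eta> z)"
    unfolding density_at_def by (rule mass[OF \<eta> compact_cball assms(1) supp'])
  moreover have "c / 2 * (LINT z|lborel. \<eta> z) < c * (LINT z|lborel. \<eta> z)"
    using pos c_pos by simp
  ultimately have "eventually (\<lambda>n. c / 2 * (LINT z|lborel. \<eta> z) < (LINT z|lborel. \<eta> z * density_at n z)) sequentially"
    by (rule order_tendstoD(1))
  then show ?thesis
  proof eventually_elim
    case (elim n)
    show ?case
    proof (rule ccontr)
      assume "\<not> (\<exists>z\<in>ball a s. c / 2 \<le> density_at n z)"
      then have less: "density_at n z \<le> c / 2" if "z \<in> ball a s" for z using that by force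
      have "(LINT z|lborel. \<eta> z * density_at n z) \<le> (LINT z|lborel. c / 2 * \<eta> z)"
      proof (rule Bochner_Integration.integral_mono)
        show "integrable lborel (\<lambda>z. \<eta> z * density_at n z)"
          by (rule integrable_density[OF \<eta> compact_cball assms(1) supp'])
        show "integrable lborel (\<lambda>z. c / 2 * \<eta> z)" using int by simp
        show "\<eta> z * density_at n z \<le> c / 2 * \<eta> z" for z
        proof (cases "z \<in> ball a s")
          case True
          then show ?thesis using mult_left_mono[OF less[OF True], of "\<eta> z"] by (simp add: \<eta>_def mult.commute)
        qed (simp add: supp)
      qed
      then show False using elim by simp
    qed
  qed
qed

text \<open>The sub-mean value property at a point of \<open>ball a s\<close> where the density is not small bounds
  \<open>\<integral> log_density\<close> from below, up to the defect of superharmonicity of \<open>ln y\<close>, which is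
  of order \<open>s ^ 4\<close>.\<close>

lemma local_L1_bound:
  assumes K: "compact K" "K \<subseteq> upper_half_plane"
  obtains C s0 where "C > 0" "s0 > 0" "\<And>a s. a \<in> K \<Longrightarrow> 0 < s \<Longrightarrow> s < s0 \<Longrightarrow> cball a s \<subseteq> upper_half_plane \<and>
    eventually (\<lambda>n. (LINT z:ball a s|lborel. \<bar>log_density n z\<bar>) \<le> C * s ^ 4) sequentially"
proof -
  obtain \<delta> K' where \<delta>: "\<delta> > 0" and K': "compact K'" "K' \<subseteq> upper_half_plane" "\<And>a. a \<in> K \<Longrightarrow> cball a \<delta> \<subseteq> K'"
    using compact_cball_neighbourhood[OF K(1) open_upper_half_plane K(2)] by metis
  obtain y where y: "y > 0" "\<And>z. z \<in> K' \<Longrightarrow> y \<le> Im z"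
    using compact_upper_half_plane_Im_bound[OF K'(1,2)] by metis
  \<comment> \<open>For s < \<open>s0\<close>, the bound 3 s <= \<open>\<delta>\<close> leaves room
    for a disc of radius 2 s around a point of \<open>ball a s\<close>, and 2 s <= y / 2 is the
    radius allowed in the lower bound for the mean of ln y.\<close>
  define s0 where "s0 = min \<delta> y / 4"
  \<comment> \<open>With A = 4 pi s^2 the final sum is pi s^4 + A s^2 + A (s^2 + 8 s^2 / y^2) = (9
    pi + 32 pi / y^2) s^4.\<close>
  define C where "C = 9 * pi + 32 * pi / y\<^sup>2"
  show ?thesis
  proof (rule that[of C s0])
    show "C > 0" using y by (auto simp: C_def intro!: add_pos_nonneg)
    show "s0 > 0" using y \<delta> by (simp add: s0_def)
    fix a s assume a: "a \<in> K" and s: "0 < s" "s < s0"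
    have s': "3 * s \<le> \<delta>" "2 * s \<le> y / 2" using s by (auto simp: s0_def min_def split: if_splits)
    have sub3: "cball a (3 * s) \<subseteq> K'" using K'(3)[OF a] s' by auto
    have sub1: "cball a s \<subseteq> K'" using sub3 s by auto
    \<comment> \<open>One tolerance s^2 serves for the upper bound of \<open>log_density\<close> on
      \<open>K'\<close> and, through ln (c / 2) / k, for its lower bound at the good point.\<close>
    have "eventually (\<lambda>m::nat. \<bar>ln (c / 2)\<bar> / m \<le> s\<^sup>2) at_top"
      using s by real_asymp
    then have "eventually (\<lambda>n. \<bar>ln (c / 2)\<bar> / k n \<le> s\<^sup>2) sequentially"
      by (rule eventually_weight)
    moreover have "eventually (\<lambda>n. \<forall>z\<in>K'. density_at n z \<le> exp (s\<^sup>2 * k n)) sequentially"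
      using density_upper_bound[OF K'(1,2), of "s\<^sup>2"] s by simp
    moreover have "eventually (\<lambda>n. \<exists>z\<in>ball a s. c / 2 \<le> density_at n z) sequentially"
      using sub1 K'(2) s by (intro exists_density_lower_bound) auto
    ultimately have "eventually (\<lambda>n. (LINT z:ball a s|lborel. \<bar>log_density n z\<bar>) \<le> C * s ^ 4) sequentially"
      using weight_pos
    proof eventually_elim
      case (elim n)
      have up: "log_density n z \<le> s\<^sup>2" if "z \<in> K'" for z
      proof (cases "density_at n z > 0")
        case True
        then have "ln (density_at n z) \<le> ln (exp (s\<^sup>2 * k n))" using elim(2) that by (intro ln_mono) auto
        then show ?thesis using elim(4) by (simp add: log_density_def field_simps)
      next
        case False
        then have "density_at n z = 0" using density_nonneg[of z n] that K'(2) by auto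
        then show ?thesis by (simp add: log_density_def)
      qed
      obtain w where w: "w \<in> ball a s" "c / 2 \<le> density_at n w" using elim(3) by blast
      have subw: "cball w (2 * s) \<subseteq> K'"
      proof
        fix z assume "z \<in> cball w (2 * s)"
        then have "dist a z \<le> 3 * s" using w(1) dist_triangle[of a z w] by auto
        then show "z \<in> K'" using sub3 by auto
      qed
      then have subw': "cball w (2 * s) \<subseteq> upper_half_plane" using K'(2) by auto
      have wK: "w \<in> K'" using subw s by auto
      then have wH: "w \<in> upper_half_plane" using K'(2) by auto
      have fw: "f n w \<noteq> 0" using w(2) c_pos by (auto simp: density_at_def)
      have hw: "- (s\<^sup>2) \<le> log_density n w"
      proof -
        have "ln (c / 2) \<le> ln (density_at n w)" using w(2) c_pos by (intro ln_mono) auto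
        then have "- \<bar>ln (c / 2)\<bar> \<le> ln (density_at n w)" by linarith
        then have "- \<bar>ln (c / 2)\<bar> / k n \<le> ln (density_at n w) / k n" by (intro divide_right_mono) auto
        then show ?thesis using elim(1) by (simp add: log_density_def)
      qed
      have s2: "2 * s > 0" using s by simp
      note ld = ball_log_density[OF subw' elim(4) s2]
      have sub1': "cball a s \<subseteq> upper_half_plane" using sub1 K'(2) by auto
      note la = ball_log_density(1)[OF sub1' elim(4) s(1)]
      note jm = jensen_submean[OF hol open_upper_half_plane connected_upper_half_plane s2 subw' fw]
      note li = set_integral_ln_Im_ball_lower[OF y(1) y(2)[OF wK] s2 s'(2)]
      define A where "A = pi * (2 * s)\<^sup>2"
      have A: "A \<ge> 0" by (simp add: A_def)
      \<comment> \<open>Jensen's inequality at \<open>w\<close> loses nothing; only the mean of ln y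
        costs 8 s^2 / y^2 per unit area.\<close>
      have lower: "A * (log_density n w - 2 * (2 * s)\<^sup>2 / y\<^sup>2) \<le> (LINT z:ball w (2 * s)|lborel. log_density n z)"
      proof -
        have "2 / k n * (A * ln (cmod (f n w))) \<le> 2 / k n * (LINT z:ball w (2 * s)|lborel. ln (cmod (f n z)))"
          using jm(2) by (intro mult_left_mono) (auto simp: A_def)
        then show ?thesis
          using li(1) unfolding ld(2) log_density_eq[OF wH fw elim(4)] A_def[symmetric] by (simp add: algebra_simps)
      qed
      have ivw: "set_integrable lborel (ball w (2 * s)) (\<lambda>z. s\<^sup>2 - log_density n z)"
      proof (rule set_integral_diff(1)[OF _ ld(1)])
        show "set_integrable lborel (ball w (2 * s)) (\<lambda>z. s\<^sup>2)"
          using emeasure_lborel_ball_finite[of w "2 * s"] by (simp add: set_integrable_def)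
      qed
      have vw: "(LINT z:ball w (2 * s)|lborel. s\<^sup>2 - log_density n z) = A * s\<^sup>2 - (LINT z:ball w (2 * s)|lborel. log_density n z)"
      proof -
        have "measure lborel (ball w (2 * s)) = A" using s by (simp add: content_ball unit_ball_vol_2 A_def)
        moreover have "set_integrable lborel (ball w (2 * s)) (\<lambda>z. s\<^sup>2)"
          using emeasure_lborel_ball_finite[of w "2 * s"] by (simp add: set_integrable_def)
        ultimately show ?thesis
          by (subst set_integral_diff(2)[OF _ ld(1)]) (auto simp: set_lebesgue_integral_def)
      qed
      have const: "set_integrable lborel (ball a s) (\<lambda>z. s\<^sup>2)"
        using emeasure_lborel_ball_finite[of a s] by (simp add: set_integrable_def)
      have constv: "(LINT z:ball a s|lborel. s\<^sup>2) = pi * s ^ 4"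
        using s by (simp add: set_lebesgue_integral_def content_ball unit_ball_vol_2 power2_eq_square eval_nat_numeral)
      have iva: "set_integrable lborel (ball a s) (\<lambda>z. s\<^sup>2 - log_density n z)"
        by (rule set_integral_diff(1)[OF const la])
      \<comment> \<open>Since h <= s^2, the function s^2 - h is nonnegative and |h| <= s^2 + (s^2 -
        h). The integral of a nonnegative function only grows on the larger disc
        \<open>ball w (2 * s)\<close>, which is centred at the good point.\<close>
      have "(LINT z:ball a s|lborel. \<bar>log_density n z\<bar>) \<le> (LINT z:ball a s|lborel. s\<^sup>2 + (s\<^sup>2 - log_density n z))"
      proof (rule set_integral_mono)
        show "set_integrable lborel (ball a s) (\<lambda>z. \<bar>log_density n z\<bar>)"
          by (rule set_integrable_abs[OF la])
        show "set_integrable lborel (ball a s) (\<lambda>z. s\<^sup>2 + (s\<^sup>2 - log_density n z))"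
          by (intro set_integral_add const iva)
        fix z assume "z \<in> ball a s"
        then have "log_density n z \<le> s\<^sup>2" using up[of z] subsetD[OF sub1, of z] by auto
        then show "\<bar>log_density n z\<bar> \<le> s\<^sup>2 + (s\<^sup>2 - log_density n z)" by (auto simp: abs_if)
      qed
      also have "\<dots> = pi * s ^ 4 + (LINT z:ball a s|lborel. s\<^sup>2 - log_density n z)"
        unfolding set_integral_add(2)[OF const iva] constv ..
      also have "(LINT z:ball a s|lborel. s\<^sup>2 - log_density n z) \<le> (LINT z:ball w (2 * s)|lborel. s\<^sup>2 - log_density n z)"
        unfolding set_lebesgue_integral_def
      proof (rule Bochner_Integration.integral_mono)
        fix z
        have "z \<in> ball w (2 * s)" if "z \<in> ball a s"
          using that w(1) dist_triangle[of w z a] by (auto simp: dist_commute)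
        moreover have "log_density n z \<le> s\<^sup>2" if "z \<in> ball w (2 * s)" using up[of z] subsetD[OF subw, of z] that by auto
        ultimately show "indicat_real (ball a s) z *\<^sub>R (s\<^sup>2 - log_density n z) \<le> indicat_real (ball w (2 * s)) z *\<^sub>R (s\<^sup>2 - log_density n z)"
          by (auto simp: indicator_def)
      qed (use iva ivw in \<open>auto simp: set_integrable_def\<close>)
      also have "\<dots> \<le> A * s\<^sup>2 - A * (log_density n w - 2 * (2 * s)\<^sup>2 / y\<^sup>2)"
        unfolding vw using lower by simp
      also have "\<dots> \<le> A * s\<^sup>2 - A * (- (s\<^sup>2) - 2 * (2 * s)\<^sup>2 / y\<^sup>2)"
        using mult_left_mono[OF hw A] by (simp add: algebra_simps)
      also have "pi * s ^ 4 + \<dots> = C * s ^ 4"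
        by (simp add: A_def C_def power_mult_distrib) (simp add: algebra_simps eval_nat_numeral add_divide_distrib)
      finally show ?case by simp
    qed
    then show "cball a s \<subseteq> upper_half_plane \<and> eventually (\<lambda>n. (LINT z:ball a s|lborel. \<bar>log_density n z\<bar>) \<le> C * s ^ 4) sequentially"
      using sub1 K'(2) by auto
  qed
qed

end

lemma set_integrable_compact_cover:
  fixes g :: "'a::euclidean_space \<Rightarrow> real"
  assumes A: "finite A" "\<And>a. a \<in> A \<Longrightarrow> set_integrable lborel (ball a (s a)) g" and K: "K \<in> sets borel" "K \<subseteq> (\<Union>a\<in>A. ball a (s a))"
  shows "set_integrable lborel K g"
    and "(LINT z:K|lborel. \<bar>g z\<bar>) \<le> (\<Sum>a\<in>A. LINT z:ball a (s a)|lborel. \<bar>g z\<bar>)"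
proof -
  have U: "set_integrable lborel (\<Union>a\<in>A. ball a (s a)) g"
    using A by (intro set_integrable_UN) auto
  show int: "set_integrable lborel K g"
    by (rule set_integrable_subset[OF U]) (use K in auto)
  have "(LINT z:K|lborel. \<bar>g z\<bar>) \<le> (LINT z|lborel. (\<Sum>a\<in>A. indicat_real (ball a (s a)) z *\<^sub>R \<bar>g z\<bar>))"
    unfolding set_lebesgue_integral_def
  proof (rule Bochner_Integration.integral_mono)
    show "integrable lborel (\<lambda>z. indicat_real K z *\<^sub>R \<bar>g z\<bar>)"
      using set_integrable_abs[OF int] by (simp add: set_integrable_def)
    show "integrable lborel (\<lambda>z. \<Sum>a\<in>A. indicat_real (ball a (s a)) z *\<^sub>R \<bar>g z\<bar>)"
      using set_integrable_abs[OF A(2)] by (intro Bochner_Integration.integrable_sum) (simp add: set_integrable_def)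
    fix z
    show "indicat_real K z *\<^sub>R \<bar>g z\<bar> \<le> (\<Sum>a\<in>A. indicat_real (ball a (s a)) z *\<^sub>R \<bar>g z\<bar>)"
    proof (cases "z \<in> K")
      case True
      then obtain a where a: "a \<in> A" "z \<in> ball a (s a)" using K by auto
      then have "indicat_real K z *\<^sub>R \<bar>g z\<bar> = indicat_real (ball a (s a)) z *\<^sub>R \<bar>g z\<bar>" using True by simp
      also have "\<dots> \<le> (\<Sum>a\<in>A. indicat_real (ball a (s a)) z *\<^sub>R \<bar>g z\<bar>)"
        by (rule member_le_sum[OF a(1)]) (use A in auto)
      finally show ?thesis .
    qed (auto intro!: sum_nonneg)
  qed
  also have "\<dots> = (\<Sum>a\<in>A. LINT z:ball a (s a)|lborel. \<bar>g z\<bar>)"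
    unfolding set_lebesgue_integral_def
    by (rule Bochner_Integration.integral_sum) (use set_integrable_abs[OF A(2)] in \<open>simp add: set_integrable_def\<close>)
  finally show "(LINT z:K|lborel. \<bar>g z\<bar>) \<le> (\<Sum>a\<in>A. LINT z:ball a (s a)|lborel. \<bar>g z\<bar>)" .
qed

text \<open>Compactness alone does not control the number of discs, which must stay of order m^2 for
  radii of order 1 / m. A square grid of mesh X / m has (2 m + 1)^2 <= 9 m^2 points; rounding down
  errs by at most one mesh per coordinate, so radius 3 X / m suffices. Grid points far from
  \<open>K\<close> are dropped, so that the centres stay close to \<open>K\<close>.\<close>

lemma compact_grid_cover:
  fixes K :: "complex set"
  assumes "compact K" "K \<noteq> {}"
  obtains X where "X > 0" "\<And>m. m > 0 \<Longrightarrow> \<exists>A. finite A \<and> card A \<le> 9 * m\<^sup>2 \<and> K \<subseteq> (\<Union>a\<in>A. ball a (3 * (X / m))) \<and>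
     (\<forall>a\<in>A. \<exists>z\<in>K. dist a z < 3 * (X / m))"
proof -
  obtain X where X: "X > 0" "\<And>z. z \<in> K \<Longrightarrow> cmod z \<le> X"
    using compact_imp_bounded[OF assms(1)] bounded_pos by metis
  show ?thesis
  proof (rule that[OF X(1)])
    fix m :: nat assume m: "m > 0"
    define s where "s = X / m"
    have s: "s > 0" using X m by (simp add: s_def)
    define G where "G = (\<lambda>(i::int, j::int). Complex (s * i) (s * j)) ` ({- int m..int m} \<times> {- int m..int m})"
    define A where "A = {a \<in> G. \<exists>z\<in>K. dist a z < 3 * s}"
    have fin: "finite G" by (simp add: G_def)
    have "card A \<le> card G" unfolding A_def by (rule card_mono[OF fin]) auto
    also have "\<dots> \<le> card ({- int m..int m} \<times> {- int m..int m})" unfolding G_def by (rule card_image_le) simp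
    also have "\<dots> = (2 * m + 1)\<^sup>2" by (simp add: card_cartesian_product power2_eq_square nat_add_distrib nat_mult_distrib)
    also have "\<dots> \<le> (3 * m)\<^sup>2" using m by (intro power_mono) auto
    finally have card: "card A \<le> 9 * m\<^sup>2" by (simp add: power_mult_distrib)
    have "\<exists>a\<in>A. dist a z < 3 * s" if z: "z \<in> K" for z
    proof -
      define i where "i = \<lfloor>Re z / s\<rfloor>"
      define j where "j = \<lfloor>Im z / s\<rfloor>"
      have bd: "- int m \<le> \<lfloor>t / s\<rfloor> \<and> \<lfloor>t / s\<rfloor> \<le> int m" if "\<bar>t\<bar> \<le> cmod z" for t
      proof -
        have "\<bar>t\<bar> \<le> s * m" using that X(2)[OF z] m by (simp add: s_def)
        then have "- real m \<le> t / s" "t / s \<le> real m" using s by (auto simp: field_simps abs_le_iff)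
        then show ?thesis by (simp add: le_floor_iff floor_le_iff)
      qed
      have fl: "\<bar>s * \<lfloor>t / s\<rfloor> - t\<bar> \<le> s" for t
      proof -
        have "\<lfloor>t / s\<rfloor> \<le> t / s" "t / s \<le> \<lfloor>t / s\<rfloor> + 1" by linarith+
        from this[THEN mult_left_mono, of s] have "s * \<lfloor>t / s\<rfloor> \<le> s * (t / s)" "s * (t / s) \<le> s * (\<lfloor>t / s\<rfloor> + 1)"
          using s by simp_all
        then show ?thesis using s by (auto simp: abs_le_iff algebra_simps)
      qed
      define a where "a = Complex (s * i) (s * j)"
      have "cmod (a - z) \<le> \<bar>Re (a - z)\<bar> + \<bar>Im (a - z)\<bar>" by (rule cmod_le)
      also have "\<dots> \<le> s + s" using fl[of "Re z"] fl[of "Im z"] by (auto simp: a_def i_def j_def)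
      finally have "dist a z < 3 * s" using s by (simp add: dist_norm)
      moreover have "a \<in> G"
        unfolding G_def a_def using bd[OF abs_Re_le_cmod] bd[OF abs_Im_le_cmod]
        by (intro image_eqI[where x="(i, j)"]) (auto simp: i_def j_def)
      ultimately show ?thesis using z by (auto simp: A_def)
    qed
    then show "\<exists>A. finite A \<and> card A \<le> 9 * m\<^sup>2 \<and> K \<subseteq> (\<Union>a\<in>A. ball a (3 * (X / m))) \<and>
     (\<forall>a\<in>A. \<exists>z\<in>K. dist a z < 3 * (X / m))"
      unfolding s_def[symmetric]
      using card fin by (intro exI[of _ A]) (auto simp: A_def)
  qed
qed

section \<open>Convergence of the logarithmic density to 0 in L^1 on compact sets\<close>

context equidistributed_mass
begin

lemma integrable_log_density:
  assumes K: "compact K" "K \<subseteq> upper_half_plane" and k: "k n > 0"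
  shows "set_integrable lborel K (log_density n)"
proof -
  obtain \<delta> K' where \<delta>: "\<delta> > 0" and K': "compact K'" "K' \<subseteq> upper_half_plane" "\<And>a. a \<in> K \<Longrightarrow> cball a \<delta> \<subseteq> K'"
    using compact_cball_neighbourhood[OF K(1) open_upper_half_plane K(2)] by metis
  obtain A where A: "finite A" "A \<subseteq> K" "K \<subseteq> (\<Union>a\<in>A. ball a \<delta>)"
    using compactE_image[OF K(1), of K "\<lambda>a. ball a \<delta>"] \<delta> by (metis UN_I centre_in_ball open_ball subsetI)
  show ?thesis
  proof (rule set_integrable_compact_cover(1)[OF A(1) _ _ A(3)])
    show "K \<in> sets borel" using K(1) by (simp add: borel_compact)
    fix a assume "a \<in> A"
    then have "cball a \<delta> \<subseteq> upper_half_plane" using A(2) K'(2,3) by blast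
    then show "set_integrable lborel (ball a \<delta>) (log_density n)" by (rule ball_log_density(1)[OF _ k \<delta>])
  qed
qed

text \<open>A grid of mesh X / m gives 9 m^2 discs of radius s = 3 X / m, each contributing at most
  C s^4 for large \<open>n\<close>, in all 729 C X^4 / m^2. For fixed m only finitely many
  conditions are imposed on \<open>n\<close>, and m can be taken large.\<close>

lemma log_density_tendsto_L1:
  assumes K: "compact K" "K \<subseteq> upper_half_plane"
  shows "(\<lambda>n. LINT z:K|lborel. \<bar>log_density n z\<bar>) \<longlonglongrightarrow> 0"
proof (cases "K = {}")
  case False
  obtain \<delta> K' where \<delta>: "\<delta> > 0" and K': "compact K'" "K' \<subseteq> upper_half_plane" "\<And>a. a \<in> K \<Longrightarrow> cball a \<delta> \<subseteq> K'"
    using compact_cball_neighbourhood[OF K(1) open_upper_half_plane K(2)] by metis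
  obtain C s0 where C: "C > 0" "s0 > 0" and L: "\<And>a s. a \<in> K' \<Longrightarrow> 0 < s \<Longrightarrow> s < s0 \<Longrightarrow> cball a s \<subseteq> upper_half_plane \<and>
    eventually (\<lambda>n. (LINT z:ball a s|lborel. \<bar>log_density n z\<bar>) \<le> C * s ^ 4) sequentially"
    using local_L1_bound[OF K'(1,2)] by metis
  obtain X where X: "X > 0" and cov: "\<And>m. m > 0 \<Longrightarrow> \<exists>A. finite A \<and> card A \<le> 9 * m\<^sup>2 \<and> K \<subseteq> (\<Union>a\<in>A. ball a (3 * (X / m))) \<and>
     (\<forall>a\<in>A. \<exists>z\<in>K. dist a z < 3 * (X / m))"
    using compact_grid_cover[OF K(1) False] by metis
  show ?thesis
  proof (rule tendstoI)
    fix e :: real assume e: "e > 0"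
    have ev: "eventually (\<lambda>m. 729 * C * X ^ 4 / real m ^ 2 < e \<and> 3 * (X / real m) < min s0 \<delta>) at_top"
    proof (intro eventually_conj)
      have "((\<lambda>m. 729 * C * X ^ 4 / real m ^ 2) \<longlongrightarrow> 0) at_top" by real_asymp
      then show "eventually (\<lambda>m. 729 * C * X ^ 4 / real m ^ 2 < e) at_top" using e by (rule order_tendstoD)
      have "((\<lambda>m. 3 * (X / real m)) \<longlongrightarrow> 0) at_top" by real_asymp
      then show "eventually (\<lambda>m. 3 * (X / real m) < min s0 \<delta>) at_top" using C \<delta> by (intro order_tendstoD) auto
    qed
    then obtain m where m: "m > 0" "729 * C * X ^ 4 / real m ^ 2 < e" "3 * (X / real m) < min s0 \<delta>"
      using eventually_happens[OF eventually_conj[OF ev eventually_gt_at_top[of 0]]] by auto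
    define s where "s = 3 * (X / real m)"
    have s: "0 < s" "s < s0" "s < \<delta>" using m X by (auto simp: s_def)
    obtain A where A: "finite A" "card A \<le> 9 * m\<^sup>2" "K \<subseteq> (\<Union>a\<in>A. ball a s)" "\<And>a. a \<in> A \<Longrightarrow> \<exists>z\<in>K. dist a z < s"
      using cov[OF m(1)] unfolding s_def by metis
    have AK: "a \<in> K'" if "a \<in> A" for a
    proof -
      obtain z where "z \<in> K" "dist a z < s" using A(4)[OF \<open>a \<in> A\<close>] by auto
      then show ?thesis using K'(3)[of z] s by (auto simp: dist_commute)
    qed
    have "eventually (\<lambda>n. \<forall>a\<in>A. (LINT z:ball a s|lborel. \<bar>log_density n z\<bar>) \<le> C * s ^ 4) sequentially"
      using L[OF AK s(1,2)] by (intro eventually_ball_finite[OF A(1)]) auto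
    then show "eventually (\<lambda>n. dist (LINT z:K|lborel. \<bar>log_density n z\<bar>) 0 < e) sequentially"
      using weight_pos
    proof eventually_elim
      case (elim n)
      have "(LINT z:K|lborel. \<bar>log_density n z\<bar>) \<le> (\<Sum>a\<in>A. LINT z:ball a s|lborel. \<bar>log_density n z\<bar>)"
      proof (rule set_integrable_compact_cover(2)[OF A(1) _ _ A(3)])
        show "K \<in> sets borel" using K(1) by (simp add: borel_compact)
        show "set_integrable lborel (ball a s) (log_density n)" if "a \<in> A" for a
          using L[OF AK[OF that] s(1,2)] by (intro ball_log_density(1) elim(2) s(1)) auto
      qed
      also have "\<dots> \<le> (\<Sum>a\<in>A. C * s ^ 4)" using elim(1) by (intro sum_mono) auto
      also have "\<dots> = real (card A) * (C * s ^ 4)" by simp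
      also have "\<dots> \<le> real (9 * m\<^sup>2) * (C * s ^ 4)" using A(2) C by (intro mult_right_mono of_nat_mono) auto
      also have "\<dots> = 729 * C * X ^ 4 / real m ^ 2"
        using m(1) by (simp add: s_def power_divide power_mult_distrib) (simp add: field_simps eval_nat_numeral)
      also have "\<dots> < e" by (rule m(2))
      finally have "(LINT z:K|lborel. \<bar>log_density n z\<bar>) < e" .
      moreover have "0 \<le> (LINT z:K|lborel. \<bar>log_density n z\<bar>)"
        unfolding set_lebesgue_integral_def by (intro Bochner_Integration.integral_nonneg) auto
      ultimately show ?case by simp
    qed
  qed
qed (simp add: set_lebesgue_integral_def)

end

text \<open>By Green's formula the main term is the integral of \<open>(R\<^sup>2 - \<bar>z - a\<bar>\<^sup>2)\<^sup>2\<close> against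
  the Laplacian \<open>- 1 / y\<^sup>2\<close> of \<open>ln y\<close>, frozen at \<open>a\<close>.\<close>

lemma set_integral_ln_Im_test_function:
  assumes y: "0 < y" "y \<le> Im a" and R: "0 < R" "R \<le> y / 2"
  shows "\<bar>(LINT z:ball a R|lborel. (16 * (cmod (z - a))\<^sup>2 - 8 * R\<^sup>2) * ln (Im z)) + pi * R ^ 6 / (3 * (Im a)\<^sup>2)\<bar>
      \<le> 16 * pi * R ^ 7 / y ^ 3"
    and "set_integrable lborel (ball a R) (\<lambda>z. (16 * (cmod (z - a))\<^sup>2 - 8 * R\<^sup>2) * ln (Im z))"
proof -
  have Im: "\<bar>Im z - Im a\<bar> \<le> R" if "z \<in> cball a R" for z
    using abs_Im_le_cmod[of "z - a"] that by (simp add: dist_norm norm_minus_commute)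
  have "set_integrable lborel (cball a R) (\<lambda>z. (16 * (cmod (z - a))\<^sup>2 - 8 * R\<^sup>2) * ln (Im z))"
    unfolding set_integrable_def
  proof (intro borel_integrable_compact continuous_intros)
    show "\<forall>z\<in>cball a R. Im z \<noteq> 0" using Im y R by fastforce
  qed auto
  then show int: "set_integrable lborel (ball a R) (\<lambda>z. (16 * (cmod (z - a))\<^sup>2 - 8 * R\<^sup>2) * ln (Im z))"
    by (rule set_integrable_subset) auto
  define q where "q = (\<lambda>r::real. 16 * r\<^sup>2 - 8 * R\<^sup>2)"
  have qc: "continuous_on UNIV q" unfolding q_def by (intro continuous_intros)
  define Y where "Y = Im a"
  have Y: "Y \<ge> y" "Y > 0" using y by (auto simp: Y_def)
  have ci: "set_integrable lborel (ball 0 R) g" if "continuous_on UNIV g" for g :: "complex \<Rightarrow> real"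
  proof -
    have "set_integrable lborel (cball 0 R) g"
      unfolding set_integrable_def by (intro borel_integrable_compact compact_cball continuous_on_subset[OF that]) auto
    then show ?thesis by (rule set_integrable_subset) auto
  qed
  \<comment> \<open>The second order Taylor polynomial of ln Im (a + z), weighted with
    \<open>q\<close>. The constant part is killed by the mean zero of \<open>q\<close>, the linear
    part by oddness; in the quadratic part (Im z)^2 may be replaced by |z|^2 / 2, which gives - 1 /
    (4 Y^2) times 4 pi R^6 / 3.\<close>
  define T where "T = (\<lambda>z. q (cmod z) * ln Y + (1 / Y) * (q (cmod z) * Im z) + (- 1 / (2 * Y\<^sup>2)) * (q (cmod z) * (Im z)\<^sup>2))"
  have i: "set_integrable lborel (ball 0 R) (\<lambda>z. cmod z ^ n)" for n
    using set_integral_cmod_power(1)[of R n] R by simp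
  have q0: "(LINT z:ball (0::complex) R|lborel. q (cmod z)) = 0"
  proof -
    have "(LINT z:ball (0::complex) R|lborel. q (cmod z)) = (LINT z:ball (0::complex) R|lborel. 16 * cmod z ^ 2 - 8 * R\<^sup>2 * cmod z ^ 0)"
      by (simp add: q_def)
    also have "\<dots> = 16 * (LINT z:ball (0::complex) R|lborel. cmod z ^ 2) - 8 * R\<^sup>2 * (LINT z:ball (0::complex) R|lborel. cmod z ^ 0)"
      unfolding set_integral_mult_right[symmetric] by (intro set_integral_diff(2) set_integrable_mult_right i)
    also have "\<dots> = 0"
      using R by (subst (1 2) set_integral_cmod_power(2)) (auto simp: eval_nat_numeral)
    finally show ?thesis .
  qed
  have q2: "(LINT z:ball (0::complex) R|lborel. q (cmod z) * (cmod z)\<^sup>2) = 4 * pi / 3 * R ^ 6"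
  proof -
    have "(LINT z:ball (0::complex) R|lborel. q (cmod z) * (cmod z)\<^sup>2) = (LINT z:ball (0::complex) R|lborel. 16 * cmod z ^ 4 - 8 * R\<^sup>2 * cmod z ^ 2)"
      by (rule set_lebesgue_integral_cong) (auto simp: q_def algebra_simps eval_nat_numeral)
    also have "\<dots> = 16 * (LINT z:ball (0::complex) R|lborel. cmod z ^ 4) - 8 * R\<^sup>2 * (LINT z:ball (0::complex) R|lborel. cmod z ^ 2)"
      unfolding set_integral_mult_right[symmetric] by (intro set_integral_diff(2) set_integrable_mult_right i)
    also have "\<dots> = 4 * pi / 3 * R ^ 6"
      using R by (subst (1 2) set_integral_cmod_power(2)) (auto simp: eval_nat_numeral field_simps)
    finally show ?thesis .
  qed
  have i1: "set_integrable lborel (ball 0 R) (\<lambda>z. q (cmod z) * ln Y)"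
    and i2: "set_integrable lborel (ball 0 R) (\<lambda>z. (1 / Y) * (q (cmod z) * Im z))"
    and i3: "set_integrable lborel (ball 0 R) (\<lambda>z. (- 1 / (2 * Y\<^sup>2)) * (q (cmod z) * (Im z)\<^sup>2))"
    by (intro ci continuous_on_mult continuous_on_const continuous_on_compose2[OF qc] continuous_intros; simp)+
  have iT: "set_integrable lborel (ball 0 R) T"
    unfolding T_def by (intro set_integral_add i1 i2 i3)
  have "(LINT z:ball 0 R|lborel. T z) = (LINT z:ball (0::complex) R|lborel. q (cmod z)) * ln Y
      + (1 / Y) * (LINT z:ball 0 R|lborel. q (cmod z) * Im z)
      + (- 1 / (2 * Y\<^sup>2)) * (LINT z:ball 0 R|lborel. q (cmod z) * (Im z)\<^sup>2)"
    unfolding T_def set_integral_mult_right[symmetric] set_integral_mult_left[symmetric]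
    using i1 i2 i3 by (simp only: set_integral_add)
  also have "\<dots> = - (pi * R ^ 6 / (3 * Y\<^sup>2))"
    using R by (simp add: q0 set_integral_radial_odd_even[OF qc] q2)
  finally have Tv: "(LINT z:ball 0 R|lborel. T z) = - (pi * R ^ 6 / (3 * Y\<^sup>2))" .
  have int0: "set_integrable lborel (ball 0 R) (\<lambda>z. q (cmod z) * ln (Im (a + z)))"
    using int unfolding set_integral_ball_translate(1)[of a] by (simp add: q_def)
  have bound: "\<bar>q (cmod z) * ln (Im (a + z)) - T z\<bar> \<le> 16 * R ^ 5 / y ^ 3" if z: "z \<in> ball 0 R" for z
  proof -
    have zR: "cmod z < R" using z by simp
    have "\<bar>Im z\<bar> \<le> R" using abs_Im_le_cmod[of z] zR by linarith
    define x where "x = Im z / Y"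
    have x: "\<bar>x\<bar> \<le> R / y"
      unfolding x_def abs_divide using \<open>\<bar>Im z\<bar> \<le> R\<close> Y y by (intro frac_le) auto
    have "R / y \<le> 1 / 2" using R y by (simp add: field_simps)
    then have x2: "\<bar>x\<bar> \<le> 1 / 2" using x by linarith
    have "Im (a + z) = Y * (1 + x)" using Y by (simp add: x_def Y_def field_simps)
    then have "ln (Im (a + z)) = ln Y + ln (1 + x)"
      using Y x2 by (simp add: ln_mult_pos)
    then have eq: "q (cmod z) * ln (Im (a + z)) - T z = q (cmod z) * (ln (1 + x) - (x - x\<^sup>2 / 2))"
      using Y by (simp add: T_def x_def power_divide) (simp add: field_simps)
    have "(cmod z)\<^sup>2 \<le> R\<^sup>2" using zR by (intro power_mono) auto
    then have qb: "\<bar>q (cmod z)\<bar> \<le> 8 * R\<^sup>2" by (auto simp: q_def abs_le_iff)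
    have "\<bar>q (cmod z) * ln (Im (a + z)) - T z\<bar> = \<bar>q (cmod z)\<bar> * \<bar>ln (1 + x) - (x - x\<^sup>2 / 2)\<bar>"
      unfolding eq by (simp add: abs_mult)
    also have "\<dots> \<le> 8 * R\<^sup>2 * (2 * \<bar>x\<bar> ^ 3)"
      by (intro mult_mono qb ln_one_plus_third_order x2) auto
    also have "\<dots> \<le> 8 * R\<^sup>2 * (2 * (R / y) ^ 3)"
      using x by (intro mult_left_mono power_mono) auto
    also have "\<dots> = 16 * R ^ 5 / y ^ 3" by (simp add: power_divide eval_nat_numeral)
    finally show ?thesis .
  qed
  have "(LINT z:ball a R|lborel. (16 * (cmod (z - a))\<^sup>2 - 8 * R\<^sup>2) * ln (Im z)) + pi * R ^ 6 / (3 * (Im a)\<^sup>2)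
      = (LINT z:ball 0 R|lborel. q (cmod z) * ln (Im (a + z))) - (LINT z:ball 0 R|lborel. T z)"
    unfolding Tv set_integral_ball_translate(2)[of a] by (simp add: q_def Y_def)
  also have "\<dots> = (LINT z:ball 0 R|lborel. q (cmod z) * ln (Im (a + z)) - T z)"
    by (rule set_integral_diff(2)[OF int0 iT, symmetric])
  finally have "\<bar>(LINT z:ball a R|lborel. (16 * (cmod (z - a))\<^sup>2 - 8 * R\<^sup>2) * ln (Im z)) + pi * R ^ 6 / (3 * (Im a)\<^sup>2)\<bar>
      = \<bar>LINT z:ball 0 R|lborel. q (cmod z) * ln (Im (a + z)) - T z\<bar>" by simp
  also have "\<dots> \<le> (LINT z:ball 0 R|lborel. \<bar>q (cmod z) * ln (Im (a + z)) - T z\<bar>)"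
    using set_integral_norm_bound[OF set_integral_diff(1)[OF int0 iT]] by simp
  also have "\<dots> \<le> (LINT z:ball (0::complex) R|lborel. 16 * R ^ 5 / y ^ 3)"
    using bound by (intro set_integral_mono set_integrable_abs set_integral_diff(1)[OF int0 iT] ci) auto
  also have "\<dots> = 16 * pi * R ^ 7 / y ^ 3"
    using R by (simp add: set_lebesgue_integral_def content_ball unit_ball_vol_2 eval_nat_numeral)
  finally show "\<bar>(LINT z:ball a R|lborel. (16 * (cmod (z - a))\<^sup>2 - 8 * R\<^sup>2) * ln (Im z)) + pi * R ^ 6 / (3 * (Im a)\<^sup>2)\<bar>
      \<le> 16 * pi * R ^ 7 / y ^ 3" .
qed

section \<open>Counting zeros with the radial kernel\<close>

context equidistributed_mass
begin

text \<open>Substituting ln |f| = (k / 2) (h - ln y) into Jensen's formula expresses the sum over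
  zeros, divided by k, as 1 / (4 pi) times an h-part, at most 8 R^2 times the L^1 norm of h, minus a
  ln y part with main term - pi R^6 / (3 (Im a)^2). The sum runs over all zeros in
  \<open>K'\<close>, cut off by \<open>max\<close>, so that its range stays put when the centre
  \<open>a\<close> is integrated over later.\<close>

lemma smoothed_zeros_estimate:
  assumes K': "compact K'" "K' \<subseteq> upper_half_plane" and a: "cball a R \<subseteq> K'"
    and y: "0 < y" "y \<le> Im a" and R: "0 < R" "R \<le> y / 2" and k: "k n > 0"
  shows "\<bar>(\<Sum>w\<in>{w \<in> K'. f n w = 0}. zorder (f n) w * (max 0 (R\<^sup>2 - (cmod (w - a))\<^sup>2))\<^sup>2) / k n - R ^ 6 / (12 * (Im a)\<^sup>2)\<bar>
     \<le> (8 * R\<^sup>2 * (LINT z:K'|lborel. \<bar>log_density n z\<bar>) + 16 * pi * R ^ 7 / y ^ 3) / (4 * pi)"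
proof -
  have aH: "cball a R \<subseteq> upper_half_plane" using a K'(2) by auto
  obtain z0 where z0: "z0 \<in> upper_half_plane" "f n z0 \<noteq> 0" using nonzero by blast
  define \<kappa> where "\<kappa> = (\<lambda>z. 16 * (cmod (z - a))\<^sup>2 - 8 * R\<^sup>2)"
  have J: "set_integrable lborel (ball a R) (\<lambda>z. \<kappa> z * ln (cmod (f n z)))"
    "(LINT z:ball a R|lborel. \<kappa> z * ln (cmod (f n z))) =
      2 * pi * (\<Sum>w\<in>{w \<in> ball a R. f n w = 0}. zorder (f n) w * (R\<^sup>2 - (cmod (w - a))\<^sup>2)\<^sup>2)"
    unfolding \<kappa>_def
    by (rule jensen_test_function[OF hol open_upper_half_plane connected_upper_half_plane z0 R(1) aH])+
  have I: "\<bar>(LINT z:ball a R|lborel. \<kappa> z * ln (Im z)) + pi * R ^ 6 / (3 * (Im a)\<^sup>2)\<bar> \<le> 16 * pi * R ^ 7 / y ^ 3"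
    "set_integrable lborel (ball a R) (\<lambda>z. \<kappa> z * ln (Im z))"
    unfolding \<kappa>_def by (rule set_integral_ln_Im_test_function[OF y R])+
  have \<kappa>m: "\<kappa> \<in> borel_measurable borel" unfolding \<kappa>_def by measurable
  note B = ball_weighted_log_density[OF aH k J(1) I(2) \<kappa>m]
  have "(\<Sum>w\<in>{w \<in> K'. f n w = 0}. zorder (f n) w * (max 0 (R\<^sup>2 - (cmod (w - a))\<^sup>2))\<^sup>2) =
     (\<Sum>w\<in>{w \<in> ball a R. f n w = 0}. zorder (f n) w * (R\<^sup>2 - (cmod (w - a))\<^sup>2)\<^sup>2)"
  proof (rule sum.mono_neutral_cong_right[OF finite_zeros[OF K']])
    show "{w \<in> ball a R. f n w = 0} \<subseteq> {w \<in> K'. f n w = 0}" using a by auto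
    show "\<forall>w\<in>{w \<in> K'. f n w = 0} - {w \<in> ball a R. f n w = 0}. zorder (f n) w * (max 0 (R\<^sup>2 - (cmod (w - a))\<^sup>2))\<^sup>2 = 0"
    proof
      fix w assume "w \<in> {w \<in> K'. f n w = 0} - {w \<in> ball a R. f n w = 0}"
      then have "R \<le> cmod (w - a)" by (auto simp: dist_norm norm_minus_commute)
      then have "R\<^sup>2 \<le> (cmod (w - a))\<^sup>2" using R by (intro power_mono) auto
      then show "zorder (f n) w * (max 0 (R\<^sup>2 - (cmod (w - a))\<^sup>2))\<^sup>2 = 0" by simp
    qed
    fix w assume "w \<in> {w \<in> ball a R. f n w = 0}"
    then have "(cmod (w - a))\<^sup>2 \<le> R\<^sup>2" by (intro power_mono) (auto simp: dist_norm norm_minus_commute)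
    then show "zorder (f n) w * (max 0 (R\<^sup>2 - (cmod (w - a))\<^sup>2))\<^sup>2 = zorder (f n) w * (R\<^sup>2 - (cmod (w - a))\<^sup>2)\<^sup>2" by simp
  qed
  also have "\<dots> = (LINT z:ball a R|lborel. \<kappa> z * ln (cmod (f n z))) / (2 * pi)"
    unfolding J(2) by simp
  finally have "(\<Sum>w\<in>{w \<in> K'. f n w = 0}. zorder (f n) w * (max 0 (R\<^sup>2 - (cmod (w - a))\<^sup>2))\<^sup>2) / k n =
     ((LINT z:ball a R|lborel. \<kappa> z * log_density n z) - (LINT z:ball a R|lborel. \<kappa> z * ln (Im z))) / (4 * pi)"
    unfolding B(2) using k by (simp add: field_simps)
  moreover have "R ^ 6 / (12 * (Im a)\<^sup>2) = pi * R ^ 6 / (3 * (Im a)\<^sup>2) / (4 * pi)"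
    by (simp add: field_simps)
  ultimately have eq: "(\<Sum>w\<in>{w \<in> K'. f n w = 0}. zorder (f n) w * (max 0 (R\<^sup>2 - (cmod (w - a))\<^sup>2))\<^sup>2) / k n - R ^ 6 / (12 * (Im a)\<^sup>2) =
     ((LINT z:ball a R|lborel. \<kappa> z * log_density n z) - ((LINT z:ball a R|lborel. \<kappa> z * ln (Im z)) + pi * R ^ 6 / (3 * (Im a)\<^sup>2))) / (4 * pi)"
    by (simp only: diff_divide_distrib add_divide_distrib)
  have iK: "set_integrable lborel K' (\<lambda>z. \<bar>log_density n z\<bar>)"
    by (rule set_integrable_abs[OF integrable_log_density[OF K' k]])
  have "\<bar>LINT z:ball a R|lborel. \<kappa> z * log_density n z\<bar> \<le> (LINT z:ball a R|lborel. \<bar>\<kappa> z * log_density n z\<bar>)"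
    using set_integral_norm_bound[OF B(1)] by simp
  also have "\<dots> \<le> (LINT z:K'|lborel. 8 * R\<^sup>2 * \<bar>log_density n z\<bar>)"
    unfolding set_lebesgue_integral_def
  proof (rule Bochner_Integration.integral_mono)
    show "integrable lborel (\<lambda>z. indicat_real (ball a R) z *\<^sub>R \<bar>\<kappa> z * log_density n z\<bar>)"
      using set_integrable_abs[OF B(1)] by (simp add: set_integrable_def)
    show "integrable lborel (\<lambda>z. indicat_real K' z *\<^sub>R (8 * R\<^sup>2 * \<bar>log_density n z\<bar>))"
      using set_integrable_mult_right[OF iK] unfolding set_integrable_def .
    fix z
    show "indicat_real (ball a R) z *\<^sub>R \<bar>\<kappa> z * log_density n z\<bar> \<le> indicat_real K' z *\<^sub>R (8 * R\<^sup>2 * \<bar>log_density n z\<bar>)"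
    proof (cases "z \<in> ball a R")
      case True
      then have zK: "z \<in> K'" using a by auto
      have "(cmod (z - a))\<^sup>2 \<le> R\<^sup>2" using True by (intro power_mono) (auto simp: dist_norm norm_minus_commute)
      then have "\<bar>\<kappa> z\<bar> \<le> 8 * R\<^sup>2" by (auto simp: \<kappa>_def abs_le_iff)
      then have "\<bar>\<kappa> z\<bar> * \<bar>log_density n z\<bar> \<le> 8 * R\<^sup>2 * \<bar>log_density n z\<bar>" by (rule mult_right_mono) simp
      then show ?thesis using True zK by (simp add: abs_mult)
    qed simp
  qed
  also have "\<dots> = 8 * R\<^sup>2 * (LINT z:K'|lborel. \<bar>log_density n z\<bar>)" by simp
  finally have "\<bar>LINT z:ball a R|lborel. \<kappa> z * log_density n z\<bar> \<le> 8 * R\<^sup>2 * (LINT z:K'|lborel. \<bar>log_density n z\<bar>)" .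
  with I(1) have "\<bar>(LINT z:ball a R|lborel. \<kappa> z * log_density n z) - ((LINT z:ball a R|lborel. \<kappa> z * ln (Im z)) + pi * R ^ 6 / (3 * (Im a)\<^sup>2))\<bar>
     \<le> 8 * R\<^sup>2 * (LINT z:K'|lborel. \<bar>log_density n z\<bar>) + 16 * pi * R ^ 7 / y ^ 3" by linarith
  then show ?thesis
    unfolding eq abs_divide by (simp add: divide_right_mono)
qed

text \<open>On the disc of half the radius the kernel is at least (R^2 / 2)^2, so the smoothed
  counts around finitely many centres bound the true count. The order k is what converts a uniform
  error in the test function into a small error of the normalized sum.\<close>

lemma zeros_linear_bound:
  assumes K: "compact K" "K \<subseteq> upper_half_plane"
  obtains C :: real where "C \<ge> 0" "eventually (\<lambda>n. (\<Sum>w\<in>{w \<in> K. f n w = 0}. zorder (f n) w) \<le> C * k n) sequentially"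
proof -
  obtain \<delta> K' where \<delta>: "\<delta> > 0" and K': "compact K'" "K' \<subseteq> upper_half_plane" "\<And>a. a \<in> K \<Longrightarrow> cball a \<delta> \<subseteq> K'"
    using compact_cball_neighbourhood[OF K(1) open_upper_half_plane K(2)] by metis
  obtain y where y: "y > 0" "\<And>z. z \<in> K' \<Longrightarrow> y \<le> Im z"
    using compact_upper_half_plane_Im_bound[OF K'(1,2)] by metis
  define R where "R = min \<delta> (y / 2)"
  have R: "R > 0" "R \<le> \<delta>" "R \<le> y / 2" using \<delta> y by (auto simp: R_def)
  obtain A where A: "finite A" "A \<subseteq> K" "K \<subseteq> (\<Union>a\<in>A. ball a (R / 2))"
    using compactE_image[OF K(1), of K "\<lambda>a. ball a (R / 2)"] R by (metis UN_I centre_in_ball half_gt_zero open_ball subsetI)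
  \<comment> \<open>The main term at the lowest height \<open>y\<close> plus the error term, with
    the L^1 norm replaced by 1.\<close>
  define D where "D = R ^ 6 / (12 * y\<^sup>2) + (8 * R\<^sup>2 + 16 * pi * R ^ 7 / y ^ 3) / (4 * pi)"
  define C where "C = card A * (D / (R\<^sup>2 / 2)\<^sup>2)"
  have D: "D \<ge> 0" unfolding D_def using R y by (intro add_nonneg_nonneg divide_nonneg_nonneg) auto
  have "eventually (\<lambda>n. (LINT z:K'|lborel. \<bar>log_density n z\<bar>) < 1) sequentially"
    using order_tendstoD(2)[OF log_density_tendsto_L1[OF K'(1,2)], of 1] by simp
  then have "eventually (\<lambda>n. (\<Sum>w\<in>{w \<in> K. f n w = 0}. zorder (f n) w) \<le> C * k n) sequentially"
    using weight_pos
  proof eventually_elim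
    case (elim n)
    define Z where "Z = {w \<in> K'. f n w = 0}"
    have fin: "finite Z" unfolding Z_def by (rule finite_zeros[OF K'(1,2)])
    have ord: "0 \<le> real_of_int (zorder (f n) w)" if "w \<in> Z" for w
      using zorder_nonneg[of w n] that K'(2) by (auto simp: Z_def)
    have KK': "K \<subseteq> K'" using K'(3) \<delta> by (meson centre_in_cball less_imp_le subsetD subsetI)
    define b where "b = (\<lambda>a w. (max 0 (R\<^sup>2 - (cmod (w - a))\<^sup>2))\<^sup>2)"
    have one: "(\<Sum>w\<in>Z. zorder (f n) w * b a w) \<le> D * k n" if a: "a \<in> A" for a
    proof -
      have aK: "a \<in> K" using A(2) a by auto
      have c: "cball a R \<subseteq> K'" using K'(3)[OF aK] R(2) by auto
      have ya: "y \<le> Im a" using y(2)[OF subsetD[OF c, of a]] R by simp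
      have "\<bar>(\<Sum>w\<in>Z. zorder (f n) w * b a w) / k n - R ^ 6 / (12 * (Im a)\<^sup>2)\<bar>
        \<le> (8 * R\<^sup>2 * (LINT z:K'|lborel. \<bar>log_density n z\<bar>) + 16 * pi * R ^ 7 / y ^ 3) / (4 * pi)"
        unfolding Z_def b_def by (rule smoothed_zeros_estimate[OF K'(1,2) c y(1) ya R(1,3) elim(2)])
      also have "\<dots> \<le> (8 * R\<^sup>2 * 1 + 16 * pi * R ^ 7 / y ^ 3) / (4 * pi)"
        using elim(1) by (intro divide_right_mono add_right_mono mult_left_mono) auto
      finally have "(\<Sum>w\<in>Z. zorder (f n) w * b a w) / k n \<le> R ^ 6 / (12 * (Im a)\<^sup>2) + (8 * R\<^sup>2 + 16 * pi * R ^ 7 / y ^ 3) / (4 * pi)"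
        by simp
      also have "R ^ 6 / (12 * (Im a)\<^sup>2) \<le> R ^ 6 / (12 * y\<^sup>2)"
        using y ya R by (intro divide_left_mono mult_left_mono power_mono mult_pos_pos zero_less_power) auto
      finally have "(\<Sum>w\<in>Z. zorder (f n) w * b a w) / k n \<le> D" by (simp add: D_def)
      then show ?thesis using elim(2) by (simp add: field_simps)
    qed
    have bnn: "0 \<le> b a w" for a w by (simp add: b_def)
    have "(\<Sum>w\<in>{w \<in> K. f n w = 0}. zorder (f n) w) * (R\<^sup>2 / 2)\<^sup>2 \<le> (\<Sum>w\<in>{w \<in> K. f n w = 0}. zorder (f n) w * (\<Sum>a\<in>A. b a w))"
      unfolding of_int_sum sum_distrib_right
    proof (intro sum_mono mult_left_mono)
      fix w assume w: "w \<in> {w \<in> K. f n w = 0}"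
      then obtain a where a: "a \<in> A" "w \<in> ball a (R / 2)" using A(3) by auto
      have "(cmod (w - a))\<^sup>2 \<le> (R / 2)\<^sup>2" using a(2) by (intro power_mono) (auto simp: dist_norm norm_minus_commute)
      also have "\<dots> \<le> R\<^sup>2 / 2" by (simp add: power_divide)
      finally have "R\<^sup>2 / 2 \<le> R\<^sup>2 - (cmod (w - a))\<^sup>2" by simp
      then have "R\<^sup>2 / 2 \<le> max 0 (R\<^sup>2 - (cmod (w - a))\<^sup>2)" by (rule order.trans) simp
      then have "(R\<^sup>2 / 2)\<^sup>2 \<le> b a w" unfolding b_def by (rule power_mono) simp
      also have "b a w \<le> (\<Sum>a\<in>A. b a w)"
        by (rule member_le_sum[OF a(1) bnn A(1)])
      finally show "(R\<^sup>2 / 2)\<^sup>2 \<le> (\<Sum>a\<in>A. b a w)" .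
      show "0 \<le> real_of_int (zorder (f n) w)" using ord[of w] w KK' by (auto simp: Z_def)
    qed
    also have "\<dots> \<le> (\<Sum>w\<in>Z. zorder (f n) w * (\<Sum>a\<in>A. b a w))"
      using KK' ord bnn by (intro sum_mono2[OF fin]) (auto simp: Z_def intro!: mult_nonneg_nonneg sum_nonneg)
    also have "\<dots> = (\<Sum>a\<in>A. \<Sum>w\<in>Z. zorder (f n) w * b a w)"
      unfolding sum_distrib_left by (rule sum.swap)
    also have "\<dots> \<le> (\<Sum>a\<in>A. D * k n)" using one by (rule sum_mono)
    finally show ?case using R by (simp add: C_def field_simps)
  qed
  moreover have "C \<ge> 0" using D by (simp add: C_def)
  ultimately show ?thesis by (rule that[rotated])
qed

end

section \<open>From the kernel to continuous test functions\<close>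

lemma integral_test_function:
  assumes R: "R > 0"
  defines "b \<equiv> \<lambda>z::complex. (max 0 (R\<^sup>2 - (cmod z)\<^sup>2))\<^sup>2"
  shows "integrable lborel b" and "(LINT z|lborel. b z) = pi * R ^ 6 / 3"
proof -
  have b: "b = (\<lambda>z. indicat_real (ball 0 R) z *\<^sub>R (R ^ 4 * cmod z ^ 0 - 2 * R\<^sup>2 * cmod z ^ 2 + cmod z ^ 4))"
  proof
    fix z
    show "b z = indicat_real (ball 0 R) z *\<^sub>R (R ^ 4 * cmod z ^ 0 - 2 * R\<^sup>2 * cmod z ^ 2 + cmod z ^ 4)"
    proof (cases "cmod z < R")
      case True
      then have "(cmod z)\<^sup>2 \<le> R\<^sup>2" by (intro power_mono) auto
      then show ?thesis using True by (simp add: b_def power2_diff; simp add: power2_eq_square eval_nat_numeral algebra_simps)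
    next
      case False
      then have "(cmod z)\<^sup>2 \<ge> R\<^sup>2" using R by (intro power_mono) auto
      then show ?thesis using False by (simp add: b_def)
    qed
  qed
  have i: "set_integrable lborel (ball 0 R) (\<lambda>z. cmod z ^ n)" for n
    using set_integral_cmod_power(1)[of R n] R by simp
  have "set_integrable lborel (ball 0 R) (\<lambda>z. R ^ 4 * cmod z ^ 0 - 2 * R\<^sup>2 * cmod z ^ 2 + cmod z ^ 4)"
    by (intro set_integral_add(1) set_integral_diff(1) set_integrable_mult_right i)
  then show "integrable lborel b" unfolding b set_integrable_def .
  have "(LINT z|lborel. b z) = (LINT z:ball (0::complex) R|lborel. R ^ 4 * cmod z ^ 0 - 2 * R\<^sup>2 * cmod z ^ 2 + cmod z ^ 4)"
    unfolding b set_lebesgue_integral_def ..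
  also have "\<dots> = R ^ 4 * (LINT z:ball (0::complex) R|lborel. cmod z ^ 0) - 2 * R\<^sup>2 * (LINT z:ball (0::complex) R|lborel. cmod z ^ 2)
     + (LINT z:ball (0::complex) R|lborel. cmod z ^ 4)"
    using i by (simp only: set_integral_add(2) set_integral_diff set_integrable_mult_right set_integral_mult_right)
  also have "\<dots> = pi * R ^ 6 / 3"
    using R by (subst (1 2 3) set_integral_cmod_power(2)) (auto simp: eval_nat_numeral field_simps)
  finally show "(LINT z|lborel. b z) = pi * R ^ 6 / 3" .
qed

text \<open>The kernel divided by its total mass pi R^6 / 3 is an approximate identity at scale
  \<open>R\<close>. The oscillation of \<open>\<psi>\<close> is controlled around the single point
  \<open>w\<close>, which will be a zero.\<close>

lemma convolution_test_function_bound: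
  fixes \<psi> :: "complex \<Rightarrow> real"
  assumes R: "R > 0" and \<psi>: "integrable lborel \<psi>" "\<And>a. dist a w < R \<Longrightarrow> \<bar>\<psi> a - \<psi> w\<bar> \<le> \<epsilon>"
  defines "b \<equiv> \<lambda>z::complex. (max 0 (R\<^sup>2 - (cmod z)\<^sup>2))\<^sup>2"
  shows "integrable lborel (\<lambda>a. \<psi> a * b (w - a))"
    and "\<bar>(LINT a|lborel. \<psi> a * b (w - a)) - \<psi> w * (pi * R ^ 6 / 3)\<bar> \<le> \<epsilon> * (pi * R ^ 6 / 3)"
proof -
  have bR: "0 \<le> b z" "b z \<le> R ^ 4" for z
  proof -
    have "max 0 (R\<^sup>2 - (cmod z)\<^sup>2) \<le> R\<^sup>2" by simp
    then have "b z \<le> (R\<^sup>2)\<^sup>2" unfolding b_def by (rule power_mono) simp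
    then show "b z \<le> R ^ 4" by simp
  qed (simp add: b_def)
  have bm [measurable]: "b \<in> borel_measurable borel" unfolding b_def by measurable
  have b: "integrable lborel b" "(LINT z|lborel. b z) = pi * R ^ 6 / 3"
    unfolding b_def by (rule integral_test_function[OF R])+
  have bneg: "b (w - a) = b (- w + a)" for a
    by (simp add: b_def norm_minus_commute)
  have bw: "integrable lborel (\<lambda>a. b (w - a))" "(LINT a|lborel. b (w - a)) = pi * R ^ 6 / 3"
    unfolding bneg using integrable_lborel_translation[OF b(1), of "- w"] b(2) by simp_all
  have \<psi>m [measurable]: "\<psi> \<in> borel_measurable borel" using \<psi>(1) by auto
  show int: "integrable lborel (\<lambda>a. \<psi> a * b (w - a))"
  proof (rule Bochner_Integration.integrable_bound[OF integrable_mult_left[OF \<psi>(1), of "R ^ 4"]])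
    show "AE a in lborel. norm (\<psi> a * b (w - a)) \<le> norm (\<psi> a * R ^ 4)"
      using bR R by (intro AE_I2) (auto simp: abs_mult intro!: mult_left_mono)
  qed measurable
  have "\<bar>(LINT a|lborel. \<psi> a * b (w - a)) - \<psi> w * (pi * R ^ 6 / 3)\<bar> = \<bar>LINT a|lborel. \<psi> a * b (w - a) - \<psi> w * b (w - a)\<bar>"
    using int bw(1) unfolding bw(2)[symmetric] by simp
  also have "\<dots> \<le> (LINT a|lborel. \<bar>\<psi> a * b (w - a) - \<psi> w * b (w - a)\<bar>)"
    by (rule integral_abs_bound)
  also have "\<dots> \<le> (LINT a|lborel. \<epsilon> * b (w - a))"
  proof (rule Bochner_Integration.integral_mono)
    fix a
    show "\<bar>\<psi> a * b (w - a) - \<psi> w * b (w - a)\<bar> \<le> \<epsilon> * b (w - a)"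
    proof (cases "dist a w < R")
      case True
      have "\<bar>\<psi> a * b (w - a) - \<psi> w * b (w - a)\<bar> = \<bar>\<psi> a - \<psi> w\<bar> * b (w - a)"
        using bR by (simp add: abs_mult flip: left_diff_distrib)
      also have "\<dots> \<le> \<epsilon> * b (w - a)" using \<psi>(2)[OF True] bR by (intro mult_right_mono) auto
      finally show ?thesis .
    next
      case False
      then have "R\<^sup>2 \<le> (cmod (w - a))\<^sup>2" using R by (intro power_mono) (auto simp: dist_norm norm_minus_commute)
      then have "b (w - a) = 0" by (simp add: b_def)
      then show ?thesis by simp
    qed
  qed (use int bw in auto)
  also have "\<dots> = \<epsilon> * (pi * R ^ 6 / 3)" using bw by simp
  finally show "\<bar>(LINT a|lborel. \<psi> a * b (w - a)) - \<psi> w * (pi * R ^ 6 / 3)\<bar> \<le> \<epsilon> * (pi * R ^ 6 / 3)" .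
qed

context equidistributed_mass
begin

text \<open>The sum over zeros of the convolution of \<open>\<psi>\<close> with the kernel is
  estimated twice. Seen from each zero it is the kernel mass times \<open>\<psi>\<close>, up to
  oscillation; with sum and integral exchanged it is the integral over all centres of the smoothed
  counts, which are known. The constant of the limit is (R^6 / 12) / (pi R^6 / 3) = 1 / (4
  pi).\<close>

theorem zeros_equidistributed:
  fixes \<psi> :: "complex \<Rightarrow> real"
  assumes \<psi>: "continuous_on UNIV \<psi>" and K: "compact K" "K \<subseteq> upper_half_plane" and supp: "\<And>z. z \<notin> K \<Longrightarrow> \<psi> z = 0"
  shows "(\<lambda>n. (\<Sum>w\<in>{w \<in> K. f n w = 0}. zorder (f n) w * \<psi> w) / k n)
      \<longlonglongrightarrow> (LINT z|lborel. \<psi> z / (Im z)\<^sup>2) / (4 * pi)"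
proof (rule tendstoI)
  fix e :: real assume e: "e > 0"
  obtain \<delta> K' where \<delta>: "\<delta> > 0" and K': "compact K'" "K' \<subseteq> upper_half_plane" "\<And>a. a \<in> K \<Longrightarrow> cball a \<delta> \<subseteq> K'"
    using compact_cball_neighbourhood[OF K(1) open_upper_half_plane K(2)] by metis
  obtain y where y: "y > 0" "\<And>z. z \<in> K' \<Longrightarrow> y \<le> Im z"
    using compact_upper_half_plane_Im_bound[OF K'(1,2)] by metis
  have KK': "K \<subseteq> K'" using K'(3) \<delta> by (meson centre_in_cball less_imp_le subsetD subsetI)
  obtain C :: real where C: "C \<ge> 0" "eventually (\<lambda>n. (\<Sum>w\<in>{w \<in> K'. f n w = 0}. zorder (f n) w) \<le> C * k n) sequentially"
    by (rule zeros_linear_bound[OF K'(1,2)])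
  have ind: "(\<lambda>z. indicator K z *\<^sub>R \<psi> z) = \<psi>" using supp by (auto simp: indicator_def fun_eq_iff)
  have i\<psi>: "integrable lborel \<psi>"
    using borel_integrable_compact[OF K(1) continuous_on_subset[OF \<psi>]] unfolding ind by simp
  have i\<psi>2: "integrable lborel (\<lambda>z. \<psi> z / (Im z)\<^sup>2)"
  proof -
    have "integrable lborel (\<lambda>z. indicator K z *\<^sub>R (\<psi> z / (Im z)\<^sup>2))"
      by (intro borel_integrable_compact K(1) continuous_intros continuous_on_subset[OF \<psi>])
        (use K(2) in \<open>auto simp: upper_half_plane_def\<close>)
    also have "(\<lambda>z. indicator K z *\<^sub>R (\<psi> z / (Im z)\<^sup>2)) = (\<lambda>z. \<psi> z / (Im z)\<^sup>2)"
      using supp by (auto simp: indicator_def fun_eq_iff)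
    finally show ?thesis .
  qed
  define N where "N = (LINT z|lborel. \<bar>\<psi> z\<bar>)"
  have N: "N \<ge> 0" unfolding N_def by (intro Bochner_Integration.integral_nonneg) auto
  \<comment> \<open>Then C \<epsilon> <= e / 4 < e / 3; the summand 1 avoids a division by 0 when C
    = 0.\<close>
  define \<epsilon> where "\<epsilon> = e / (4 * (C + 1))"
  have \<epsilon>: "\<epsilon> > 0" "C * \<epsilon> < e / 3"
  proof -
    show "\<epsilon> > 0" using e C(1) by (simp add: \<epsilon>_def)
    have "C * \<epsilon> \<le> (C + 1) * \<epsilon>" using \<open>\<epsilon> > 0\<close> by (intro mult_right_mono) auto
    also have "\<dots> = e / 4"
    proof -
      have "C + 1 > 0" using C(1) by simp
      then show ?thesis unfolding \<epsilon>_def by (simp add: field_simps)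
    qed
    finally show "C * \<epsilon> < e / 3" using e by simp
  qed
  have "uniformly_continuous_on K' \<psi>"
    by (intro compact_uniformly_continuous continuous_on_subset[OF \<psi>] K'(1)) auto
  then obtain d where d: "d > 0" "\<And>a b. a \<in> K' \<Longrightarrow> b \<in> K' \<Longrightarrow> dist b a < d \<Longrightarrow> dist (\<psi> b) (\<psi> a) < \<epsilon>"
    using \<epsilon>(1) unfolding uniformly_continuous_on_def by metis
  \<comment> \<open>Chosen so that the kernel mass times C1 R is the Taylor error: (pi R^6 / 3) C1 R
    = 4 R^7 / y^3 = (16 pi R^7 / y^3) / (4 pi).\<close>
  define C1 where "C1 = 12 / (pi * y ^ 3)"
  have C1: "C1 > 0" using y by (simp add: C1_def)
  define r1 where "r1 = y / 2"
  define r2 where "r2 = e / (4 * (N * C1 + 1))"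
  \<comment> \<open>\<open>R\<close> is fixed before \<open>n\<close>. It keeps the discs inside
    \<open>K'\<close>, resolves the uniform continuity of \<open>\<psi>\<close>, respects the bound
    y / 2 of the Taylor expansion, and makes N C1 R small.\<close>
  define R where "R = min (min \<delta> d) (min r1 r2)"
  have NC: "0 < N * C1 + 1" using N C1 by (simp add: add_nonneg_pos)
  have "r1 > 0" "r2 > 0" using y e NC by (simp_all add: r1_def r2_def)
  then have "R > 0" "R \<le> \<delta>" "R \<le> d" "R \<le> r1" "R \<le> r2"
    using \<delta> d by (simp_all add: R_def)
  then have R: "R > 0" "R \<le> \<delta>" "R \<le> d" "R \<le> y / 2" "R \<le> e / (4 * (N * C1 + 1))"
    by (simp_all only: r1_def r2_def)
  have NR: "N * (C1 * R) < e / 3"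
  proof -
    have "N * C1 * R \<le> (N * C1 + 1) * R" using R by (intro mult_right_mono) auto
    also have "\<dots> \<le> (N * C1 + 1) * (e / (4 * (N * C1 + 1)))"
      using R(5) N C1 by (intro mult_left_mono) auto
    also have "\<dots> = e / 4"
      using NC by (simp add: field_simps)
    finally show ?thesis using e by (simp add: mult.assoc)
  qed
  define L where "L = (\<lambda>n. LINT z:K'|lborel. \<bar>log_density n z\<bar>)"
  have "L \<longlonglongrightarrow> 0" unfolding L_def by (rule log_density_tendsto_L1[OF K'(1,2)])
  then have "(\<lambda>n. N * (6 / (pi\<^sup>2 * R ^ 4) * L n)) \<longlonglongrightarrow> N * (6 / (pi\<^sup>2 * R ^ 4) * 0)"
    by (intro tendsto_intros)
  then have "eventually (\<lambda>n. N * (6 / (pi\<^sup>2 * R ^ 4) * L n) < e / 3) sequentially"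
    using e by (intro order_tendstoD) auto
  then show "eventually (\<lambda>n. dist ((\<Sum>w\<in>{w \<in> K. f n w = 0}. zorder (f n) w * \<psi> w) / k n)
      ((LINT z|lborel. \<psi> z / (Im z)\<^sup>2) / (4 * pi)) < e) sequentially"
    using weight_pos C(2)
  proof eventually_elim
    case (elim n)
    define Z where "Z = {w \<in> K'. f n w = 0}"
    have fin: "finite Z" unfolding Z_def by (rule finite_zeros[OF K'(1,2)])
    have ord: "0 \<le> real_of_int (zorder (f n) w)" if "w \<in> Z" for w
      using zorder_nonneg[of w n] that K'(2) by (auto simp: Z_def)
    define b where "b = (\<lambda>z::complex. (max 0 (R\<^sup>2 - (cmod z)\<^sup>2))\<^sup>2)"
    define M where "M = pi * R ^ 6 / 3"
    have M: "M > 0" using R by (simp add: M_def)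
    define I where "I = (\<Sum>w\<in>Z. zorder (f n) w * (LINT a|lborel. \<psi> a * b (w - a)))"
    define S where "S = (\<Sum>w\<in>Z. zorder (f n) w * \<psi> w)"
    have S: "(\<Sum>w\<in>{w \<in> K. f n w = 0}. zorder (f n) w * \<psi> w) = S"
      unfolding S_def using KK' supp fin by (intro sum.mono_neutral_left) (auto simp: Z_def)
    \<comment> \<open>If neither point lies in \<open>K\<close>, both values vanish; otherwise both
      points lie in \<open>K'\<close>, where \<open>\<psi>\<close> is uniformly continuous.\<close>
    have close: "\<bar>\<psi> a - \<psi> w\<bar> \<le> \<epsilon>" if w: "w \<in> Z" and a: "dist a w < R" for a w
    proof -
      have *: "a \<in> K'" if "a \<in> K \<or> w \<in> K"
      proof (cases "a \<in> K")
        case False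
        then have "w \<in> K" using that by simp
        moreover have "a \<in> cball w \<delta>" using a R(2) by (simp add: dist_commute)
        ultimately show ?thesis using K'(3) by blast
      qed (use KK' in blast)
      show ?thesis
      proof (cases "a \<in> K \<or> w \<in> K")
        case True
        then show ?thesis
          using d(2)[of w a] w a R * by (force simp: Z_def dist_real_def)
      next
        case False
        then show ?thesis using supp \<epsilon>(1) by simp
      qed
    qed
    have conv: "integrable lborel (\<lambda>a. \<psi> a * b (w - a))"
      "\<bar>(LINT a|lborel. \<psi> a * b (w - a)) - \<psi> w * M\<bar> \<le> \<epsilon> * M" if "w \<in> Z" for w
      unfolding b_def M_def
      by (rule convolution_test_function_bound[OF R(1) i\<psi> close[OF that]]; assumption)+
    \<comment> \<open>At most C k zeros with multiplicity, each with an error of oscillation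
      \<open>\<epsilon>\<close> times kernel mass \<open>M\<close>.\<close>
    have first: "\<bar>I - M * S\<bar> \<le> \<epsilon> * M * (C * k n)"
    proof -
      have "\<bar>I - M * S\<bar> = \<bar>\<Sum>w\<in>Z. zorder (f n) w * ((LINT a|lborel. \<psi> a * b (w - a)) - \<psi> w * M)\<bar>"
        by (simp add: I_def S_def sum_distrib_left sum_subtractf right_diff_distrib mult_ac)
      also have "\<dots> \<le> (\<Sum>w\<in>Z. \<bar>zorder (f n) w * ((LINT a|lborel. \<psi> a * b (w - a)) - \<psi> w * M)\<bar>)"
        by (rule sum_abs)
      also have "\<dots> \<le> (\<Sum>w\<in>Z. zorder (f n) w * (\<epsilon> * M))"
      proof (rule sum_mono)
        fix w assume w: "w \<in> Z"
        show "\<bar>zorder (f n) w * ((LINT a|lborel. \<psi> a * b (w - a)) - \<psi> w * M)\<bar> \<le> zorder (f n) w * (\<epsilon> * M)"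
          unfolding abs_mult abs_of_nonneg[OF ord[OF w]] using conv(2)[OF w] ord[OF w] by (intro mult_left_mono) auto
      qed
      also have "\<dots> = (\<Sum>w\<in>Z. real_of_int (zorder (f n) w)) * (\<epsilon> * M)" by (simp add: sum_distrib_right)
      also have "\<dots> \<le> (C * k n) * (\<epsilon> * M)"
        using elim(3) \<epsilon>(1) M by (intro mult_right_mono) (auto simp: Z_def)
      finally show ?thesis by (simp add: mult_ac)
    qed
    have I: "I = (LINT a|lborel. \<psi> a * (\<Sum>w\<in>Z. zorder (f n) w * b (w - a)))"
      and Ii: "integrable lborel (\<lambda>a. \<psi> a * (\<Sum>w\<in>Z. zorder (f n) w * b (w - a)))"
    proof -
      have eq: "\<psi> a * (\<Sum>w\<in>Z. zorder (f n) w * b (w - a)) = (\<Sum>w\<in>Z. zorder (f n) w * (\<psi> a * b (w - a)))" for a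
        by (simp add: sum_distrib_left mult_ac)
      show "integrable lborel (\<lambda>a. \<psi> a * (\<Sum>w\<in>Z. zorder (f n) w * b (w - a)))"
        unfolding eq by (intro Bochner_Integration.integrable_sum integrable_mult_right conv(1))
      show "I = (LINT a|lborel. \<psi> a * (\<Sum>w\<in>Z. zorder (f n) w * b (w - a)))"
        unfolding eq I_def by (subst Bochner_Integration.integral_sum) (auto intro!: conv(1))
    qed
    define E where "E = (8 * R\<^sup>2 * L n + 16 * pi * R ^ 7 / y ^ 3) / (4 * pi)"
    \<comment> \<open>The estimate of the smoothed counts is uniform over centres in
      \<open>K\<close>, so integrating it against \<open>\<psi>\<close> costs only the factor
      \<open>N\<close>, the L^1 norm of \<open>\<psi>\<close>.\<close>
    have second: "\<bar>I / k n - M * ((LINT z|lborel. \<psi> z / (Im z)\<^sup>2) / (4 * pi))\<bar> \<le> N * E"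
    proof -
      let ?g = "\<lambda>a. (\<Sum>w\<in>Z. zorder (f n) w * b (w - a)) / k n - R ^ 6 / (12 * (Im a)\<^sup>2)"
      have i1: "integrable lborel (\<lambda>a. \<psi> a * (\<Sum>w\<in>Z. zorder (f n) w * b (w - a)) / k n)"
        using Ii by (rule integrable_divide_zero)
      have i2: "integrable lborel (\<lambda>a. (R ^ 6 / 12) * (\<psi> a / (Im a)\<^sup>2))"
        using i\<psi>2 by (rule integrable_mult_right)
      have g: "\<psi> a * ?g a = \<psi> a * (\<Sum>w\<in>Z. zorder (f n) w * b (w - a)) / k n - (R ^ 6 / 12) * (\<psi> a / (Im a)\<^sup>2)" for a
        by (simp add: right_diff_distrib)
      have ig: "integrable lborel (\<lambda>a. \<psi> a * ?g a)"
        unfolding g by (rule Bochner_Integration.integrable_diff[OF i1 i2])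
      have "\<bar>I / k n - M * ((LINT z|lborel. \<psi> z / (Im z)\<^sup>2) / (4 * pi))\<bar> = \<bar>LINT a|lborel. \<psi> a * ?g a\<bar>"
        unfolding g Bochner_Integration.integral_diff[OF i1 i2] integral_mult_right_zero by (simp add: I M_def)
      also have "\<dots> \<le> (LINT a|lborel. \<bar>\<psi> a * ?g a\<bar>)" by (rule integral_abs_bound)
      also have "\<dots> \<le> (LINT a|lborel. \<bar>\<psi> a\<bar> * E)"
      proof (rule Bochner_Integration.integral_mono)
        fix a
        show "\<bar>\<psi> a * ?g a\<bar> \<le> \<bar>\<psi> a\<bar> * E"
        proof (cases "a \<in> K")
          case True
          then have c: "cball a R \<subseteq> K'" using K'(3)[of a] R(2) by auto
          have ya: "y \<le> Im a" using y(2) True KK' by auto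
          have "\<bar>?g a\<bar> \<le> E"
            using smoothed_zeros_estimate[OF K'(1,2) c y(1) ya R(1,4) elim(2)]
            by (simp add: E_def L_def b_def Z_def)
          then show ?thesis unfolding abs_mult by (intro mult_left_mono) auto
        qed (simp add: supp)
      qed (use ig i\<psi> in auto)
      also have "\<dots> = N * E" by (simp add: N_def)
      finally show ?thesis .
    qed
    define J where "J = (LINT z|lborel. \<psi> z / (Im z)\<^sup>2) / (4 * pi)"
    have "M * \<bar>S / k n - J\<bar> = \<bar>M * S / k n - M * J\<bar>"
    proof -
      have "M * S / k n - M * J = M * (S / k n - J)" by (simp add: right_diff_distrib)
      then show ?thesis using M by (simp add: abs_mult)
    qed
    also have "\<dots> \<le> \<bar>M * S / k n - I / k n\<bar> + \<bar>I / k n - M * J\<bar>" by linarith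
    also have "\<bar>M * S / k n - I / k n\<bar> = \<bar>I - M * S\<bar> / k n"
      by (simp add: abs_minus_commute flip: diff_divide_distrib)
    also have "\<dots> \<le> \<epsilon> * M * (C * k n) / k n"
      using first by (rule divide_right_mono) simp
    also have "\<dots> = M * (C * \<epsilon>)" using elim(2) by simp
    also have "\<bar>I / k n - M * J\<bar> \<le> N * E" using second by (simp add: J_def)
    also have "N * E = M * (N * (6 / (pi\<^sup>2 * R ^ 4) * L n) + N * (C1 * R))"
    proof -
      have "M * (6 / (pi\<^sup>2 * R ^ 4) * L n) = 2 * R\<^sup>2 * L n / pi"
        using R(1) by (simp add: M_def field_simps eval_nat_numeral)
      moreover have "M * (C1 * R) = 4 * R ^ 7 / y ^ 3"
        using y(1) by (simp add: M_def C1_def field_simps eval_nat_numeral)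
      moreover have "E = 2 * R\<^sup>2 * L n / pi + 4 * R ^ 7 / y ^ 3"
        by (simp add: E_def add_divide_distrib)
      ultimately have "E = M * (6 / (pi\<^sup>2 * R ^ 4) * L n) + M * (C1 * R)" by simp
      then show ?thesis by (simp only: distrib_left mult.left_commute[of N])
    qed
    finally have "M * \<bar>S / k n - J\<bar> \<le> M * (C * \<epsilon> + (N * (6 / (pi\<^sup>2 * R ^ 4) * L n) + N * (C1 * R)))"
      by (simp add: distrib_left)
    then have "\<bar>S / k n - J\<bar> \<le> C * \<epsilon> + (N * (6 / (pi\<^sup>2 * R ^ 4) * L n) + N * (C1 * R))"
      using M by simp
    also have "\<dots> < e" using elim(1) NR \<epsilon>(2) by simp
    finally show ?case unfolding S J_def by (simp add: dist_real_def)
  qed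
qed

end

subsection \<open>The modular group\<close>

definition mat2 :: "int \<Rightarrow> int \<Rightarrow> int \<Rightarrow> int \<Rightarrow> int^2^2" where
  "mat2 a b c d = vector [vector [a, b], vector [c, d]]"

lemma mat2_sel [simp]:
  "mat2 a b c d $ 1 $ 1 = a" "mat2 a b c d $ 1 $ 2 = b" "mat2 a b c d $ 2 $ 1 = c" "mat2 a b c d $ 2 $ 2 = d"
  by (simp_all add: mat2_def)

lemma mat2_eqI:
  "A $ 1 $ 1 = B $ 1 $ 1 \<Longrightarrow> A $ 1 $ 2 = B $ 1 $ 2 \<Longrightarrow> A $ 2 $ 1 = B $ 2 $ 1 \<Longrightarrow> A $ 2 $ 2 = B $ 2 $ 2 \<Longrightarrow> A = B"
  for A B :: "'a^2^2"
  by (simp add: vec_eq_iff forall_2)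

lemma SL2Z_iff: "A \<in> SL2Z \<longleftrightarrow> A $ 1 $ 1 * A $ 2 $ 2 - A $ 1 $ 2 * A $ 2 $ 1 = 1"
  by (simp add: SL2Z_def det_2)

lemma matrix_mult_2_sel:
  fixes A B :: "int^2^2"
  shows "(A ** B) $ i $ j = A $ i $ 1 * B $ 1 $ j + A $ i $ 2 * B $ 2 $ j"
  by (simp add: matrix_matrix_mult_def sum_2)

lemma SL2Z_mult: "A \<in> SL2Z \<Longrightarrow> B \<in> SL2Z \<Longrightarrow> A ** B \<in> SL2Z"
  by (simp add: SL2Z_def det_mul)

lemma SL2Z_uminus: "A \<in> SL2Z \<Longrightarrow> - A \<in> SL2Z"
  by (simp add: SL2Z_iff)

lemma SL2Z_one: "mat 1 \<in> SL2Z"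
  by (simp add: SL2Z_def)

text \<open>The adjugate matrix: integral without any division, and the inverse because the
  determinant is 1.\<close>

definition SL2Z_inv :: "int^2^2 \<Rightarrow> int^2^2" where
  "SL2Z_inv A = mat2 (A $ 2 $ 2) (- A $ 1 $ 2) (- A $ 2 $ 1) (A $ 1 $ 1)"

lemma SL2Z_inv: "A \<in> SL2Z \<Longrightarrow> SL2Z_inv A \<in> SL2Z"
  by (simp add: SL2Z_inv_def SL2Z_iff algebra_simps)

lemma SL2Z_inv_inv [simp]: "SL2Z_inv (SL2Z_inv A) = A"
  by (rule mat2_eqI) (simp_all add: SL2Z_inv_def)

lemma SL2Z_mult_inv [simp]:
  "A \<in> SL2Z \<Longrightarrow> A ** SL2Z_inv A = mat 1" "A \<in> SL2Z \<Longrightarrow> SL2Z_inv A ** A = mat 1"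
  by (rule mat2_eqI; simp add: SL2Z_inv_def SL2Z_iff matrix_mult_2_sel mat_def algebra_simps)+

text \<open>The factor commonly written j(A, z); \<open>automorphy_mult\<close> is its cocycle
  relation.\<close>

definition automorphy :: "int^2^2 \<Rightarrow> complex \<Rightarrow> complex" where
  "automorphy A z = of_int (A $ 2 $ 1) * z + of_int (A $ 2 $ 2)"

lemma SL2Z_act_eq: "SL2Z_act A z = (of_int (A $ 1 $ 1) * z + of_int (A $ 1 $ 2)) / automorphy A z"
  by (simp add: SL2Z_act_def moebius_def automorphy_def)

lemma Im_pos: "z \<in> upper_half_plane \<Longrightarrow> Im z > 0"
  by (simp add: upper_half_plane_def)

lemma automorphy_nonzero:
  assumes "A \<in> SL2Z" "z \<in> upper_half_plane"
  shows "automorphy A z \<noteq> 0"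
proof
  assume "automorphy A z = 0"
  then have "Im (automorphy A z) = 0" "Re (automorphy A z) = 0" by simp_all
  then have "A $ 2 $ 1 = 0" "A $ 2 $ 2 = 0" using Im_pos[OF assms(2)] by (auto simp: automorphy_def)
  then show False using assms(1) by (simp add: SL2Z_iff)
qed

lemma Im_SL2Z_act:
  assumes "A \<in> SL2Z"
  shows "Im (SL2Z_act A z) = Im z / (cmod (automorphy A z))\<^sup>2"
proof -
  define a b c d where "a = real_of_int (A $ 1 $ 1)" "b = real_of_int (A $ 1 $ 2)" "c = real_of_int (A $ 2 $ 1)" "d = real_of_int (A $ 2 $ 2)"
  have det: "a * d - b * c = 1"
    using assms unfolding SL2Z_iff a_b_c_d_def of_int_mult[symmetric] of_int_diff[symmetric] by simp
  have "Im (SL2Z_act A z) = ((a * d - b * c) * Im z) / (cmod (automorphy A z))\<^sup>2"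
    by (simp add: SL2Z_act_eq Im_divide cmod_power2 automorphy_def flip: a_b_c_d_def) (simp add: algebra_simps)
  then show ?thesis by (simp add: det)
qed

lemma SL2Z_act_in: "A \<in> SL2Z \<Longrightarrow> z \<in> upper_half_plane \<Longrightarrow> SL2Z_act A z \<in> upper_half_plane"
  using automorphy_nonzero[of A z] by (simp add: upper_half_plane_def Im_SL2Z_act)

lemma automorphy_mult:
  assumes "B \<in> SL2Z" "z \<in> upper_half_plane"
  shows "automorphy (A ** B) z = automorphy A (SL2Z_act B z) * automorphy B z"
proof -
  define u v where "u = of_int (B $ 1 $ 1) * z + of_int (B $ 1 $ 2)" "v = automorphy B z"
  have "v \<noteq> 0" using automorphy_nonzero[OF assms] by (simp add: u_v_def)
  then have "automorphy A (u / v) * v = of_int (A $ 2 $ 1) * u + of_int (A $ 2 $ 2) * v"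
    by (simp add: automorphy_def field_simps)
  also have "\<dots> = automorphy (A ** B) z"
    by (simp add: automorphy_def u_v_def matrix_mult_2_sel algebra_simps)
  finally show ?thesis by (simp add: SL2Z_act_eq u_v_def)
qed

lemma SL2Z_act_mult:
  assumes "A \<in> SL2Z" "B \<in> SL2Z" "z \<in> upper_half_plane"
  shows "SL2Z_act (A ** B) z = SL2Z_act A (SL2Z_act B z)"
proof -
  define u v where "u = of_int (B $ 1 $ 1) * z + of_int (B $ 1 $ 2)" "v = automorphy B z"
  have v: "v \<noteq> 0" using automorphy_nonzero[OF assms(2,3)] by (simp add: u_v_def)
  have "automorphy A (u / v) \<noteq> 0"
    using automorphy_nonzero[OF assms(1) SL2Z_act_in[OF assms(2,3)]] by (simp add: SL2Z_act_eq u_v_def)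
  have "SL2Z_act A (u / v) = (of_int (A $ 1 $ 1) * (u / v) + of_int (A $ 1 $ 2)) * v / (automorphy A (u / v) * v)"
    using v by (simp add: SL2Z_act_eq)
  also have "(of_int (A $ 1 $ 1) * (u / v) + of_int (A $ 1 $ 2)) * v = of_int (A $ 1 $ 1) * u + of_int (A $ 1 $ 2) * v"
    using v by (simp add: field_simps)
  also have "\<dots> = of_int ((A ** B) $ 1 $ 1) * z + of_int ((A ** B) $ 1 $ 2)"
    by (simp add: automorphy_def u_v_def matrix_mult_2_sel algebra_simps)
  also have "automorphy A (u / v) * v = automorphy (A ** B) z"
    using automorphy_mult[OF assms(2,3), of A] by (simp add: SL2Z_act_eq u_v_def)
  finally show ?thesis by (simp add: SL2Z_act_eq u_v_def)
qed

lemma SL2Z_act_one [simp]: "SL2Z_act (mat 1) z = z"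
  by (simp add: SL2Z_act_def moebius_def mat_def)

lemma SL2Z_act_uminus: "SL2Z_act (- A) z = SL2Z_act A z"
proof -
  have "of_int ((- A) $ 1 $ 1) * z + of_int ((- A) $ 1 $ 2) = - (of_int (A $ 1 $ 1) * z + of_int (A $ 1 $ 2) :: complex)"
    "automorphy (- A) z = - automorphy A z"
    by (simp_all add: automorphy_def)
  then show ?thesis unfolding SL2Z_act_eq by (simp only: minus_divide_divide)
qed

lemma SL2Z_act_inv:
  assumes "A \<in> SL2Z" "z \<in> upper_half_plane"
  shows "SL2Z_act (SL2Z_inv A) (SL2Z_act A z) = z" "SL2Z_act A (SL2Z_act (SL2Z_inv A) z) = z"
  using SL2Z_act_mult[OF SL2Z_inv[OF assms(1)] assms] SL2Z_act_mult[OF assms(1) SL2Z_inv[OF assms(1)] assms(2)] assms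
  by simp_all

section \<open>The action on the half-plane: derivative, heights, proper discontinuity\<close>

lemma SL2Z_act_has_derivative:
  assumes "A \<in> SL2Z" "z \<in> upper_half_plane"
  shows "(SL2Z_act A has_field_derivative 1 / (automorphy A z)\<^sup>2) (at z)"
proof -
  define a b c d :: complex where "a = of_int (A $ 1 $ 1)" "b = of_int (A $ 1 $ 2)" "c = of_int (A $ 2 $ 1)" "d = of_int (A $ 2 $ 2)"
  have det: "a * d - b * c = 1"
    using assms(1) unfolding SL2Z_iff a_b_c_d_def of_int_mult[symmetric] of_int_diff[symmetric] by simp
  have nz: "c * z + d \<noteq> 0" using automorphy_nonzero[OF assms] by (simp add: automorphy_def a_b_c_d_def)
  have "((\<lambda>z. (a * z + b) / (c * z + d)) has_field_derivative (a * (c * z + d) - (a * z + b) * c) / ((c * z + d) * (c * z + d))) (at z)"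
    using nz by (auto intro!: derivative_eq_intros)
  also have "a * (c * z + d) - (a * z + b) * c = a * d - b * c" by (simp add: algebra_simps)
  moreover have "SL2Z_act A = (\<lambda>z. (a * z + b) / (c * z + d))" "automorphy A z = c * z + d"
    by (simp_all add: SL2Z_act_def moebius_def automorphy_def a_b_c_d_def)
  ultimately show ?thesis by (simp add: det power2_eq_square)
qed

lemma continuous_on_SL2Z_act: "A \<in> SL2Z \<Longrightarrow> continuous_on upper_half_plane (SL2Z_act A)"
  by (meson SL2Z_act_has_derivative DERIV_isCont continuous_at_imp_continuous_on)

lemma inj_on_SL2Z_act: "A \<in> SL2Z \<Longrightarrow> inj_on (SL2Z_act A) upper_half_plane"
  by (metis SL2Z_act_inv(1) inj_onI)

lemma borel_measurable_SL2Z_act [measurable]: "SL2Z_act A \<in> borel_measurable borel"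
  unfolding SL2Z_act_def moebius_def by measurable

text \<open>Let (c, d) be the lower row. For c = 0 the determinant forces d = 1 or d = -1, and the
  height is unchanged; otherwise |c z + d| >= |c| Im z >= Im z, so the new height is at most 1 / Im
  z. An orbit therefore cannot climb arbitrarily high.\<close>

lemma Im_SL2Z_act_le:
  assumes "A \<in> SL2Z" "z \<in> upper_half_plane"
  shows "Im (SL2Z_act A z) \<le> max (Im z) (1 / Im z)"
proof -
  have y: "Im z > 0" using assms(2) by (rule Im_pos)
  define c where "c = A $ 2 $ 1"
  define d where "d = A $ 2 $ 2"
  have n: "(cmod (automorphy A z))\<^sup>2 = (c * Re z + d)\<^sup>2 + (c * Im z)\<^sup>2"
    by (simp add: automorphy_def cmod_power2 c_def d_def)
  show ?thesis
  proof (cases "c = 0")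
    case True
    then have "A $ 1 $ 1 * d = 1" using assms(1) by (simp add: SL2Z_iff c_def d_def)
    then have "\<bar>d\<bar> = 1" by (metis abs_mult_self_eq abs_one mult.commute zmult_eq_1_iff abs_minus_cancel)
    then have "(real_of_int d)\<^sup>2 = 1" by (metis of_int_1 of_int_abs power2_abs power_one)
    then show ?thesis using True by (simp add: Im_SL2Z_act[OF assms(1)] n)
  next
    case False
    then have "(1::int) \<le> c\<^sup>2" by (simp add: int_one_le_iff_zero_less)
    then have "1 \<le> (real_of_int c)\<^sup>2" by (metis of_int_1_le_iff of_int_power)
    then have "1 * (Im z)\<^sup>2 \<le> (real_of_int c)\<^sup>2 * (Im z)\<^sup>2" by (intro mult_right_mono) auto
    then have "(Im z)\<^sup>2 \<le> (cmod (automorphy A z))\<^sup>2" unfolding n by (simp add: power_mult_distrib add_increasing)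
    then have "Im z / (cmod (automorphy A z))\<^sup>2 \<le> Im z / (Im z)\<^sup>2"
      using y by (intro divide_left_mono mult_pos_pos) (auto intro: less_le_trans[of _ "(Im z)\<^sup>2"])
    also have "\<dots> = 1 / Im z" using y by (simp add: power2_eq_square)
    finally show ?thesis by (simp add: Im_SL2Z_act[OF assms(1)])
  qed
qed

lemma finite_bounded_int_matrices: "finite {A :: int^2^2. \<forall>i j. \<bar>A $ i $ j\<bar> \<le> N}"
proof (rule finite_subset)
  show "finite ((\<lambda>(a, b, c, d). mat2 a b c d) ` ({-N..N} \<times> {-N..N} \<times> {-N..N} \<times> {-N..N}))" by simp
  show "{A :: int^2^2. \<forall>i j. \<bar>A $ i $ j\<bar> \<le> N} \<subseteq> (\<lambda>(a, b, c, d). mat2 a b c d) ` ({-N..N} \<times> {-N..N} \<times> {-N..N} \<times> {-N..N})"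
  proof
    fix A :: "int^2^2" assume "A \<in> {A. \<forall>i j. \<bar>A $ i $ j\<bar> \<le> N}"
    then have "\<bar>A $ i $ j\<bar> \<le> N" for i j by simp
    then have "A $ i $ j \<in> {-N..N}" for i j by (simp add: abs_le_iff) (metis minus_le_iff)
    moreover have "A = mat2 (A $ 1 $ 1) (A $ 1 $ 2) (A $ 2 $ 1) (A $ 2 $ 2)" by (rule mat2_eqI) simp_all
    ultimately show "A \<in> (\<lambda>(a, b, c, d). mat2 a b c d) ` ({-N..N} \<times> {-N..N} \<times> {-N..N} \<times> {-N..N})"
      by (intro image_eqI[where x="(A $ 1 $ 1, A $ 1 $ 2, A $ 2 $ 1, A $ 2 $ 2)"]) auto
  qed
qed

text \<open>The lower bound on the height of A z bounds |c z + d|, and then the bound on |A z|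
  bounds |a z + b|. A bounded linear form p z + q leaves finitely many integers p and q, since Im z
  is bounded below and |z| above.\<close>

lemma SL2Z_properly_discontinuous:
  assumes K: "compact K" "K \<subseteq> upper_half_plane" and L: "compact L" "L \<subseteq> upper_half_plane"
  shows "finite {A \<in> SL2Z. \<exists>z\<in>L. SL2Z_act A z \<in> K}"
proof -
  obtain y where y: "y > 0" "\<And>z. z \<in> K \<union> L \<Longrightarrow> y \<le> Im z"
    using compact_upper_half_plane_Im_bound[of "K \<union> L"] compact_Un[OF K(1) L(1)] K(2) L(2) by auto
  obtain M where M: "M > 0" "\<And>z. z \<in> K \<union> L \<Longrightarrow> cmod z \<le> M"
    using compact_imp_bounded[OF compact_Un[OF K(1) L(1)]] bounded_pos by metis
  define B where "B = sqrt (M / y)"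
  have B: "B \<ge> 0" using M y by (simp add: B_def)
  have lin: "\<bar>real_of_int p\<bar> \<le> S / y" "\<bar>real_of_int q\<bar> \<le> S + S / y * M"
    if z: "z \<in> L" and S: "cmod (of_int p * z + of_int q) \<le> S" for p q z S
  proof -
    have "\<bar>real_of_int p\<bar> * y \<le> \<bar>real_of_int p\<bar> * Im z"
      using y(2)[of z] z by (intro mult_left_mono) auto
    also have "\<dots> = \<bar>Im (of_int p * z + of_int q)\<bar>" using y(1) y(2)[of z] z by (simp add: abs_mult)
    also have "\<dots> \<le> S" using abs_Im_le_cmod S order.trans by blast
    finally show p: "\<bar>real_of_int p\<bar> \<le> S / y" using y(1) by (simp add: field_simps)
    have "\<bar>real_of_int q\<bar> = cmod ((of_int p * z + of_int q) - of_int p * z)" by simp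
    also have "\<dots> \<le> cmod (of_int p * z + of_int q) + cmod (of_int p * z)" by (rule norm_triangle_ineq4)
    also have "cmod (of_int p * z) \<le> S / y * M"
      unfolding norm_mult norm_of_int using M(2)[of z] z by (intro mult_mono p) (auto intro: order.trans[OF _ p])
    also note S
    finally show "\<bar>real_of_int q\<bar> \<le> S + S / y * M" by simp
  qed
  define N where "N = max (max (B / y) (B + B / y * M)) (max (M * B / y) (M * B + M * B / y * M))"
  have "\<forall>i j. \<bar>A $ i $ j\<bar> \<le> \<lceil>N\<rceil>" if A: "A \<in> SL2Z" and z: "z \<in> L" "SL2Z_act A z \<in> K" for A z
  proof -
    have zH: "z \<in> upper_half_plane" using z L by auto
    have nz: "automorphy A z \<noteq> 0" by (rule automorphy_nonzero[OF A zH])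
    have "y \<le> Im z / (cmod (automorphy A z))\<^sup>2" using y(2)[of "SL2Z_act A z"] z Im_SL2Z_act[OF A] by simp
    then have "(cmod (automorphy A z))\<^sup>2 \<le> Im z / y" using nz y(1) by (simp add: field_simps)
    also have "\<dots> \<le> M / y"
      using M(2)[of z] z abs_Im_le_cmod[of z] y(1) by (intro divide_right_mono) auto
    finally have j: "cmod (automorphy A z) \<le> B" unfolding B_def by (rule real_le_rsqrt)
    have "of_int (A $ 1 $ 1) * z + of_int (A $ 1 $ 2) = SL2Z_act A z * automorphy A z"
      using nz by (simp add: SL2Z_act_eq)
    then have "cmod (of_int (A $ 1 $ 1) * z + of_int (A $ 1 $ 2)) \<le> M * B"
      using M(2)[of "SL2Z_act A z"] z(2) j M(1) by (auto simp: norm_mult intro!: mult_mono)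
    from lin[OF z(1) this] lin[OF z(1) j[unfolded automorphy_def]]
    have "\<bar>real_of_int (A $ i $ j)\<bar> \<le> N" for i j
      using exhaust_2[of i] exhaust_2[of j] by (auto simp: N_def)
    then show ?thesis by (metis le_of_int_ceiling of_int_abs of_int_le_iff order_trans)
  qed
  then show ?thesis
    by (intro finite_subset[OF _ finite_bounded_int_matrices[of "\<lceil>N\<rceil>"]]) blast
qed

subsection \<open>The fundamental domain\<close>

lemma fundamental_domain_subset: "fundamental_domain \<subseteq> upper_half_plane"
  by (auto simp: fundamental_domain_def)

lemma fundamental_domain_Im:
  assumes "z \<in> fundamental_domain" shows "3 / 4 \<le> (Im z)\<^sup>2" "1 / 2 \<le> Im z"
proof -
  have "(Re z)\<^sup>2 \<le> (1 / 2)\<^sup>2" using assms by (intro abs_le_square_iff[THEN iffD1]) (auto simp: fundamental_domain_def)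
  moreover have "1\<^sup>2 \<le> (cmod z)\<^sup>2" using assms by (intro power_mono) (auto simp: fundamental_domain_def)
  ultimately show *: "3 / 4 \<le> (Im z)\<^sup>2" by (simp add: cmod_power2 power_divide)
  have "Im z > 0" using assms by (auto simp: fundamental_domain_def upper_half_plane_def)
  moreover have "(1 / 2)\<^sup>2 \<le> (Im z)\<^sup>2" using * by (simp add: power_divide)
  ultimately show "1 / 2 \<le> Im z" by (meson power2_le_imp_le less_imp_le)
qed

text \<open>Trades the strict condition Im z > 0 for Im z >= 1/2, so that closedness in the whole
  plane becomes visible.\<close>

lemma fundamental_domain_eq: "fundamental_domain = {z. 1 / 2 \<le> Im z} \<inter> {z. \<bar>Re z\<bar> \<le> 1 / 2} \<inter> {z. 1 \<le> cmod z}"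
  using fundamental_domain_Im(2) by (fastforce simp: fundamental_domain_def upper_half_plane_def)

lemma closed_fundamental_domain: "closed fundamental_domain"
  unfolding fundamental_domain_eq by (intro closed_Int closed_Collect_le continuous_intros)

lemma sets_fundamental_domain [measurable]: "fundamental_domain \<in> sets borel"
  using closed_fundamental_domain by (rule borel_closed)

lemma compact_fundamental_domain_le: "compact {z \<in> fundamental_domain. Im z \<le> T}"
proof -
  have "closed (fundamental_domain \<inter> {z. Im z \<le> T})"
    by (intro closed_Int closed_fundamental_domain closed_Collect_le continuous_intros)
  moreover have "bounded (fundamental_domain \<inter> {z. Im z \<le> T})"
  proof (rule boundedI)
    fix z assume z: "z \<in> fundamental_domain \<inter> {z. Im z \<le> T}"
    then have "\<bar>Re z\<bar> \<le> 1 / 2" "\<bar>Im z\<bar> \<le> T" using fundamental_domain_Im(2)[of z] by (auto simp: fundamental_domain_def)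
    then show "norm z \<le> 1 / 2 + T" using cmod_le[of z] by linarith
  qed
  ultimately have "compact (fundamental_domain \<inter> {z. Im z \<le> T})" using compact_eq_bounded_closed by blast
  moreover have "fundamental_domain \<inter> {z. Im z \<le> T} = {z \<in> fundamental_domain. Im z \<le> T}" by auto
  ultimately show ?thesis by simp
qed

text \<open>The domain is not compact, but a point with a translate in \<open>K\<close> has height
  at most \<open>max M (1 / y)\<close>, by \<open>Im_SL2Z_act_le\<close> for the inverse matrix.
  Only a compact part of the domain is involved.\<close>

lemma finite_fundamental_domain_translates:
  assumes K: "compact K" "K \<subseteq> upper_half_plane"
  shows "finite {A \<in> SL2Z. \<exists>z\<in>fundamental_domain. SL2Z_act A z \<in> K}"
proof -
  obtain y where y: "y > 0" "\<And>z. z \<in> K \<Longrightarrow> y \<le> Im z"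
    using compact_upper_half_plane_Im_bound[OF K] by metis
  obtain M where M: "M > 0" "\<And>z. z \<in> K \<Longrightarrow> cmod z \<le> M"
    using compact_imp_bounded[OF K(1)] bounded_pos by metis
  define L where "L = {z \<in> fundamental_domain. Im z \<le> max M (1 / y)}"
  have "finite {A \<in> SL2Z. \<exists>z\<in>L. SL2Z_act A z \<in> K}"
    using fundamental_domain_subset compact_fundamental_domain_le
    by (intro SL2Z_properly_discontinuous K) (auto simp: L_def)
  moreover have "z \<in> L" if A: "A \<in> SL2Z" "z \<in> fundamental_domain" "SL2Z_act A z \<in> K" for A z
  proof -
    let ?w = "SL2Z_act A z"
    have zH: "z \<in> upper_half_plane" using A(2) fundamental_domain_subset by auto
    have "Im z = Im (SL2Z_act (SL2Z_inv A) ?w)" using SL2Z_act_inv(1)[OF A(1) zH] by simp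
    also have "\<dots> \<le> max (Im ?w) (1 / Im ?w)" by (intro Im_SL2Z_act_le SL2Z_inv SL2Z_act_in A(1) zH)
    also have "\<dots> \<le> max M (1 / y)"
      using y(2)[OF A(3)] y(1) M(2)[OF A(3)] abs_Im_le_cmod[of ?w] by (intro max.mono divide_left_mono) auto
    finally show ?thesis using A(2) by (simp add: L_def)
  qed
  ultimately show ?thesis by (elim finite_subset[rotated]) blast
qed

lemma SL2Z_translation:
  obtains A where "A \<in> SL2Z" "\<And>z. SL2Z_act A z = z + of_int n"
proof
  show "mat2 1 n 0 1 \<in> SL2Z" by (simp add: SL2Z_iff)
  show "SL2Z_act (mat2 1 n 0 1) z = z + of_int n" for z by (simp add: SL2Z_act_eq automorphy_def)
qed

text \<open>Among the translates in the strip |Re| <= 1/2 that are at least as high as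
  \<open>z\<close>, take one of maximal height; it exists, since they lie in a compact box. If its
  modulus were below 1, inversion followed by a translation would raise it further.\<close>

lemma exists_fundamental_domain_rep:
  assumes z: "z \<in> upper_half_plane"
  obtains A where "A \<in> SL2Z" "SL2Z_act A z \<in> fundamental_domain"
proof -
  have recenter: "\<exists>B\<in>SL2Z. \<bar>Re (SL2Z_act B z)\<bar> \<le> 1 / 2 \<and> Im (SL2Z_act B z) = Im w"
    if A: "A \<in> SL2Z" and w: "w = SL2Z_act A z" for A w
  proof -
    obtain T where T: "T \<in> SL2Z" "\<And>z. SL2Z_act T z = z + of_int (- round (Re w))"
      using SL2Z_translation by metis
    have "SL2Z_act (T ** A) z = w - of_int (round (Re w))"
      using SL2Z_act_mult[OF T(1) A z] T(2) w by simp
    moreover have "\<bar>Re w - of_int (round (Re w))\<bar> \<le> 1 / 2"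
      using of_int_round_abs_le[of "Re w"] by (simp add: abs_minus_commute)
    ultimately show ?thesis by (intro bexI[of _ "T ** A"] SL2Z_mult T A) auto
  qed
  define T where "T = max (Im z) (1 / Im z)"
  have y: "Im z > 0" using z by (rule Im_pos)
  \<comment> \<open>The lower edge is at the height of \<open>z\<close>, the upper edge at the
    largest height that \<open>Im_SL2Z_act_le\<close> allows in the orbit.\<close>
  define Box where "Box = cbox (Complex (- 1 / 2) (Im z)) (Complex (1 / 2) T)"
  define G where "G = {A \<in> SL2Z. \<exists>u\<in>{z}. SL2Z_act A u \<in> Box}"
  have fin: "finite G"
    unfolding G_def using z y
    by (intro SL2Z_properly_discontinuous) (auto simp: Box_def compact_cbox in_cbox_complex_iff upper_half_plane_def)
  have inG: "A \<in> G" if "A \<in> SL2Z" "\<bar>Re (SL2Z_act A z)\<bar> \<le> 1 / 2" "Im z \<le> Im (SL2Z_act A z)" for A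
    using that Im_SL2Z_act_le[OF that(1) z] by (auto simp: G_def Box_def in_cbox_complex_iff T_def abs_le_iff)
  obtain A0 where "A0 \<in> SL2Z" "\<bar>Re (SL2Z_act A0 z)\<bar> \<le> 1 / 2" "Im (SL2Z_act A0 z) = Im z"
    using recenter[OF SL2Z_one, of z] by auto
  then have "G \<noteq> {}" using inG by force
  then obtain A where A: "A \<in> G" "\<And>B. B \<in> G \<Longrightarrow> Im (SL2Z_act B z) \<le> Im (SL2Z_act A z)"
    using obtains_MAX[OF fin \<open>G \<noteq> {}\<close>, of "\<lambda>A. Im (SL2Z_act A z)"] fin
    by (metis (no_types, lifting) Max_ge finite_imageI imageI)
  define w where "w = SL2Z_act A z"
  have AS: "A \<in> SL2Z" and wRe: "\<bar>Re w\<bar> \<le> 1 / 2" and wIm: "Im z \<le> Im w"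
    using A(1) by (auto simp: G_def Box_def in_cbox_complex_iff w_def)
  have wH: "w \<in> upper_half_plane" unfolding w_def by (rule SL2Z_act_in[OF AS z])
  have "1 \<le> cmod w"
  proof (rule ccontr)
    assume n: "\<not> 1 \<le> cmod w"
    \<comment> \<open>The inversion w -> -1 / w, which divides the height by |w|^2 < 1.\<close>
    define S where "S = mat2 0 (-1) 1 0"
    have S: "S \<in> SL2Z" by (simp add: S_def SL2Z_iff)
    have "automorphy S w = w" by (simp add: automorphy_def S_def)
    then have ImS: "Im (SL2Z_act S w) = Im w / (cmod w)\<^sup>2" by (simp add: Im_SL2Z_act[OF S])
    have "w \<noteq> 0" using Im_pos[OF wH] by auto
    then have "(cmod w)\<^sup>2 < 1" "0 < (cmod w)\<^sup>2" using n by (simp_all add: power_less_one_iff abs_square_less_1)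
    then have "Im w < Im w / (cmod w)\<^sup>2" using Im_pos[OF wH] by (simp add: field_simps)
    moreover obtain B where B: "B \<in> SL2Z" "\<bar>Re (SL2Z_act B z)\<bar> \<le> 1 / 2" "Im (SL2Z_act B z) = Im (SL2Z_act S w)"
      using recenter[OF SL2Z_mult[OF S AS] refl] SL2Z_act_mult[OF S AS z] by (auto simp: w_def)
    ultimately have "Im w < Im (SL2Z_act B z)" using ImS by simp
    moreover have "B \<in> G" using inG[OF B(1,2)] wIm calculation by simp
    ultimately show False using A(2)[of B] by (simp add: w_def)
  qed
  then show ?thesis using that[OF AS] wRe wH by (simp add: fundamental_domain_def w_def)
qed

text \<open>|c z + d|^2 = c^2 |z|^2 + 2 c d Re z + d^2 exceeds c^2 - |c d| + d^2, which is a
  positive integer. Strictness comes from |z| > 1 and c \<noteq> 0.\<close>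

lemma Im_SL2Z_act_less:
  assumes A: "A \<in> SL2Z" "A $ 2 $ 1 \<noteq> 0" and z: "z \<in> fundamental_domain" "\<bar>Re z\<bar> \<noteq> 1 / 2" "cmod z \<noteq> 1"
  shows "Im (SL2Z_act A z) < Im z"
proof -
  define c d where "c = A $ 2 $ 1" "d = A $ 2 $ 2"
  have x: "\<bar>Re z\<bar> < 1 / 2" "cmod z > 1" using z by (auto simp: fundamental_domain_def)
  have "(cmod (automorphy A z))\<^sup>2 = (real_of_int c)\<^sup>2 * (cmod z)\<^sup>2 + 2 * (real_of_int c * d * Re z) + (real_of_int d)\<^sup>2"
    unfolding cmod_power2 by (simp add: automorphy_def power2_eq_square algebra_simps flip: c_d_def)
  moreover have "(real_of_int c)\<^sup>2 * 1 < (real_of_int c)\<^sup>2 * (cmod z)\<^sup>2"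
    using A(2) x by (intro mult_strict_left_mono) (auto simp: c_d_def)
  moreover have "\<bar>2 * (real_of_int c * d * Re z)\<bar> \<le> \<bar>real_of_int c * d\<bar> * 1"
    using x mult_left_mono[of "2 * \<bar>Re z\<bar>" 1 "\<bar>real_of_int c * d\<bar>"] by (simp add: abs_mult mult_ac)
  moreover have "1 \<le> (real_of_int c)\<^sup>2 + (real_of_int d)\<^sup>2 - \<bar>real_of_int c * d\<bar>"
  proof -
    have "1 \<le> c\<^sup>2 + d\<^sup>2 - \<bar>c * d\<bar>"
    proof (cases "d = 0")
      case True
      then show ?thesis using A(2) by (simp add: c_d_def int_one_le_iff_zero_less)
    next
      case False
      have "0 \<le> (\<bar>c\<bar> - \<bar>d\<bar>)\<^sup>2" by simp
      also have "\<dots> = c\<^sup>2 + d\<^sup>2 - 2 * \<bar>c * d\<bar>" by (simp add: power2_diff abs_mult)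
      finally have "\<bar>c * d\<bar> \<le> c\<^sup>2 + d\<^sup>2 - \<bar>c * d\<bar>" by simp
      moreover have "1 \<le> \<bar>c * d\<bar>" using False A(2) by (simp add: c_d_def int_one_le_iff_zero_less)
      ultimately show ?thesis by simp
    qed
    then have "real_of_int 1 \<le> real_of_int (c\<^sup>2 + d\<^sup>2 - \<bar>c * d\<bar>)" by (simp only: of_int_le_iff)
    then show ?thesis by simp
  qed
  ultimately have "1 < (cmod (automorphy A z))\<^sup>2" by linarith
  then have "Im z / (cmod (automorphy A z))\<^sup>2 < Im z / 1"
    using Im_pos[of z] z(1) fundamental_domain_subset by (intro divide_strict_left_mono) auto
  then show ?thesis by (simp add: Im_SL2Z_act[OF A(1)])
qed

text \<open>If c were nonzero, \<open>A\<close> would strictly lower the height of \<open>z\<close>,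
  and its inverse would strictly lower the height on the way back, a contradiction. So
  \<open>A\<close> acts as a translation, by an integer smaller than 1 in absolute value.\<close>

lemma fundamental_domain_unique:
  assumes A: "A \<in> SL2Z" and z: "z \<in> fundamental_domain" "\<bar>Re z\<bar> \<noteq> 1 / 2" "cmod z \<noteq> 1"
    and w: "SL2Z_act A z \<in> fundamental_domain" "\<bar>Re (SL2Z_act A z)\<bar> \<noteq> 1 / 2" "cmod (SL2Z_act A z) \<noteq> 1"
  shows "A = mat 1 \<or> A = - mat 1"
proof -
  have zH: "z \<in> upper_half_plane" using z fundamental_domain_subset by auto
  have c: "A $ 2 $ 1 = 0"
  proof (rule ccontr)
    assume n: "A $ 2 $ 1 \<noteq> 0"
    then have "Im (SL2Z_act A z) < Im z" by (rule Im_SL2Z_act_less[OF A _ z])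
    moreover have "Im (SL2Z_act (SL2Z_inv A) (SL2Z_act A z)) < Im (SL2Z_act A z)"
      using n by (intro Im_SL2Z_act_less w SL2Z_inv A) (simp add: SL2Z_inv_def)
    ultimately show False by (simp add: SL2Z_act_inv(1)[OF A zH])
  qed
  then have ad: "A $ 1 $ 1 * A $ 2 $ 2 = 1" using A by (simp add: SL2Z_iff)
  then have "A $ 1 $ 1 = 1 \<and> A $ 2 $ 2 = 1 \<or> A $ 1 $ 1 = - 1 \<and> A $ 2 $ 2 = - 1"
    using zmult_eq_1_iff by blast
  moreover define b where "b = A $ 1 $ 2"
  ultimately have "Re (SL2Z_act A z) = Re z + b \<or> Re (SL2Z_act A z) = Re z - b"
    using c by (auto simp: SL2Z_act_eq automorphy_def)
  moreover have "\<bar>Re z\<bar> < 1 / 2" "\<bar>Re (SL2Z_act A z)\<bar> < 1 / 2" using z w by (auto simp: fundamental_domain_def)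
  ultimately have "\<bar>real_of_int b\<bar> < 1" by linarith
  then have "b = 0" by linarith
  then show ?thesis
    using c ad \<open>A $ 1 $ 1 = 1 \<and> A $ 2 $ 2 = 1 \<or> A $ 1 $ 1 = - 1 \<and> A $ 2 $ 2 = - 1\<close>
    by (elim disjE; intro disjI1 disjI2 mat2_eqI) (auto simp: b_def mat_def)
qed

lemma SL2Z_neq_uminus: "A \<in> SL2Z \<Longrightarrow> A \<noteq> - A"
proof
  assume A: "A \<in> SL2Z" "A = - A"
  have eq: "A $ i $ j = (- A) $ i $ j" for i j
    using A(2) by (rule arg_cong[where f="\<lambda>M. M $ i $ j"])
  have "A $ i $ j = 0" for i j using eq[of i j] by simp
  then show False using A(1) by (simp add: SL2Z_iff)
qed

subsection \<open>Hyperbolic measure\<close>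

lemma sets_hyperbolic_measure [measurable_cong, simp]: "sets hyperbolic_measure = sets borel"
  by (simp add: hyperbolic_measure_def)

lemma space_hyperbolic_measure [simp]: "space hyperbolic_measure = UNIV"
  by (simp add: hyperbolic_measure_def)

lemma sets_upper_half_plane [measurable]: "upper_half_plane \<in> sets borel"
  using open_upper_half_plane by simp

lemma borel_measurable_automorphy [measurable]: "automorphy A \<in> borel_measurable borel"
  unfolding automorphy_def by measurable

text \<open>The change of variables formula for the action, read as an equality of measures so that
  it extends to all nonnegative integrands at once. The density |c z + d|^(-4) is the squared
  modulus of the derivative.\<close>

lemma distr_SL2Z_act_density:
  assumes A: "A \<in> SL2Z"
  shows "distr (density lborel (\<lambda>z. indicator upper_half_plane z * ennreal ((cmod (1 / (automorphy A z)\<^sup>2))\<^sup>2))) borel (SL2Z_act A)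
      = density lborel (indicator upper_half_plane)" (is "distr ?N _ _ = ?R")
proof (rule measure_eqI)
  fix B assume "B \<in> sets (distr ?N borel (SL2Z_act A))"
  then have B [measurable]: "B \<in> sets borel" by simp
  have pre [measurable]: "SL2Z_act A -` B \<in> sets borel"
    using measurable_sets[OF borel_measurable_SL2Z_act B] by simp
  have sub: "B \<inter> upper_half_plane \<subseteq> SL2Z_act A ` upper_half_plane"
    using SL2Z_act_inv(2)[OF A] SL2Z_act_in[OF SL2Z_inv[OF A]] by (metis Int_iff image_eqI subsetI)
  have m: "(\<lambda>z. 1 / (automorphy A z)\<^sup>2) \<in> borel_measurable borel" by measurable
  have "emeasure ?R B = emeasure lborel (B \<inter> upper_half_plane)"
    by (subst emeasure_density) (auto simp: indicator_inter_arith[symmetric] Int_commute intro!: nn_integral_cong)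
  also have "\<dots> = (\<integral>\<^sup>+z. indicator (upper_half_plane \<inter> SL2Z_act A -` (B \<inter> upper_half_plane)) z * ennreal ((cmod (1 / (automorphy A z)\<^sup>2))\<^sup>2) \<partial>lborel)"
    by (rule emeasure_holomorphic_preimage[OF sets_upper_half_plane inj_on_SL2Z_act[OF A] SL2Z_act_has_derivative[OF A] m borel_measurable_SL2Z_act _ sub]) auto
  also have "\<dots> = (\<integral>\<^sup>+z. indicator upper_half_plane z * ennreal ((cmod (1 / (automorphy A z)\<^sup>2))\<^sup>2) * indicator (SL2Z_act A -` B) z \<partial>lborel)"
    using SL2Z_act_in[OF A] by (intro nn_integral_cong) (auto simp: indicator_def)
  also have "\<dots> = emeasure (distr ?N borel (SL2Z_act A)) B"
    by (subst emeasure_distr) (auto simp: emeasure_density)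
  finally show "emeasure (distr ?N borel (SL2Z_act A)) B = emeasure ?R B" by simp
qed simp

text \<open>Im (A z) = Im z / |c z + d|^2, so the Jacobian |c z + d|^(-4) is exactly what turns 1 /
  (Im (A z))^2 into 1 / (Im z)^2.\<close>

lemma hyperbolic_measure_invariant:
  assumes A: "A \<in> SL2Z"
  shows "distr hyperbolic_measure borel (SL2Z_act A) = hyperbolic_measure"
proof (rule measure_eqI)
  fix B assume "B \<in> sets (distr hyperbolic_measure borel (SL2Z_act A))"
  then have B [measurable]: "B \<in> sets borel" by simp
  have pre [measurable]: "SL2Z_act A -` B \<in> sets borel"
    using measurable_sets[OF borel_measurable_SL2Z_act B] by simp
  let ?h = "\<lambda>z. ennreal (1 / (Im z)\<^sup>2) * indicator B z"
  have "emeasure hyperbolic_measure B = (\<integral>\<^sup>+z. ?h z \<partial>density lborel (indicator upper_half_plane))"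
    unfolding hyperbolic_measure_def
    by (subst emeasure_density; (subst nn_integral_density)?) (auto simp: mult_ac intro!: nn_integral_cong)
  also have "\<dots> = (\<integral>\<^sup>+z. ?h (SL2Z_act A z) \<partial>density lborel (\<lambda>z. indicator upper_half_plane z * ennreal ((cmod (1 / (automorphy A z)\<^sup>2))\<^sup>2)))"
    unfolding distr_SL2Z_act_density[OF A, symmetric] by (subst nn_integral_distr) auto
  also have "\<dots> = (\<integral>\<^sup>+z. indicator upper_half_plane z * ennreal ((cmod (1 / (automorphy A z)\<^sup>2))\<^sup>2) * ?h (SL2Z_act A z) \<partial>lborel)"
    by (subst nn_integral_density) auto
  also have "\<dots> = (\<integral>\<^sup>+z. indicator upper_half_plane z * ennreal (1 / (Im z)\<^sup>2) * indicator (SL2Z_act A -` B) z \<partial>lborel)"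
  proof (intro nn_integral_cong)
    fix z
    show "indicator upper_half_plane z * ennreal ((cmod (1 / (automorphy A z)\<^sup>2))\<^sup>2) * ?h (SL2Z_act A z) =
      indicator upper_half_plane z * ennreal (1 / (Im z)\<^sup>2) * indicator (SL2Z_act A -` B) z"
    proof (cases "z \<in> upper_half_plane")
      case True
      have "(cmod (1 / (automorphy A z)\<^sup>2))\<^sup>2 * (1 / (Im (SL2Z_act A z))\<^sup>2) = 1 / (Im z)\<^sup>2"
        using automorphy_nonzero[OF A True] Im_pos[OF True]
        by (simp add: Im_SL2Z_act[OF A] norm_divide norm_power power_divide)
      then have "ennreal ((cmod (1 / (automorphy A z)\<^sup>2))\<^sup>2) * ennreal (1 / (Im (SL2Z_act A z))\<^sup>2) = ennreal (1 / (Im z)\<^sup>2)"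
        by (simp flip: ennreal_mult)
      then show ?thesis using True by (simp add: indicator_def)
    qed simp
  qed
  also have "\<dots> = emeasure hyperbolic_measure (SL2Z_act A -` B)"
    unfolding hyperbolic_measure_def by (subst emeasure_density) auto
  also have "\<dots> = emeasure (distr hyperbolic_measure borel (SL2Z_act A)) B"
    by (subst emeasure_distr) auto
  finally show "emeasure (distr hyperbolic_measure borel (SL2Z_act A)) B = emeasure hyperbolic_measure B" by simp
qed simp

lemma integral_SL2Z_act:
  fixes F :: "complex \<Rightarrow> 'b::{banach, second_countable_topology}"
  assumes A: "A \<in> SL2Z" and F: "F \<in> borel_measurable borel"
  shows "integrable hyperbolic_measure (\<lambda>z. F (SL2Z_act A z)) \<longleftrightarrow> integrable hyperbolic_measure F"
    and "(\<integral>z. F (SL2Z_act A z) \<partial>hyperbolic_measure) = (\<integral>z. F z \<partial>hyperbolic_measure)"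
  using integrable_distr_eq[of "SL2Z_act A" hyperbolic_measure borel F] integral_distr[of "SL2Z_act A" hyperbolic_measure borel F] F
  by (simp_all add: hyperbolic_measure_invariant[OF A])

lemma integral_hyperbolic_measure:
  fixes F :: "complex \<Rightarrow> 'b::{banach, second_countable_topology}"
  assumes F: "F \<in> borel_measurable borel" and supp: "\<And>z. z \<notin> upper_half_plane \<Longrightarrow> F z = 0"
  shows "integrable hyperbolic_measure F \<longleftrightarrow> integrable lborel (\<lambda>z. (1 / (Im z)\<^sup>2) *\<^sub>R F z)"
    and "(\<integral>z. F z \<partial>hyperbolic_measure) = (\<integral>z. (1 / (Im z)\<^sup>2) *\<^sub>R F z \<partial>lborel)"
proof -
  have h: "hyperbolic_measure = density lborel (\<lambda>z. ennreal (indicator upper_half_plane z * (1 / (Im z)\<^sup>2)))"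
    unfolding hyperbolic_measure_def by (intro arg_cong2[where f=density] refl ext) (auto simp: indicator_def)
  have eq: "(indicator upper_half_plane z * (1 / (Im z)\<^sup>2)) *\<^sub>R F z = (1 / (Im z)\<^sup>2) *\<^sub>R F z" for z
    using supp[of z] by (auto simp: indicator_def)
  show "integrable hyperbolic_measure F \<longleftrightarrow> integrable lborel (\<lambda>z. (1 / (Im z)\<^sup>2) *\<^sub>R F z)"
    using integrable_density[of F lborel "\<lambda>z. indicator upper_half_plane z * (1 / (Im z)\<^sup>2)"] F unfolding h eq by simp
  show "(\<integral>z. F z \<partial>hyperbolic_measure) = (\<integral>z. (1 / (Im z)\<^sup>2) *\<^sub>R F z \<partial>lborel)"
    using integral_density[of F lborel "\<lambda>z. indicator upper_half_plane z * (1 / (Im z)\<^sup>2)"] F unfolding h eq by simp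
qed

section \<open>The volume of the fundamental domain and its null boundary\<close>

lemma borel_measurable_Complex: "(\<lambda>(x, y). Complex x y) \<in> borel_measurable (lborel \<Otimes>\<^sub>M lborel)"
proof -
  have "(\<lambda>(x, y). Complex x y) = (\<lambda>p. of_real (fst p) + \<i> * of_real (snd p))"
    by (auto simp: Complex_eq fun_eq_iff)
  then show ?thesis by simp
qed

lemma lborel_complex_eq_distr_pair:
  "(lborel :: complex measure) = distr (lborel \<Otimes>\<^sub>M lborel) borel (\<lambda>(x, y). Complex x y)"
proof (rule lborel_eqI)
  have m: "(\<lambda>(x, y). Complex x y) \<in> borel_measurable (lborel \<Otimes>\<^sub>M lborel)"
    by (rule borel_measurable_Complex)
  fix l u :: complex
  assume le: "\<And>b. b \<in> Basis \<Longrightarrow> l \<bullet> b \<le> u \<bullet> b"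
  have le': "Re l \<le> Re u" "Im l \<le> Im u"
    using le[of 1] le[of \<i>] by (auto simp: Basis_complex_def)
  have vim: "(\<lambda>(x, y). Complex x y) -` box l u = {Re l<..<Re u} \<times> {Im l<..<Im u}"
    by (auto simp: in_box_complex_iff)
  have "emeasure (distr (lborel \<Otimes>\<^sub>M lborel) borel (\<lambda>(x, y). Complex x y)) (box l u) =
      emeasure (lborel \<Otimes>\<^sub>M lborel) ({Re l<..<Re u} \<times> {Im l<..<Im u})"
    using m by (subst emeasure_distr) (auto simp: vim space_pair_measure)
  also have "\<dots> = emeasure lborel {Re l<..<Re u} * emeasure lborel {Im l<..<Im u}"
    by (subst lborel.emeasure_pair_measure_Times) auto
  also have "\<dots> = ennreal (\<Prod>b\<in>Basis. (u - l) \<bullet> b)"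
    using le' by (simp add: Basis_complex_def ennreal_mult)
  finally show "emeasure (distr (lborel \<Otimes>\<^sub>M lborel) borel (\<lambda>(x, y). Complex x y)) (box l u) = ennreal (\<Prod>b\<in>Basis. (u - l) \<bullet> b)" .
qed simp

text \<open>For |x| <= 1/2 the integral of 1 / y^2 from sqrt (1 - x^2) to infinity is 1 / sqrt (1 -
  x^2), with antiderivative arcsin; each of the two halves of the strip gives pi / 6.\<close>

lemma emeasure_fundamental_domain: "emeasure hyperbolic_measure fundamental_domain = ennreal (pi / 3)"
proof -
  have m [measurable]: "(\<lambda>(x, y). Complex x y) \<in> borel_measurable (lborel \<Otimes>\<^sub>M lborel)"
    by (rule borel_measurable_Complex)
  have m' [measurable]: "(\<lambda>p. Complex (fst p) (snd p)) \<in> borel_measurable (lborel \<Otimes>\<^sub>M lborel)"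
    using m by (simp add: case_prod_unfold)
  have fd: "Complex x y \<in> fundamental_domain \<longleftrightarrow> x \<in> {- 1 / 2..1 / 2} \<and> y \<in> {sqrt (1 - x\<^sup>2)..}" for x y
  proof (cases "\<bar>x\<bar> \<le> 1 / 2")
    case True
    then have "x\<^sup>2 \<le> (1 / 2)\<^sup>2" by (simp add: abs_le_square_iff[symmetric])
    then have x: "1 - x\<^sup>2 > 0" by (simp add: power_divide)
    have "y > 0 \<and> 1 \<le> sqrt (x\<^sup>2 + y\<^sup>2) \<longleftrightarrow> sqrt (1 - x\<^sup>2) \<le> y"
    proof
      assume "y > 0 \<and> 1 \<le> sqrt (x\<^sup>2 + y\<^sup>2)"
      then show "sqrt (1 - x\<^sup>2) \<le> y" by (intro real_le_lsqrt) auto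
    next
      assume y: "sqrt (1 - x\<^sup>2) \<le> y"
      then have y0: "y > 0" using x by (meson less_le_trans real_sqrt_gt_zero)
      have "1 - x\<^sup>2 \<le> y\<^sup>2" using y x y0 by (simp add: real_sqrt_le_iff' sqrt_le_D)
      then show "y > 0 \<and> 1 \<le> sqrt (x\<^sup>2 + y\<^sup>2)" using y0 by simp
    qed
    then show ?thesis using True by (auto simp: fundamental_domain_def upper_half_plane_def cmod_def abs_le_iff)
  qed (auto simp: fundamental_domain_def)
  have "emeasure hyperbolic_measure fundamental_domain = (\<integral>\<^sup>+z. ennreal (1 / (Im z)\<^sup>2) * indicator fundamental_domain z \<partial>lborel)"
    unfolding hyperbolic_measure_def using fundamental_domain_subset
    by (subst emeasure_density) (auto simp: indicator_def intro!: nn_integral_cong)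
  also have "\<dots> = (\<integral>\<^sup>+p. ennreal (1 / (snd p)\<^sup>2) * indicator fundamental_domain (Complex (fst p) (snd p)) \<partial>(lborel \<Otimes>\<^sub>M lborel))"
    by (subst lborel_complex_eq_distr_pair, subst nn_integral_distr) (auto simp: case_prod_unfold)
  also have "\<dots> = (\<integral>\<^sup>+x. \<integral>\<^sup>+y. ennreal (1 / y\<^sup>2) * indicator fundamental_domain (Complex x y) \<partial>lborel \<partial>lborel)"
    by (subst lborel.nn_integral_fst[symmetric]) auto
  also have "\<dots> = (\<integral>\<^sup>+x. ennreal (1 / sqrt (1 - x\<^sup>2)) * indicator {- 1 / 2..1 / 2} x \<partial>lborel)"
  proof (intro nn_integral_cong)
    fix x :: real
    show "(\<integral>\<^sup>+y. ennreal (1 / y\<^sup>2) * indicator fundamental_domain (Complex x y) \<partial>lborel) = ennreal (1 / sqrt (1 - x\<^sup>2)) * indicator {- 1 / 2..1 / 2} x"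
    proof (cases "x \<in> {- 1 / 2..1 / 2}")
      case True
      then have "\<bar>x\<bar> \<le> \<bar>1 / 2\<bar>" by auto
      then have "x\<^sup>2 \<le> (1 / 2)\<^sup>2" by (rule abs_le_square_iff[THEN iffD1])
      then have x: "sqrt (1 - x\<^sup>2) > 0" by (simp add: power_divide)
      have "(\<integral>\<^sup>+y. ennreal (1 / y\<^sup>2) * indicator fundamental_domain (Complex x y) \<partial>lborel) = (\<integral>\<^sup>+y. ennreal (1 / y\<^sup>2) * indicator {sqrt (1 - x\<^sup>2)..} y \<partial>lborel)"
        using True by (intro nn_integral_cong) (simp add: fd indicator_def)
      also have "\<dots> = 0 - (- 1 / sqrt (1 - x\<^sup>2))"
      proof (rule nn_integral_FTC_atLeast)
        fix y assume "sqrt (1 - x\<^sup>2) \<le> y"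
        then have "y > 0" using x by linarith
        then show "((\<lambda>y. - 1 / y) has_real_derivative 1 / y\<^sup>2) (at y)"
          by (auto intro!: derivative_eq_intros simp: power2_eq_square)
      next
        show "((\<lambda>y. - 1 / y) \<longlongrightarrow> (0::real)) at_top" by real_asymp
      qed auto
      finally show ?thesis using True by simp
    next
      case False
      then have "Complex x y \<notin> fundamental_domain" for y using fd by blast
      then have "indicator fundamental_domain (Complex x y) = (0::ennreal)" for y by simp
      then show ?thesis using False by simp
    qed
  qed
  also have "\<dots> = ennreal (arcsin (1 / 2) - arcsin (- 1 / 2))"
  proof (rule nn_integral_FTC_Icc)
    fix x :: real assume x: "x \<in> {- 1 / 2..1 / 2}"
    have "(arcsin has_real_derivative inverse (sqrt (1 - x\<^sup>2))) (at x)"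
      by (rule DERIV_arcsin) (use x in auto)
    then show "(arcsin has_real_derivative 1 / sqrt (1 - x\<^sup>2)) (at x)"
      by (simp add: inverse_eq_divide)
    have "\<bar>x\<bar> \<le> \<bar>1 / 2\<bar>" using x by auto
    then have "x\<^sup>2 \<le> (1 / 2)\<^sup>2" by (rule abs_le_square_iff[THEN iffD1])
    then show "0 \<le> 1 / sqrt (1 - x\<^sup>2)" by (simp add: power_divide)
  qed auto
  also have "arcsin (1 / 2) - arcsin (- 1 / 2) = pi / 3"
  proof -
    have "arcsin (sin (pi / 6)) = pi / 6" by (rule arcsin_sin) auto
    then show ?thesis using arcsin_minus[of "1 / 2"] by (simp add: sin_30)
  qed
  finally show ?thesis .
qed

lemma integral_modular_measure:
  fixes g :: "complex \<Rightarrow> complex"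
  assumes g: "(\<lambda>z. indicat_real fundamental_domain z *\<^sub>R g z) \<in> borel_measurable borel"
  shows "(\<integral>z. g z \<partial>modular_measure) = (3 / pi) *\<^sub>R (\<integral>z. indicat_real fundamental_domain z *\<^sub>R g z \<partial>hyperbolic_measure)"
proof -
  have u: "uniform_measure hyperbolic_measure fundamental_domain = density hyperbolic_measure (\<lambda>z. ennreal (indicator fundamental_domain z * (3 / pi)))"
    unfolding uniform_measure_def
  proof (intro arg_cong2[where f=density] refl ext)
    fix z
    have "indicator fundamental_domain z / ennreal (pi / 3) = ennreal (indicator fundamental_domain z) / ennreal (pi / 3)"
      by (simp add: ennreal_indicator)
    also have "\<dots> = ennreal (indicator fundamental_domain z / (pi / 3))" by (rule divide_ennreal) auto
    finally show "indicator fundamental_domain z / emeasure hyperbolic_measure fundamental_domain = ennreal (indicator fundamental_domain z * (3 / pi))"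
      by (simp add: emeasure_fundamental_domain)
  qed
  have "(\<integral>z. g z \<partial>modular_measure) = (\<integral>z. indicat_real fundamental_domain z *\<^sub>R g z \<partial>uniform_measure hyperbolic_measure fundamental_domain)"
    unfolding modular_measure_def by (subst integral_restrict_space) auto
  also have "\<dots> = (\<integral>z. (indicat_real fundamental_domain z * (3 / pi)) *\<^sub>R (indicat_real fundamental_domain z *\<^sub>R g z) \<partial>hyperbolic_measure)"
    unfolding u using g by (subst integral_density) auto
  also have "\<dots> = (\<integral>z. (3 / pi) *\<^sub>R (indicat_real fundamental_domain z *\<^sub>R g z) \<partial>hyperbolic_measure)"
    by (intro Bochner_Integration.integral_cong refl) (auto simp: indicator_def)
  also have "\<dots> = (3 / pi) *\<^sub>R (\<integral>z. indicat_real fundamental_domain z *\<^sub>R g z \<partial>hyperbolic_measure)"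
    by (rule integral_scaleR_right)
  finally show ?thesis .
qed

text \<open>The boundary lies in two lines and a circle, which are null, and differentiable maps of
  the plane preserve null sets; a finite set of matrices keeps the union null.\<close>

lemma AE_translates_off_boundary:
  assumes G: "finite G" "G \<subseteq> SL2Z"
  shows "AE w in lborel. w \<in> upper_half_plane \<longrightarrow> (\<forall>A\<in>G. \<bar>Re (SL2Z_act A w)\<bar> \<noteq> 1 / 2 \<and> cmod (SL2Z_act A w) \<noteq> 1)"
proof -
  \<comment> \<open>The inner product \<open>\<i> \<bullet> (\<i> * z)\<close> is Re z, so the first
    two sets are the lines Re z = 1/2 and Re z = -1/2.\<close>
  define bd where "bd = {z::complex. \<i> \<bullet> (\<i> * z) = 1 / 2} \<union> {z. \<i> \<bullet> (\<i> * z) = - 1 / 2} \<union> sphere 0 1"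
  have re: "{z::complex. \<i> \<bullet> (\<i> * z) = x} = {z. 1 \<bullet> z = x}" for x by (auto simp: inner_complex_def)
  have neg: "negligible bd"
    unfolding bd_def re by (intro negligible_Un negligible_hyperplane negligible_sphere) auto
  have bd: "z \<in> bd \<longleftrightarrow> \<bar>Re z\<bar> = 1 / 2 \<or> cmod z = 1" for z
    by (auto simp: bd_def inner_complex_def dist_norm)
  define E where "E = (\<Union>A\<in>G. SL2Z_act (SL2Z_inv A) ` (bd \<inter> upper_half_plane))"
  have "negligible E"
    unfolding E_def
  proof (intro negligible_Union finite_imageI G(1); clarify)
    fix A assume "A \<in> G"
    then have A: "SL2Z_inv A \<in> SL2Z" using G(2) SL2Z_inv by auto
    have "SL2Z_act (SL2Z_inv A) differentiable_on (bd \<inter> upper_half_plane)"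
      unfolding differentiable_on_def
    proof
      fix z assume "z \<in> bd \<inter> upper_half_plane"
      then have "(SL2Z_act (SL2Z_inv A) has_derivative (*) (1 / (automorphy (SL2Z_inv A) z)\<^sup>2)) (at z)"
        using SL2Z_act_has_derivative[OF A, of z] by (simp add: has_field_derivative_def)
      then show "SL2Z_act (SL2Z_inv A) differentiable at z within bd \<inter> upper_half_plane"
        by (rule differentiable_at_withinI[OF differentiableI])
    qed
    moreover have "negligible (bd \<inter> upper_half_plane)" by (rule negligible_subset[OF neg]) auto
    ultimately show "negligible (SL2Z_act (SL2Z_inv A) ` (bd \<inter> upper_half_plane))"
      by (intro negligible_differentiable_image_negligible) auto
  qed
  then have "AE w in lborel. w \<notin> E"
    by (auto simp: negligible_iff_null_sets AE_completion_iff dest: AE_not_in)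
  then show ?thesis
  proof eventually_elim
    case (elim w)
    show ?case
    proof (intro impI ballI)
      fix A assume w: "w \<in> upper_half_plane" and A: "A \<in> G"
      then have AS: "A \<in> SL2Z" using G(2) by auto
      have "SL2Z_act A w \<notin> bd"
      proof
        assume "SL2Z_act A w \<in> bd"
        then have "w \<in> SL2Z_act (SL2Z_inv A) ` (bd \<inter> upper_half_plane)"
          using SL2Z_act_inv(1)[OF AS w] SL2Z_act_in[OF AS w] by (metis IntI image_eqI)
        then show False using elim A by (auto simp: E_def)
      qed
      then show "\<bar>Re (SL2Z_act A w)\<bar> \<noteq> 1 / 2 \<and> cmod (SL2Z_act A w) \<noteq> 1" by (simp add: bd)
    qed
  qed
qed

subsection \<open>Automorphic sums and unfolding\<close>

text \<open>A Poincare series over the full group SL_2(Z), so that \<open>A\<close> and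
  \<open>- A\<close> both count. Restricting to nonzero terms makes the index set finite for
  compactly supported \<open>\<psi>\<close>; a sum over an infinite set would be 0.\<close>

definition automorphize :: "(complex \<Rightarrow> 'a::comm_monoid_add) \<Rightarrow> complex \<Rightarrow> 'a" where
  "automorphize \<psi> z = (\<Sum>A\<in>{A \<in> SL2Z. \<psi> (SL2Z_act A z) \<noteq> 0}. \<psi> (SL2Z_act A z))"

lemma automorphize_eq:
  assumes "finite G" "G \<subseteq> SL2Z" "\<And>A. A \<in> SL2Z \<Longrightarrow> \<psi> (SL2Z_act A z) \<noteq> 0 \<Longrightarrow> A \<in> G"
  shows "automorphize \<psi> z = (\<Sum>A\<in>G. \<psi> (SL2Z_act A z))"
  unfolding automorphize_def using assms by (intro sum.mono_neutral_left) auto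

lemma SL2Z_mult_cancel:
  assumes "B \<in> SL2Z"
  shows "(A ** B) ** SL2Z_inv B = A" "(A ** SL2Z_inv B) ** B = A"
  using assms by (simp_all flip: matrix_mul_assoc)

lemma automorphize_invariant:
  assumes B: "B \<in> SL2Z" and z: "z \<in> upper_half_plane"
  shows "automorphize \<psi> (SL2Z_act B z) = automorphize \<psi> z"
  unfolding automorphize_def
proof (rule sum.reindex_bij_witness[of _ "\<lambda>A. A ** SL2Z_inv B" "\<lambda>A. A ** B"])
  have inv: "SL2Z_act (A ** SL2Z_inv B) (SL2Z_act B z) = SL2Z_act A z" if "A \<in> SL2Z" for A
    using SL2Z_act_mult[OF that SL2Z_inv[OF B] SL2Z_act_in[OF B z]] SL2Z_act_inv(1)[OF B z] by simp
  show "A ** SL2Z_inv B \<in> {A \<in> SL2Z. \<psi> (SL2Z_act A (SL2Z_act B z)) \<noteq> 0}"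
    if "A \<in> {A \<in> SL2Z. \<psi> (SL2Z_act A z) \<noteq> 0}" for A
    using that inv[of A] SL2Z_mult[OF _ SL2Z_inv[OF B]] by auto
  show "A ** B \<in> {A \<in> SL2Z. \<psi> (SL2Z_act A z) \<noteq> 0}"
    and "\<psi> (SL2Z_act (A ** B) z) = \<psi> (SL2Z_act A (SL2Z_act B z))"
    if "A \<in> {A \<in> SL2Z. \<psi> (SL2Z_act A (SL2Z_act B z)) \<noteq> 0}" for A
    using that SL2Z_mult[OF _ B] SL2Z_act_mult[OF _ B z] by auto
qed (simp_all add: SL2Z_mult_cancel B)

text \<open>By proper discontinuity only finitely many matrices contribute near a given point, so
  the sum is locally a fixed finite one.\<close>

lemma continuous_on_automorphize:
  fixes \<psi> :: "complex \<Rightarrow> 'a::real_normed_vector"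
  assumes \<psi>: "continuous_on UNIV \<psi>" and K: "compact K" "K \<subseteq> upper_half_plane" and supp: "\<And>z. z \<notin> K \<Longrightarrow> \<psi> z = 0"
  shows "continuous_on upper_half_plane (automorphize \<psi>)"
proof (rule continuous_at_imp_continuous_on, rule ballI)
  fix z assume "z \<in> upper_half_plane"
  then obtain \<delta> where \<delta>: "\<delta> > 0" "cball z \<delta> \<subseteq> upper_half_plane"
    using open_upper_half_plane open_contains_cball by blast
  define G where "G = {A \<in> SL2Z. \<exists>u\<in>cball z \<delta>. SL2Z_act A u \<in> K}"
  have fin: "finite G" unfolding G_def by (rule SL2Z_properly_discontinuous[OF K compact_cball \<delta>(2)])
  have eq: "automorphize \<psi> u = (\<Sum>A\<in>G. \<psi> (SL2Z_act A u))" if "u \<in> ball z \<delta>" for u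
    using that supp by (intro automorphize_eq[OF fin]) (force simp: G_def)+
  have c: "continuous_on (ball z \<delta>) (\<lambda>u. \<Sum>A\<in>G. \<psi> (SL2Z_act A u))"
  proof (rule continuous_on_sum)
    fix A assume "A \<in> G"
    then have "continuous_on (ball z \<delta>) (SL2Z_act A)"
      using continuous_on_subset[OF continuous_on_SL2Z_act, of A "ball z \<delta>"] subset_trans[OF ball_subset_cball \<delta>(2)]
      by (simp add: G_def)
    then show "continuous_on (ball z \<delta>) (\<lambda>u. \<psi> (SL2Z_act A u))"
      by (rule continuous_on_compose2[OF \<psi>]) auto
  qed
  then have "continuous_on (ball z \<delta>) (automorphize \<psi>)"
    by (rule continuous_on_eq) (simp add: eq)
  then show "isCont (automorphize \<psi>) z"
    by (rule continuous_on_interior) (simp add: \<delta>(1))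
qed

text \<open>Off the boundary, the matrix that brings \<open>w\<close> into the domain is unique up
  to sign; \<open>B\<close> and \<open>- B\<close> are distinct with the same action, so the count
  is 2 and not 1.\<close>

lemma card_fundamental_translates:
  assumes w: "w \<in> upper_half_plane"
    and G: "finite G" "G \<subseteq> SL2Z" "\<And>A. A \<in> SL2Z \<Longrightarrow> SL2Z_act (SL2Z_inv A) w \<in> fundamental_domain \<Longrightarrow> A \<in> G"
    and off: "\<And>A. A \<in> G \<Longrightarrow> \<bar>Re (SL2Z_act (SL2Z_inv A) w)\<bar> \<noteq> 1 / 2 \<and> cmod (SL2Z_act (SL2Z_inv A) w) \<noteq> 1"
  shows "card {A \<in> G. SL2Z_act (SL2Z_inv A) w \<in> fundamental_domain} = 2"
proof -
  obtain A0 where A0: "A0 \<in> SL2Z" "SL2Z_act A0 w \<in> fundamental_domain"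
    by (rule exists_fundamental_domain_rep[OF w])
  define B where "B = SL2Z_inv A0"
  have B: "B \<in> SL2Z" "SL2Z_act (SL2Z_inv B) w \<in> fundamental_domain"
    using A0 SL2Z_inv by (simp_all add: B_def)
  have um: "SL2Z_inv (- A) = - SL2Z_inv A" for A
    by (rule mat2_eqI) (simp_all add: SL2Z_inv_def)
  have mB: "- B \<in> SL2Z" "SL2Z_act (SL2Z_inv (- B)) w \<in> fundamental_domain"
    using B by (simp_all add: SL2Z_uminus um SL2Z_act_uminus)
  have "A = B \<or> A = - B" if A: "A \<in> G" "SL2Z_act (SL2Z_inv A) w \<in> fundamental_domain" for A
  proof -
    have AS: "A \<in> SL2Z" using A G by auto
    let ?u = "SL2Z_act (SL2Z_inv B) w"
    have uH: "?u \<in> upper_half_plane" by (rule SL2Z_act_in[OF SL2Z_inv[OF B(1)] w])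
    have eq: "SL2Z_act (SL2Z_inv A ** B) ?u = SL2Z_act (SL2Z_inv A) w"
      using SL2Z_act_mult[OF SL2Z_inv[OF AS] B(1) uH] SL2Z_act_inv(2)[OF B(1) w] by simp
    have "SL2Z_inv A ** B = mat 1 \<or> SL2Z_inv A ** B = - mat 1"
      using off[OF A(1)] off[OF G(3)[OF B]] A(2) B(2)
      by (intro fundamental_domain_unique[of _ ?u] SL2Z_mult SL2Z_inv AS B(1)) (auto simp: eq)
    moreover have "A ** (SL2Z_inv A ** B) = B"
      using AS by (simp add: matrix_mul_assoc)
    moreover have "A ** (- mat 1) = - A"
      by (rule mat2_eqI) (simp_all add: matrix_mult_2_sel mat_def)
    ultimately show ?thesis by auto
  qed
  then have "{A \<in> G. SL2Z_act (SL2Z_inv A) w \<in> fundamental_domain} = {B, - B}"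
    using B mB G(3) by auto
  then show ?thesis using SL2Z_neq_uminus[OF B(1)] by simp
qed

text \<open>Each matrix contributes the integral of \<open>\<psi>\<close> times
  \<open>\<Phi>\<close> over one translate of the domain, by invariance of the measure and of
  \<open>\<Phi>\<close>. The translates cover the half-plane twice, once for \<open>A\<close> and
  once for \<open>- A\<close>; with the reciprocal area 3 / pi this gives 6 / pi.\<close>

lemma unfolding_integral:
  fixes \<psi> :: "complex \<Rightarrow> complex" and \<Phi> :: "complex \<Rightarrow> real"
  assumes \<psi>: "continuous_on UNIV \<psi>" and K: "compact K" "K \<subseteq> upper_half_plane" and supp: "\<And>z. z \<notin> K \<Longrightarrow> \<psi> z = 0"
    and \<Phi>: "continuous_on upper_half_plane \<Phi>" "\<And>A z. A \<in> SL2Z \<Longrightarrow> z \<in> upper_half_plane \<Longrightarrow> \<Phi> (SL2Z_act A z) = \<Phi> z"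
  shows "(\<integral>z. automorphize \<psi> z * of_real (\<Phi> z) \<partial>modular_measure) =
    of_real (6 / pi) * (\<integral>z. \<psi> z * of_real (\<Phi> z / (Im z)\<^sup>2) \<partial>lborel)"
proof -
  \<comment> \<open>The matrices whose term can be nonzero somewhere on the domain; finitely many,
    although the domain is not compact.\<close>
  define G where "G = {A \<in> SL2Z. \<exists>z\<in>fundamental_domain. SL2Z_act A z \<in> K}"
  have G: "finite G" "G \<subseteq> SL2Z"
    using finite_fundamental_domain_translates[OF K] by (auto simp: G_def)
  define h where "h = (\<lambda>z. \<psi> z * of_real (\<Phi> z))"
  have hsupp: "h z = 0" if "z \<notin> K" for z using supp[OF that] by (simp add: h_def)
  have h [measurable]: "h \<in> borel_measurable borel"
  proof -
    have "continuous_on upper_half_plane h"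
      unfolding h_def by (intro continuous_intros \<Phi>(1) continuous_on_subset[OF \<psi>]) auto
    then have "(\<lambda>z. indicator upper_half_plane z *\<^sub>R h z) \<in> borel_measurable borel"
      using open_upper_half_plane by (intro borel_measurable_continuous_on_indicator) auto
    also have "(\<lambda>z. indicator upper_half_plane z *\<^sub>R h z) = h"
      using hsupp K(2) by (auto simp: indicator_def fun_eq_iff)
    finally show ?thesis .
  qed
  have eq: "indicat_real fundamental_domain z *\<^sub>R (automorphize \<psi> z * of_real (\<Phi> z)) =
     (\<Sum>A\<in>G. indicat_real fundamental_domain z *\<^sub>R h (SL2Z_act A z))" for z
  proof (cases "z \<in> fundamental_domain")
    case True
    have "automorphize \<psi> z = (\<Sum>A\<in>G. \<psi> (SL2Z_act A z))"
      using True supp by (intro automorphize_eq G) (force simp: G_def)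
    moreover have "h (SL2Z_act A z) = \<psi> (SL2Z_act A z) * of_real (\<Phi> z)" if "A \<in> G" for A
      using \<Phi>(2)[of A z] True fundamental_domain_subset G(2) that by (auto simp: h_def)
    ultimately show ?thesis using True by (simp add: sum_distrib_right)
  qed simp
  \<comment> \<open>The term of \<open>A\<close>, rewritten as a function of w = A z: the condition
    that z lies in the domain becomes a condition on w.\<close>
  define F where "F = (\<lambda>A w. indicat_real fundamental_domain (SL2Z_act (SL2Z_inv A) w) *\<^sub>R h w)"
  have Fm [measurable]: "F A \<in> borel_measurable borel" for A
  proof -
    have [measurable]: "{w. SL2Z_act (SL2Z_inv A) w \<in> fundamental_domain} \<in> sets borel"
      using measurable_sets[OF borel_measurable_SL2Z_act sets_fundamental_domain, of "SL2Z_inv A"] by (simp add: vimage_def)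
    have "F A = (\<lambda>w. indicat_real {w. SL2Z_act (SL2Z_inv A) w \<in> fundamental_domain} w *\<^sub>R h w)"
      by (auto simp: F_def indicator_def fun_eq_iff)
    also have "\<dots> \<in> borel_measurable borel" by measurable
    finally show ?thesis .
  qed
  have Fsupp: "F A z = 0" if "z \<notin> upper_half_plane" for A z
    using hsupp[of z] K(2) that by (auto simp: F_def)
  have FA: "indicat_real fundamental_domain z *\<^sub>R h (SL2Z_act A z) = F A (SL2Z_act A z)" if "A \<in> G" for A z
  proof (cases "z \<in> upper_half_plane")
    case True
    then show ?thesis using SL2Z_act_inv(1)[of A z] G(2) that by (auto simp: F_def)
  next
    case False
    have AS: "A \<in> SL2Z" using that G(2) by auto
    \<comment> \<open>The height of A z has the sign of Im z, or is 0 when the denominator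
      vanishes.\<close>
    have "SL2Z_act A z \<notin> upper_half_plane"
      using False divide_pos_pos[of "Im z"] by (auto simp: upper_half_plane_def Im_SL2Z_act[OF AS] zero_less_divide_iff)
    then show ?thesis using False fundamental_domain_subset Fsupp by (auto simp: indicator_def)
  qed
  have hint: "integrable lborel (\<lambda>w. (1 / (Im w)\<^sup>2) *\<^sub>R h w)"
  proof -
    have "integrable lborel (\<lambda>w. indicator K w *\<^sub>R ((1 / (Im w)\<^sup>2) *\<^sub>R h w))"
      unfolding h_def
      by (intro borel_integrable_compact K(1) continuous_intros continuous_on_subset[OF \<Phi>(1) K(2)] continuous_on_subset[OF \<psi>])
        (use K(2) in \<open>auto simp: upper_half_plane_def\<close>)
    also have "(\<lambda>w. indicator K w *\<^sub>R ((1 / (Im w)\<^sup>2) *\<^sub>R h w)) = (\<lambda>w. (1 / (Im w)\<^sup>2) *\<^sub>R h w)"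
      using hsupp by (auto simp: indicator_def fun_eq_iff)
    finally show ?thesis .
  qed
  have Fint: "integrable lborel (\<lambda>w. (1 / (Im w)\<^sup>2) *\<^sub>R F A w)" for A
    by (rule Bochner_Integration.integrable_bound[OF hint]) (auto simp: F_def indicator_def)
  have Fint': "integrable hyperbolic_measure (F A)" for A
    using integral_hyperbolic_measure(1)[OF Fm Fsupp] Fint by simp
  have "(\<integral>z. automorphize \<psi> z * of_real (\<Phi> z) \<partial>modular_measure) =
      (3 / pi) *\<^sub>R (\<integral>z. (\<Sum>A\<in>G. indicat_real fundamental_domain z *\<^sub>R h (SL2Z_act A z)) \<partial>hyperbolic_measure)"
    by (subst integral_modular_measure) (simp_all add: eq)
  also have "(\<integral>z. (\<Sum>A\<in>G. indicat_real fundamental_domain z *\<^sub>R h (SL2Z_act A z)) \<partial>hyperbolic_measure) =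
      (\<integral>z. (\<Sum>A\<in>G. F A (SL2Z_act A z)) \<partial>hyperbolic_measure)"
    by (simp add: FA cong: sum.cong)
  also have "\<dots> = (\<Sum>A\<in>G. \<integral>z. F A (SL2Z_act A z) \<partial>hyperbolic_measure)"
    using G(2) integral_SL2Z_act(1)[OF _ Fm] Fint' by (intro Bochner_Integration.integral_sum) auto
  also have "\<dots> = (\<Sum>A\<in>G. \<integral>z. F A z \<partial>hyperbolic_measure)"
    using G(2) integral_SL2Z_act(2)[OF _ Fm] by (intro sum.cong refl) auto
  also have "\<dots> = (\<Sum>A\<in>G. \<integral>z. (1 / (Im z)\<^sup>2) *\<^sub>R F A z \<partial>lborel)"
    using integral_hyperbolic_measure(2)[OF Fm Fsupp] by simp
  also have "\<dots> = (\<integral>z. (\<Sum>A\<in>G. (1 / (Im z)\<^sup>2) *\<^sub>R F A z) \<partial>lborel)"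
    using Fint by (intro Bochner_Integration.integral_sum[symmetric]) auto
  also have "\<dots> = (\<integral>z. 2 * (\<psi> z * of_real (\<Phi> z / (Im z)\<^sup>2)) \<partial>lborel)"
  proof (rule integral_cong_AE)
    show "(\<lambda>z. \<Sum>A\<in>G. (1 / (Im z)\<^sup>2) *\<^sub>R F A z) \<in> borel_measurable lborel" by measurable
    have e: "2 * (\<psi> z * of_real (\<Phi> z / (Im z)\<^sup>2)) = 2 * ((1 / (Im z)\<^sup>2) *\<^sub>R h z)" for z
      by (simp add: h_def scaleR_conv_of_real)
    show "(\<lambda>z. 2 * (\<psi> z * of_real (\<Phi> z / (Im z)\<^sup>2))) \<in> borel_measurable lborel"
      unfolding e by measurable
    have "finite (SL2Z_inv ` G)" "SL2Z_inv ` G \<subseteq> SL2Z" using G SL2Z_inv by auto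
    from AE_translates_off_boundary[OF this]
    show "AE z in lborel. (\<Sum>A\<in>G. (1 / (Im z)\<^sup>2) *\<^sub>R F A z) = 2 * (\<psi> z * of_real (\<Phi> z / (Im z)\<^sup>2))"
    proof eventually_elim
      case (elim w)
      show ?case
      proof (cases "w \<in> K")
        case True
        then have w: "w \<in> upper_half_plane" using K(2) by auto
        have "card {A \<in> G. SL2Z_act (SL2Z_inv A) w \<in> fundamental_domain} = 2"
        proof (rule card_fundamental_translates[OF w G])
          fix A assume A: "A \<in> SL2Z" "SL2Z_act (SL2Z_inv A) w \<in> fundamental_domain"
          then show "A \<in> G" using SL2Z_act_inv(2)[OF A(1) w] True by (force simp: G_def)
        qed (use elim w in auto)
        moreover have "(\<Sum>A\<in>G. (1 / (Im w)\<^sup>2) *\<^sub>R F A w) =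
            of_nat (card {A \<in> G. SL2Z_act (SL2Z_inv A) w \<in> fundamental_domain}) * ((1 / (Im w)\<^sup>2) *\<^sub>R h w)"
        proof -
          have "(\<Sum>A\<in>G. (1 / (Im w)\<^sup>2) *\<^sub>R F A w) = (\<Sum>A\<in>{A \<in> G. SL2Z_act (SL2Z_inv A) w \<in> fundamental_domain}. (1 / (Im w)\<^sup>2) *\<^sub>R h w)"
            using G(1) by (intro sum.mono_neutral_cong_right) (auto simp: F_def)
          then show ?thesis by simp
        qed
        ultimately show ?thesis unfolding e by simp
      next
        case False
        then show ?thesis using hsupp[OF False] supp[OF False] by (simp add: F_def)
      qed
    qed
  qed
  also have "\<dots> = 2 * (\<integral>z. \<psi> z * of_real (\<Phi> z / (Im z)\<^sup>2) \<partial>lborel)"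
    by (rule integral_mult_right_zero)
  finally show ?thesis by (simp add: scaleR_conv_of_real)
qed

subsection \<open>Functions on the modular surface\<close>

lemma self_in_modular_orbit: "z \<in> modular_orbit z"
  unfolding modular_orbit_def using SL2Z_one by (intro image_eqI[where x="mat 1"]) auto

lemma modular_orbit_act:
  assumes A: "A \<in> SL2Z" and z: "z \<in> upper_half_plane"
  shows "modular_orbit (SL2Z_act A z) = modular_orbit z"
proof (intro equalityI subsetI)
  fix w assume "w \<in> modular_orbit (SL2Z_act A z)"
  then obtain B where "B \<in> SL2Z" "w = SL2Z_act B (SL2Z_act A z)" by (auto simp: modular_orbit_def)
  then show "w \<in> modular_orbit z"
    using SL2Z_act_mult[OF _ A z] SL2Z_mult[OF _ A] by (force simp: modular_orbit_def)
next
  fix w assume "w \<in> modular_orbit z"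
  then obtain B where B: "B \<in> SL2Z" "w = SL2Z_act B z" by (auto simp: modular_orbit_def)
  have "SL2Z_act (B ** SL2Z_inv A) (SL2Z_act A z) = w"
    using SL2Z_act_mult[OF B(1) SL2Z_inv[OF A] SL2Z_act_in[OF A z]] SL2Z_act_inv(1)[OF A z] B by simp
  then show "w \<in> modular_orbit (SL2Z_act A z)"
    using SL2Z_mult[OF B(1) SL2Z_inv[OF A]] by (force simp: modular_orbit_def)
qed

lemma orbit_rep_modular_orbit:
  obtains A where "A \<in> SL2Z" "orbit_rep (modular_orbit z) = SL2Z_act A z"
proof -
  have "orbit_rep (modular_orbit z) \<in> modular_orbit z"
    unfolding orbit_rep_def using self_in_modular_orbit by (rule someI)
  then show ?thesis using that by (auto simp: modular_orbit_def)
qed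

lemma modular_surface_rep:
  assumes "p \<in> modular_surface"
  shows "orbit_rep p \<in> upper_half_plane" "modular_orbit (orbit_rep p) = p"
proof -
  obtain z where z: "z \<in> upper_half_plane" "p = modular_orbit z" using assms by (auto simp: modular_surface_def)
  obtain A where A: "A \<in> SL2Z" "orbit_rep (modular_orbit z) = SL2Z_act A z" by (rule orbit_rep_modular_orbit)
  show "orbit_rep p \<in> upper_half_plane" using A z by (simp add: SL2Z_act_in)
  show "modular_orbit (orbit_rep p) = p" using A z by (simp add: modular_orbit_act)
qed

section \<open>Descending to the quotient and lifting from it\<close>

definition descend :: "(complex \<Rightarrow> 'a) \<Rightarrow> complex set \<Rightarrow> 'a" where
  "descend \<phi> p = \<phi> (orbit_rep p)"

lemma descend_modular_orbit:
  assumes "\<And>A. A \<in> SL2Z \<Longrightarrow> \<phi> (SL2Z_act A z) = \<phi> z"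
  shows "descend \<phi> (modular_orbit z) = \<phi> z"
  using assms by (metis descend_def orbit_rep_modular_orbit)

lemma continuous_map_descend:
  assumes "continuous_on upper_half_plane \<phi>"
    and "\<And>A z. A \<in> SL2Z \<Longrightarrow> z \<in> upper_half_plane \<Longrightarrow> \<phi> (SL2Z_act A z) = \<phi> z"
  shows "continuous_map modular_topology euclidean (descend \<phi>)"
proof (rule continuous_compose_quotient_map[OF quotient_map_modular_orbit])
  have "continuous_map (top_of_set upper_half_plane) euclidean \<phi>" using assms(1) by simp
  then show "continuous_map (top_of_set upper_half_plane) euclidean (descend \<phi> \<circ> modular_orbit)"
    by (rule continuous_map_eq) (use assms(2) in \<open>auto simp: descend_modular_orbit\<close>)
qed

lemma finite_support_SL2Z:
  assumes "compact K" "K \<subseteq> upper_half_plane" "\<And>z. z \<notin> K \<Longrightarrow> \<psi> z = 0" "z \<in> upper_half_plane"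
  shows "finite {A \<in> SL2Z. \<psi> (SL2Z_act A z) \<noteq> 0}"
  by (rule finite_subset[OF _ SL2Z_properly_discontinuous[OF assms(1,2), of "{z}"]]) (use assms in auto)

lemma automorphize_ge_one:
  fixes \<eta> :: "complex \<Rightarrow> real"
  assumes K: "compact K" "K \<subseteq> upper_half_plane" and supp: "\<And>z. z \<notin> K \<Longrightarrow> \<eta> z = 0" and nn: "\<And>z. 0 \<le> \<eta> z"
    and z: "z \<in> upper_half_plane" and A: "A \<in> SL2Z" "\<eta> (SL2Z_act A z) = 1"
  shows "1 \<le> automorphize \<eta> z"
proof -
  have "\<eta> (SL2Z_act A z) \<le> automorphize \<eta> z"
    unfolding automorphize_def
    by (rule member_le_sum[where f="\<lambda>A. \<eta> (SL2Z_act A z)"]) (use A nn finite_support_SL2Z[OF K supp z] in auto)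
  then show ?thesis using A by simp
qed

lemma automorphize_nonzero:
  assumes "automorphize \<psi> z \<noteq> 0"
  obtains A where "A \<in> SL2Z" "\<psi> (SL2Z_act A z) \<noteq> 0"
  using assms unfolding automorphize_def by (metis (mono_tags, lifting) mem_Collect_eq sum.not_neutral_contains_not_neutral)

lemma compactin_modular_orbit_image:
  assumes "compact K" "K \<subseteq> upper_half_plane"
  shows "compactin modular_topology (modular_orbit ` K)"
  using assms quotient_imp_continuous_map[OF quotient_map_modular_orbit]
  by (intro image_compactin) (auto simp: compactin_subtopology)

text \<open>The closure of the support must be bounded by a closed set, while the image of
  \<open>K\<close> has only been shown to be compact. The set where the automorphized bump is at
  least 1 is closed by continuity, contains the support, and lies in the compact image of
  \<open>L\<close>.\<close>

lemma Cc_modular_automorphize: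
  fixes \<psi> :: "complex \<Rightarrow> complex"
  assumes \<psi>: "continuous_on UNIV \<psi>" and K: "compact K" "K \<subseteq> upper_half_plane" and supp: "\<And>z. z \<notin> K \<Longrightarrow> \<psi> z = 0"
  shows "descend (automorphize \<psi>) \<in> Cc_modular"
proof -
  have "continuous_map modular_topology euclidean (descend (automorphize \<psi>))"
    by (intro continuous_map_descend continuous_on_automorphize[OF \<psi> K supp] automorphize_invariant)
  moreover have "compactly_supported (descend (automorphize \<psi>))"
  proof -
    obtain \<eta> :: "complex \<Rightarrow> real" and L where \<eta>: "continuous_on UNIV \<eta>" "\<And>z. 0 \<le> \<eta> z" "\<And>z. z \<in> K \<Longrightarrow> \<eta> z = 1"
      "compact L" "L \<subseteq> upper_half_plane" "\<And>z. z \<notin> L \<Longrightarrow> \<eta> z = 0"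
      using bump_function[OF K(1) open_upper_half_plane K(2)] by metis
    define C where "C = {p \<in> topspace modular_topology. descend (automorphize \<eta>) p \<in> {1..}}"
    have "closedin modular_topology C"
      unfolding C_def
      by (rule closedin_continuous_map_preimage[OF continuous_map_descend])
        (auto intro: continuous_on_automorphize[OF \<eta>(1,4,5,6)] automorphize_invariant)
    moreover have "C \<subseteq> modular_orbit ` L"
    proof
      fix p assume p: "p \<in> C"
      then have "automorphize \<eta> (orbit_rep p) \<noteq> 0" by (auto simp: C_def descend_def)
      then obtain A where A: "A \<in> SL2Z" "\<eta> (SL2Z_act A (orbit_rep p)) \<noteq> 0" by (rule automorphize_nonzero)
      then have "SL2Z_act A (orbit_rep p) \<in> L" using \<eta>(6) by blast
      moreover have "modular_orbit (SL2Z_act A (orbit_rep p)) = p"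
        using p A by (simp add: C_def modular_orbit_act modular_surface_rep)
      ultimately show "p \<in> modular_orbit ` L" by force
    qed
    moreover have "{p \<in> modular_surface. descend (automorphize \<psi>) p \<noteq> 0} \<subseteq> C"
    proof
      fix p assume "p \<in> {p \<in> modular_surface. descend (automorphize \<psi>) p \<noteq> 0}"
      then have p: "p \<in> modular_surface" "automorphize \<psi> (orbit_rep p) \<noteq> 0" by (auto simp: descend_def)
      from p(2) obtain A where A: "A \<in> SL2Z" "\<psi> (SL2Z_act A (orbit_rep p)) \<noteq> 0" by (rule automorphize_nonzero)
      then have "SL2Z_act A (orbit_rep p) \<in> K" using supp by blast
      then have "1 \<le> automorphize \<eta> (orbit_rep p)"
        using modular_surface_rep[OF p(1)] A \<eta> by (intro automorphize_ge_one[OF \<eta>(4,5)]) auto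
      then show "p \<in> C" using p by (simp add: C_def descend_def)
    qed
    ultimately show ?thesis
      unfolding compactly_supported_def
      using closed_compactin[OF compactin_modular_orbit_image[OF \<eta>(4,5)]] closure_of_minimal closedin_closure_of
      by (metis order_trans)
  qed
  ultimately show ?thesis by (simp add: Cc_modular_def)
qed

text \<open>The saturation of an open set is the union of its preimages under the continuous maps
  \<open>SL2Z_act A\<close>, so the orbit map is open.\<close>

lemma openin_modular_orbit_image:
  assumes U: "open U" "U \<subseteq> upper_half_plane"
  shows "openin modular_topology (modular_orbit ` U)"
proof -
  have eq: "{z \<in> upper_half_plane. modular_orbit z \<in> modular_orbit ` U} = (\<Union>A\<in>SL2Z. upper_half_plane \<inter> SL2Z_act A -` U)"
  proof (intro equalityI subsetI)
    fix z assume "z \<in> {z \<in> upper_half_plane. modular_orbit z \<in> modular_orbit ` U}"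
    then obtain u where u: "z \<in> upper_half_plane" "u \<in> U" "modular_orbit z = modular_orbit u" by auto
    then have "u \<in> modular_orbit z" using self_in_modular_orbit by simp
    then obtain A where "A \<in> SL2Z" "u = SL2Z_act A z" unfolding modular_orbit_def by blast
    then show "z \<in> (\<Union>A\<in>SL2Z. upper_half_plane \<inter> SL2Z_act A -` U)" using u by auto
  next
    fix z assume "z \<in> (\<Union>A\<in>SL2Z. upper_half_plane \<inter> SL2Z_act A -` U)"
    then obtain A where "A \<in> SL2Z" "z \<in> upper_half_plane" "SL2Z_act A z \<in> U" by auto
    then show "z \<in> {z \<in> upper_half_plane. modular_orbit z \<in> modular_orbit ` U}"
      using modular_orbit_act[of A z] by (auto intro!: image_eqI[where x="SL2Z_act A z"])
  qed
  have "open (\<Union>A\<in>SL2Z. upper_half_plane \<inter> SL2Z_act A -` U)"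
    by (intro open_UN ballI continuous_open_preimage continuous_on_SL2Z_act open_upper_half_plane U)
  then have "openin (top_of_set upper_half_plane) (\<Union>A\<in>SL2Z. upper_half_plane \<inter> SL2Z_act A -` U)"
    by (subst openin_open_eq[OF open_upper_half_plane]) auto
  then show ?thesis
    unfolding openin_modular_topology eq using U(2) by (auto simp: modular_surface_def)
qed

text \<open>As the orbit map is open, images of small discs form an open cover of the support;
  finitely many suffice, and the union of the corresponding closed discs is compact and meets every
  orbit on which \<open>F\<close> is nonzero.\<close>

lemma compactly_supported_lift:
  assumes F: "compactly_supported F"
  obtains K where "compact K" "K \<subseteq> upper_half_plane"
    "\<And>z. z \<in> upper_half_plane \<Longrightarrow> F (modular_orbit z) \<noteq> 0 \<Longrightarrow> \<exists>A\<in>SL2Z. SL2Z_act A z \<in> K"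
proof -
  define S where "S = {p \<in> modular_surface. F p \<noteq> 0}"
  define P where "P = {(z, r). 0 < r \<and> cball z r \<subseteq> upper_half_plane}"
  define V where "V = (\<lambda>(z, r). modular_orbit ` ball z r)"
  have comp: "compactin modular_topology (modular_topology closure_of S)"
    using F by (simp add: compactly_supported_def S_def)
  have "openin modular_topology (V x)" if "x \<in> P" for x
    using that ball_subset_cball by (auto simp: P_def V_def intro!: openin_modular_orbit_image)
  moreover have "modular_topology closure_of S \<subseteq> \<Union>(V ` P)"
  proof
    fix p assume "p \<in> modular_topology closure_of S"
    then have "p \<in> modular_surface" using closure_of_subset_topspace[of modular_topology S] by auto
    then obtain z where z: "z \<in> upper_half_plane" "p = modular_orbit z" by (auto simp: modular_surface_def)
    then obtain r where r: "r > 0" "cball z r \<subseteq> upper_half_plane"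
      using open_upper_half_plane open_contains_cball by blast
    then have "(z, r) \<in> P" by (simp add: P_def)
    moreover have "p \<in> V (z, r)" using z r by (simp add: V_def)
    ultimately show "p \<in> \<Union>(V ` P)" by blast
  qed
  ultimately obtain \<F> where \<F>: "finite \<F>" "\<F> \<subseteq> V ` P" "modular_topology closure_of S \<subseteq> \<Union>\<F>"
    using comp unfolding compactin_def by (metis (no_types, lifting) imageE)
  then obtain Q where Q: "finite Q" "Q \<subseteq> P" "\<F> = V ` Q"
    using finite_subset_image by metis
  show ?thesis
  proof (rule that[of "\<Union>((\<lambda>(z, r). cball z r) ` Q)"])
    show "compact (\<Union>((\<lambda>(z, r). cball z r) ` Q))"
      using Q(1) by (intro compact_Union finite_imageI) auto
    show "\<Union>((\<lambda>(z, r). cball z r) ` Q) \<subseteq> upper_half_plane" using Q(2) by (auto simp: P_def)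
    fix z assume z: "z \<in> upper_half_plane" "F (modular_orbit z) \<noteq> 0"
    then have "modular_orbit z \<in> S" by (auto simp: S_def modular_surface_def)
    moreover have "S \<subseteq> modular_topology closure_of S" by (rule closure_of_subset) (auto simp: S_def)
    ultimately obtain x r where x: "(x, r) \<in> Q" "modular_orbit z \<in> modular_orbit ` ball x r"
      using \<F>(3) Q(3) by (auto simp: V_def)
    then obtain u where u: "u \<in> ball x r" "modular_orbit z = modular_orbit u" by auto
    then have "u \<in> modular_orbit z" using self_in_modular_orbit by simp
    then obtain A where A: "A \<in> SL2Z" "u = SL2Z_act A z" by (auto simp: modular_orbit_def)
    have "u \<in> \<Union>((\<lambda>(z, r). cball z r) ` Q)"
      using u(1) x(1) by (intro UN_I[of "(x, r)"]) auto
    then show "\<exists>A\<in>SL2Z. SL2Z_act A z \<in> \<Union>((\<lambda>(z, r). cball z r) ` Q)" using A by blast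
  qed
qed

text \<open>The stabilizer in SL_2(Z) is the disjoint union of the cosets {A, -A}, which have two
  elements each.\<close>

lemma card_SL2Z_stabilizer:
  assumes z: "z \<in> upper_half_plane"
  shows "finite {A \<in> SL2Z. SL2Z_act A z = z}"
    and "card {A \<in> SL2Z. SL2Z_act A z = z} = 2 * card (PSL2Z_stabilizer z)"
    and "card (PSL2Z_stabilizer z) > 0"
proof -
  let ?S = "{A \<in> SL2Z. SL2Z_act A z = z}"
  show fin: "finite ?S"
    by (rule finite_subset[OF _ SL2Z_properly_discontinuous[of "{z}" "{z}"]]) (use z in auto)
  have cosets: "PSL2Z = (\<lambda>A. {A, - A}) ` SL2Z"
    unfolding PSL2Z_def quotient_def by (auto simp: SL2Z_uminus)
  have stab: "PSL2Z_stabilizer z = (\<lambda>A. {A, - A}) ` ?S"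
    unfolding PSL2Z_stabilizer_def cosets by (auto simp: SL2Z_act_uminus)
  have union: "\<Union>(PSL2Z_stabilizer z) = ?S"
    unfolding stab by (auto simp: SL2Z_uminus SL2Z_act_uminus)
  have fin': "finite (PSL2Z_stabilizer z)" unfolding stab using fin by simp
  have "2 * card (PSL2Z_stabilizer z) = card (\<Union>(PSL2Z_stabilizer z))"
  proof (rule card_partition[OF fin'])
    show "finite (\<Union>(PSL2Z_stabilizer z))" using union fin by simp
    show "card C = 2" if "C \<in> PSL2Z_stabilizer z" for C
      using that SL2Z_neq_uminus unfolding stab by auto
    show "C \<inter> D = {}" if "C \<in> PSL2Z_stabilizer z" "D \<in> PSL2Z_stabilizer z" "C \<noteq> D" for C D
      using that unfolding stab by auto
  qed
  then show "card ?S = 2 * card (PSL2Z_stabilizer z)" using union by simp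
  have "mat 1 \<in> ?S" using SL2Z_one by simp
  then have "PSL2Z_stabilizer z \<noteq> {}" unfolding stab by blast
  then show "card (PSL2Z_stabilizer z) > 0" using fin' by (simp add: card_gt_0_iff)
qed

text \<open>The matrices carrying z to B z form the left coset of the stabilizer by
  \<open>B\<close>.\<close>

lemma card_SL2Z_transporter:
  assumes z: "z \<in> upper_half_plane" and B: "B \<in> SL2Z"
  shows "card {A \<in> SL2Z. SL2Z_act A z = SL2Z_act B z} = card {A \<in> SL2Z. SL2Z_act A z = z}"
proof (rule bij_betw_same_card[of "\<lambda>A. SL2Z_inv B ** A"], rule bij_betw_byWitness[where f'="\<lambda>A. B ** A"])
  show "\<forall>A\<in>{A \<in> SL2Z. SL2Z_act A z = SL2Z_act B z}. B ** (SL2Z_inv B ** A) = A"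
    using B by (simp add: matrix_mul_assoc)
  show "\<forall>A\<in>{A \<in> SL2Z. SL2Z_act A z = z}. SL2Z_inv B ** (B ** A) = A"
    using B by (simp add: matrix_mul_assoc)
  show "(\<lambda>A. SL2Z_inv B ** A) ` {A \<in> SL2Z. SL2Z_act A z = SL2Z_act B z} \<subseteq> {A \<in> SL2Z. SL2Z_act A z = z}"
    using SL2Z_act_mult[OF SL2Z_inv[OF B] _ z] SL2Z_act_inv(1)[OF B z] SL2Z_mult[OF SL2Z_inv[OF B]] by auto
  show "(\<lambda>A. B ** A) ` {A \<in> SL2Z. SL2Z_act A z = z} \<subseteq> {A \<in> SL2Z. SL2Z_act A z = SL2Z_act B z}"
    using SL2Z_act_mult[OF B _ z] SL2Z_mult[OF B] by auto
qed

text \<open>Each point of the orbit is reached by 2 #stabilizer matrices. The weights w(z) in the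
  zero count are exactly those that cancel this multiplicity, up to the factor 2.\<close>

lemma automorphize_orbit_sum:
  fixes \<psi> :: "complex \<Rightarrow> complex"
  assumes K: "compact K" "K \<subseteq> upper_half_plane" and supp: "\<And>z. z \<notin> K \<Longrightarrow> \<psi> z = 0" and z: "z \<in> upper_half_plane"
  shows "automorphize \<psi> z = 2 * of_nat (card (PSL2Z_stabilizer z)) * (\<Sum>w\<in>{w \<in> modular_orbit z. \<psi> w \<noteq> 0}. \<psi> w)"
proof -
  define T where "T = {A \<in> SL2Z. \<psi> (SL2Z_act A z) \<noteq> 0}"
  have fin: "finite T" unfolding T_def by (rule finite_support_SL2Z[OF K supp z])
  have img: "(\<lambda>A. SL2Z_act A z) ` T = {w \<in> modular_orbit z. \<psi> w \<noteq> 0}" by (auto simp: T_def modular_orbit_def)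
  have "automorphize \<psi> z = (\<Sum>w\<in>{w \<in> modular_orbit z. \<psi> w \<noteq> 0}. \<Sum>A\<in>{A \<in> T. SL2Z_act A z = w}. \<psi> (SL2Z_act A z))"
    unfolding automorphize_def T_def[symmetric] img[symmetric] by (rule sum.group[symmetric]) (use fin in auto)
  also have "\<dots> = (\<Sum>w\<in>{w \<in> modular_orbit z. \<psi> w \<noteq> 0}. 2 * of_nat (card (PSL2Z_stabilizer z)) * \<psi> w)"
  proof (rule sum.cong[OF refl])
    fix w assume "w \<in> {w \<in> modular_orbit z. \<psi> w \<noteq> 0}"
    then obtain B where B: "B \<in> SL2Z" "w = SL2Z_act B z" "\<psi> w \<noteq> 0" by (auto simp: modular_orbit_def)
    have "{A \<in> T. SL2Z_act A z = w} = {A \<in> SL2Z. SL2Z_act A z = SL2Z_act B z}" using B by (auto simp: T_def)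
    then have "card {A \<in> T. SL2Z_act A z = w} = 2 * card (PSL2Z_stabilizer z)"
      using card_SL2Z_transporter[OF z B(1)] card_SL2Z_stabilizer(2)[OF z] by simp
    then show "(\<Sum>A\<in>{A \<in> T. SL2Z_act A z = w}. \<psi> (SL2Z_act A z)) = 2 * of_nat (card (PSL2Z_stabilizer z)) * \<psi> w"
      by simp
  qed
  finally show ?thesis by (simp add: sum_distrib_left)
qed

subsection \<open>Cusp forms\<close>

text \<open>Automorphy writes the composition of \<open>f\<close> with \<open>A\<close> as j^k f
  near z. The factor j^k does not vanish, and A u - A z vanishes to order exactly 1 at u = z, so
  both sides have the order of \<open>f\<close> at the respective point.\<close>

lemma zorder_SL2Z_act:
  assumes f: "cusp_form k f" and nz: "\<exists>z\<in>upper_half_plane. f z \<noteq> 0"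
    and A: "A \<in> SL2Z" and z: "z \<in> upper_half_plane"
  shows "zorder f (SL2Z_act A z) = zorder f z"
proof -
  have hol: "f holomorphic_on upper_half_plane" using f by (simp add: cusp_form_def)
  have tr: "f (SL2Z_act A u) = automorphy A u ^ k * f u" if "u \<in> upper_half_plane" for u
    using f A that by (simp add: cusp_form_def automorphy_def)
  obtain z0 where z0: "z0 \<in> upper_half_plane" "f z0 \<noteq> 0" using nz by blast
  have ev: "eventually (\<lambda>u. f u \<noteq> 0) (at w)" if "w \<in> upper_half_plane" for w
    by (rule eventually_nonzero_at[OF hol open_upper_half_plane connected_upper_half_plane z0 that])
  have an: "f analytic_on {w}" if "w \<in> upper_half_plane" for w
    using hol open_upper_half_plane that analytic_at by blast
  have evH: "eventually (\<lambda>u. u \<in> upper_half_plane) (at z)"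
    using open_upper_half_plane z by (intro eventually_at_in_open')
  have actH: "SL2Z_act A holomorphic_on upper_half_plane"
    using SL2Z_act_has_derivative[OF A] by (meson field_differentiable_at_within field_differentiable_def holomorphic_on_def)
  have acta: "SL2Z_act A analytic_on {z}"
    using actH open_upper_half_plane z analytic_at by blast
  have "zorder (f \<circ> SL2Z_act A) z = zorder f (SL2Z_act A z) * zorder (\<lambda>u. SL2Z_act A u - SL2Z_act A z) z"
  proof (rule zorder_compose')
    have w: "SL2Z_act A z \<in> upper_half_plane" by (rule SL2Z_act_in[OF A z])
    show "isolated_singularity_at f (SL2Z_act A z)" using an[OF w] by (rule isolated_singularity_at_analytic)
    show "not_essential f (SL2Z_act A z)" using an[OF w] by (rule not_essential_analytic)
    show "eventually (\<lambda>u. SL2Z_act A u \<noteq> SL2Z_act A z) (at z)"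
      using evH eventually_neq_at_within[of z z UNIV]
    proof eventually_elim
      case (elim u)
      then show ?case using inj_on_SL2Z_act[OF A] z by (auto simp: inj_on_def)
    qed
  qed (use ev[OF SL2Z_act_in[OF A z]] acta in auto)
  also have "zorder (\<lambda>u. SL2Z_act A u - SL2Z_act A z) z = 1"
  \<comment> \<open>The cofactor comes from A u - A z = (u - z) / (j(u) j(z)), in which the
    determinant 1 has been used.\<close>
  proof (rule zorder_eqI[OF open_upper_half_plane z, of "\<lambda>u. 1 / (automorphy A u * automorphy A z)"])
    show "(\<lambda>u. 1 / (automorphy A u * automorphy A z)) holomorphic_on upper_half_plane"
      using automorphy_nonzero[OF A] z unfolding automorphy_def by (intro holomorphic_intros) auto
    show "1 / (automorphy A z * automorphy A z) \<noteq> 0" using automorphy_nonzero[OF A z] by simp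
    fix u assume u: "u \<in> upper_half_plane"
    define a b c d :: complex where "a = of_int (A $ 1 $ 1)" "b = of_int (A $ 1 $ 2)" "c = of_int (A $ 2 $ 1)" "d = of_int (A $ 2 $ 2)"
    have det: "a * d - b * c = 1"
      using A unfolding SL2Z_iff a_b_c_d_def of_int_mult[symmetric] of_int_diff[symmetric] by simp
    have n: "c * u + d \<noteq> 0" "c * z + d \<noteq> 0"
      using automorphy_nonzero[OF A u] automorphy_nonzero[OF A z] by (auto simp: automorphy_def a_b_c_d_def)
    have "(a * u + b) / (c * u + d) - (a * z + b) / (c * z + d) = ((a * d - b * c) * (u - z)) / ((c * u + d) * (c * z + d))"
      using n by (simp add: divide_simps) (simp add: algebra_simps)
    then have "(a * u + b) / (c * u + d) - (a * z + b) / (c * z + d) = (u - z) / ((c * u + d) * (c * z + d))"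
      by (simp only: det mult_1)
    then show "SL2Z_act A u - SL2Z_act A z = 1 / (automorphy A u * automorphy A z) * (u - z) powi 1"
      by (simp add: SL2Z_act_eq automorphy_def flip: a_b_c_d_def)
  qed
  finally have 1: "zorder (f \<circ> SL2Z_act A) z = zorder f (SL2Z_act A z)" by (simp only: mult_1_right)
  have "zorder (f \<circ> SL2Z_act A) z = zorder (\<lambda>u. automorphy A u ^ k * f u) z"
    by (rule zorder_cong) (use eventually_mono[OF evH tr] in auto)
  also have "\<dots> = zorder (\<lambda>u. automorphy A u ^ k) z + zorder f z"
  proof (rule zorder_times_analytic)
    show "(\<lambda>u. automorphy A u ^ k) analytic_on {z}"
      unfolding automorphy_def by (intro analytic_intros)
    show "eventually (\<lambda>u. automorphy A u ^ k * f u \<noteq> 0) (at z)"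
      using evH ev[OF z] by eventually_elim (use automorphy_nonzero[OF A] in auto)
  qed (rule an[OF z])
  also have "zorder (\<lambda>u. automorphy A u ^ k) z = 0"
    unfolding automorphy_def using automorphy_nonzero[OF A z]
    by (intro zorder_eq_0I analytic_intros) (auto simp: automorphy_def)
  finally show ?thesis unfolding 1 by simp
qed

text \<open>In the variable q the cusp is an isolated zero of \<open>g\<close>, so \<open>f\<close>
  has no zeros above some height; the part of the fundamental domain below that height is
  compact.\<close>

lemma finite_zero_orbits:
  assumes f: "cusp_form k f" and nz: "\<exists>z\<in>upper_half_plane. f z \<noteq> 0"
  shows "finite (zero_orbits f)"
proof -
  have hol: "f holomorphic_on upper_half_plane" using f by (simp add: cusp_form_def)
  obtain z0 where z0: "z0 \<in> upper_half_plane" "f z0 \<noteq> 0" using nz by blast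
  obtain g where g: "g holomorphic_on ball 0 1" "g 0 = 0"
    "\<And>z. z \<in> upper_half_plane \<Longrightarrow> f z = g (exp (2 * of_real pi * \<i> * z))"
    using f by (auto simp: cusp_form_def)
  have q: "cmod (exp (2 * of_real pi * \<i> * z)) = exp (- (2 * pi * Im z))" for z
    by (simp add: norm_exp_eq_Re)
  have q0: "exp (2 * of_real pi * \<i> * z0) \<in> ball 0 1"
    using Im_pos[OF z0(1)] by (simp add: q)
  have g0: "g (exp (2 * of_real pi * \<i> * z0)) \<noteq> 0" using z0 g(3) by simp
  have c0: "(0::complex) \<in> ball 0 1" by simp
  obtain r where r: "r > 0" "\<forall>q\<in>ball 0 r - {0}. g q \<noteq> 0"
    by (rule isolated_zeros[OF g(1) open_ball convex_connected[OF convex_ball] c0 g(2) q0 g0]) (use that in blast)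
  \<comment> \<open>|q| = exp (-2 pi Im z) <= exp (- Im z) < r as soon as Im z > - ln r; the factor
    2 pi is given away.\<close>
  define T where "T = - ln r"
  have big: "f z \<noteq> 0" if z: "z \<in> upper_half_plane" "Im z > T" for z
  proof -
    have "Im z \<le> 2 * pi * Im z" using Im_pos[OF z(1)] pi_gt3 mult_right_mono[of 1 "2 * pi" "Im z"] by simp
    then have "- (2 * pi * Im z) < ln r" using z(2) by (simp add: T_def)
    then have "exp (- (2 * pi * Im z)) < r" using r(1) by (metis exp_less_mono exp_ln)
    then have "exp (2 * of_real pi * \<i> * z) \<in> ball 0 r - {0}" by (simp add: q)
    then show ?thesis using r(2) g(3)[OF z(1)] by simp
  qed
  have "finite {z \<in> {z \<in> fundamental_domain. Im z \<le> T}. f z = 0}"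
  proof (cases "f constant_on upper_half_plane")
    case True
    then have "{z \<in> {z \<in> fundamental_domain. Im z \<le> T}. f z = 0} = {}"
      using z0 fundamental_domain_subset by (auto simp: constant_on_def)
    then show ?thesis by (metis finite.emptyI)
  next
    case False
    show ?thesis
      by (rule holomorphic_compact_finite_zeros[OF hol open_upper_half_plane connected_upper_half_plane compact_fundamental_domain_le _ False])
        (use fundamental_domain_subset in auto)
  qed
  moreover have "zero_orbits f \<subseteq> modular_orbit ` {z \<in> {z \<in> fundamental_domain. Im z \<le> T}. f z = 0}"
  proof
    fix p assume "p \<in> zero_orbits f"
    then have p: "p \<in> modular_surface" "f (orbit_rep p) = 0" by (auto simp: zero_orbits_def)
    note rep = modular_surface_rep[OF p(1)]
    obtain A where A: "A \<in> SL2Z" "SL2Z_act A (orbit_rep p) \<in> fundamental_domain"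
      by (rule exists_fundamental_domain_rep[OF rep(1)])
    have "f (SL2Z_act A (orbit_rep p)) = 0" using f A(1) rep(1) p(2) by (simp add: cusp_form_def)
    moreover have "Im (SL2Z_act A (orbit_rep p)) \<le> T"
      using big[OF SL2Z_act_in[OF A(1) rep(1)]] calculation by force
    moreover have "p = modular_orbit (SL2Z_act A (orbit_rep p))"
      using modular_orbit_act[OF A(1) rep(1)] rep(2) by simp
    ultimately show "p \<in> modular_orbit ` {z \<in> {z \<in> fundamental_domain. Im z \<le> T}. f z = 0}" using A by blast
  qed
  ultimately show ?thesis by (meson finite_imageI finite_subset)
qed

text \<open>The factor |j|^(2 k) gained by |f|^2 cancels the factor |j|^(-2 k) gained by the k-th
  power of the height.\<close>

lemma cusp_form_density_invariant:
  assumes f: "cusp_form k f" and A: "A \<in> SL2Z" and z: "z \<in> upper_half_plane"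
  shows "Im (SL2Z_act A z) ^ k * (cmod (f (SL2Z_act A z)))\<^sup>2 = Im z ^ k * (cmod (f z))\<^sup>2"
proof -
  have tr: "f (SL2Z_act A z) = automorphy A z ^ k * f z"
    using f A z by (simp add: cusp_form_def automorphy_def)
  have "cmod (automorphy A z) \<noteq> 0" using automorphy_nonzero[OF A z] by simp
  then show ?thesis
    unfolding tr Im_SL2Z_act[OF A] norm_mult norm_power power_mult_distrib power_divide
    by (simp add: power_mult[symmetric] mult.commute)
qed

lemma petersson_nonzero:
  assumes "petersson k f f = 1"
  shows "\<exists>z\<in>upper_half_plane. f z \<noteq> 0"
proof (rule ccontr)
  assume "\<not> (\<exists>z\<in>upper_half_plane. f z \<noteq> 0)"
  then have "(\<lambda>z. indicat_real fundamental_domain z *\<^sub>R (f z * cnj (f z) * of_real (Im z ^ k))) = (\<lambda>_. 0)"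
    using fundamental_domain_subset by (auto simp: indicator_def fun_eq_iff)
  then have "petersson k f f = 0" by (simp add: petersson_def set_lebesgue_integral_def)
  then show False using assms by simp
qed

text \<open>The multiplicity 2 #stabilizer of an orbit sum cancels against
  \<open>stabilizer_weight\<close>, and the order of \<open>f\<close> is constant along an orbit.
  What is left is twice the plain sum over zeros in the half-plane, where the local result
  applies.\<close>

lemma zero_orbits_sum:
  fixes \<psi> :: "complex \<Rightarrow> complex"
  assumes f: "cusp_form k f" and nz: "\<exists>z\<in>upper_half_plane. f z \<noteq> 0"
    and K: "compact K" "K \<subseteq> upper_half_plane" and supp: "\<And>z. z \<notin> K \<Longrightarrow> \<psi> z = 0"
    and F: "\<And>z. z \<in> upper_half_plane \<Longrightarrow> automorphize \<psi> z = F (modular_orbit z)"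
  shows "(\<Sum>p\<in>zero_orbits f. of_int (zorder f (orbit_rep p)) * (of_real (stabilizer_weight (orbit_rep p)) * F p)) =
     2 * (\<Sum>w\<in>{w \<in> K. f w = 0}. of_int (zorder f w) * \<psi> w)"
proof -
  have hol: "f holomorphic_on upper_half_plane" using f by (simp add: cusp_form_def)
  have fz: "f (SL2Z_act A z) = 0 \<longleftrightarrow> f z = 0" if "A \<in> SL2Z" "z \<in> upper_half_plane" for A z
    using f that automorphy_nonzero[OF that] by (simp add: cusp_form_def automorphy_def)
  obtain z0 where z0: "z0 \<in> upper_half_plane" "f z0 \<noteq> 0" using nz by blast
  have finK: "finite {w \<in> K. f w = 0}"
  proof (cases "f constant_on upper_half_plane")
    case True
    then have "{w \<in> K. f w = 0} = {}" using z0 K(2) by (auto simp: constant_on_def)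
    then show ?thesis by (metis finite.emptyI)
  qed (intro holomorphic_compact_finite_zeros[OF hol open_upper_half_plane connected_upper_half_plane] K)
  define Z where "Z = {w \<in> K. f w = 0 \<and> \<psi> w \<noteq> 0}"
  have fin: "finite Z" using finK by (rule finite_subset[rotated]) (auto simp: Z_def)
  have ZH: "w \<in> upper_half_plane" if "w \<in> Z" for w using that K(2) by (auto simp: Z_def)
  have img: "modular_orbit ` Z \<subseteq> zero_orbits f"
  proof
    fix p assume "p \<in> modular_orbit ` Z"
    then obtain w where w: "w \<in> Z" "p = modular_orbit w" by auto
    obtain A where A: "A \<in> SL2Z" "orbit_rep (modular_orbit w) = SL2Z_act A w" by (rule orbit_rep_modular_orbit)
    have "f (orbit_rep p) = 0" using fz[OF A(1) ZH[OF w(1)]] w A by (simp add: Z_def)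
    then show "p \<in> zero_orbits f" using w ZH by (auto simp: zero_orbits_def modular_surface_def)
  qed
  have one: "of_int (zorder f (orbit_rep p)) * (of_real (stabilizer_weight (orbit_rep p)) * F p) =
      2 * (\<Sum>w\<in>{w \<in> Z. modular_orbit w = p}. of_int (zorder f w) * \<psi> w)" if p: "p \<in> zero_orbits f" for p
  proof -
    have p': "p \<in> modular_surface" "f (orbit_rep p) = 0" using p by (auto simp: zero_orbits_def)
    note rep = modular_surface_rep[OF p'(1)]
    have set: "{w \<in> modular_orbit (orbit_rep p). \<psi> w \<noteq> 0} = {w \<in> Z. modular_orbit w = p}"
    proof (intro equalityI subsetI)
      fix w assume "w \<in> {w \<in> modular_orbit (orbit_rep p). \<psi> w \<noteq> 0}"
      then obtain A where A: "A \<in> SL2Z" "w = SL2Z_act A (orbit_rep p)" "\<psi> w \<noteq> 0" by (auto simp: modular_orbit_def)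
      then have "w \<in> K" using supp by blast
      moreover have "f w = 0" using fz[OF A(1) rep(1)] A p' by simp
      moreover have "modular_orbit w = p" using modular_orbit_act[OF A(1) rep(1)] A rep by simp
      ultimately show "w \<in> {w \<in> Z. modular_orbit w = p}" using A by (simp add: Z_def)
    next
      fix w assume "w \<in> {w \<in> Z. modular_orbit w = p}"
      then show "w \<in> {w \<in> modular_orbit (orbit_rep p). \<psi> w \<noteq> 0}"
        using self_in_modular_orbit[of w] rep by (auto simp: Z_def)
    qed
    have ord: "zorder f w = zorder f (orbit_rep p)" if "w \<in> {w \<in> Z. modular_orbit w = p}" for w
    proof -
      have "w \<in> modular_orbit (orbit_rep p)" using that set by blast
      then obtain A where "A \<in> SL2Z" "w = SL2Z_act A (orbit_rep p)" by (auto simp: modular_orbit_def)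
      then show ?thesis using zorder_SL2Z_act[OF f nz _ rep(1)] by simp
    qed
    have "F p = automorphize \<psi> (orbit_rep p)" using F[OF rep(1)] rep(2) by simp
    also have "\<dots> = 2 * of_nat (card (PSL2Z_stabilizer (orbit_rep p))) * (\<Sum>w\<in>{w \<in> Z. modular_orbit w = p}. \<psi> w)"
      unfolding set[symmetric] by (rule automorphize_orbit_sum[OF K supp rep(1)])
    finally have "of_real (stabilizer_weight (orbit_rep p)) * F p = 2 * (\<Sum>w\<in>{w \<in> Z. modular_orbit w = p}. \<psi> w)"
      using card_SL2Z_stabilizer(3)[OF rep(1)] by (simp add: stabilizer_weight_def)
    then show ?thesis using ord by (simp add: sum_distrib_left mult.left_commute)
  qed
  have "(\<Sum>p\<in>zero_orbits f. of_int (zorder f (orbit_rep p)) * (of_real (stabilizer_weight (orbit_rep p)) * F p)) =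
     (\<Sum>p\<in>zero_orbits f. 2 * (\<Sum>w\<in>{w \<in> Z. modular_orbit w = p}. of_int (zorder f w) * \<psi> w))"
    using one by (rule sum.cong[OF refl])
  also have "\<dots> = 2 * (\<Sum>w\<in>Z. of_int (zorder f w) * \<psi> w)"
    unfolding sum_distrib_left[symmetric] by (subst sum.group[OF fin finite_zero_orbits[OF f nz] img]) simp
  also have "(\<Sum>w\<in>Z. of_int (zorder f w) * \<psi> w) = (\<Sum>w\<in>{w \<in> K. f w = 0}. of_int (zorder f w) * \<psi> w)"
    by (rule sum.mono_neutral_left[OF finK]) (auto simp: Z_def)
  finally show ?thesis .
qed

text \<open>A partition of unity for the group: with a bump \<open>\<eta>\<close> equal to 1 on a
  lift \<open>K\<close> of the support, \<psi> is \<eta> F / S, where S is the orbit sum of \<eta>;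
  F and S are invariant and leave the sum. The \<open>max\<close> keeps the denominator away from 0;
  wherever F is nonzero, the orbit meets \<open>K\<close> and S >= 1, so there it changes
  nothing.\<close>

lemma lift_partition:
  assumes F: "continuous_on upper_half_plane (\<lambda>z. F (modular_orbit z))" "compactly_supported F"
  obtains \<psi> :: "complex \<Rightarrow> complex" and K where "continuous_on UNIV \<psi>" "compact K" "K \<subseteq> upper_half_plane"
    "\<And>z. z \<notin> K \<Longrightarrow> \<psi> z = 0" "\<And>z. z \<in> upper_half_plane \<Longrightarrow> automorphize \<psi> z = F (modular_orbit z)"
proof -
  obtain K where K: "compact K" "K \<subseteq> upper_half_plane"
    "\<And>z. z \<in> upper_half_plane \<Longrightarrow> F (modular_orbit z) \<noteq> 0 \<Longrightarrow> \<exists>A\<in>SL2Z. SL2Z_act A z \<in> K"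
    using compactly_supported_lift[OF F(2)] by metis
  obtain \<eta> :: "complex \<Rightarrow> real" and L where \<eta>: "continuous_on UNIV \<eta>" "\<And>z. 0 \<le> \<eta> z" "\<And>z. z \<in> K \<Longrightarrow> \<eta> z = 1"
    "compact L" "L \<subseteq> upper_half_plane" "\<And>z. z \<notin> L \<Longrightarrow> \<eta> z = 0"
    using bump_function[OF K(1) open_upper_half_plane K(2)] by metis
  define S where "S = automorphize \<eta>"
  have S: "continuous_on upper_half_plane S" unfolding S_def by (rule continuous_on_automorphize[OF \<eta>(1,4,5,6)])
  define \<psi> where "\<psi> = (\<lambda>z. of_real (\<eta> z) * (F (modular_orbit z) / of_real (max (S z) 1)))"
  show ?thesis
  proof (rule that[of \<psi> L])
    show supp: "\<psi> z = 0" if "z \<notin> L" for z using \<eta>(6)[OF that] by (simp add: \<psi>_def)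
    have "continuous_on upper_half_plane \<psi>"
      unfolding \<psi>_def by (intro continuous_intros S F(1) continuous_on_subset[OF \<eta>(1)]) auto
    moreover have "continuous_on (- L) \<psi>"
      using supp by (intro continuous_on_eq[OF continuous_on_const[of _ 0]]) auto
    moreover have "open (- L)" using compact_imp_closed[OF \<eta>(4)] by (rule open_Compl)
    ultimately have "continuous_on (upper_half_plane \<union> - L) \<psi>"
      using open_upper_half_plane by (intro continuous_on_open_Un)
    moreover have "upper_half_plane \<union> - L = UNIV" using \<eta>(5) by auto
    ultimately show "continuous_on UNIV \<psi>" by simp
    fix z assume z: "z \<in> upper_half_plane"
    define G where "G = {A \<in> SL2Z. \<eta> (SL2Z_act A z) \<noteq> 0}"
    have G: "finite G" unfolding G_def by (rule finite_support_SL2Z[OF \<eta>(4,5,6) z])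
    have "automorphize \<psi> z = (\<Sum>A\<in>G. \<psi> (SL2Z_act A z))"
      by (rule automorphize_eq[OF G]) (auto simp: G_def \<psi>_def)
    also have "\<dots> = (\<Sum>A\<in>G. of_real (\<eta> (SL2Z_act A z)) * (F (modular_orbit z) / of_real (max (S z) 1)))"
    proof (rule sum.cong[OF refl])
      fix A assume "A \<in> G"
      then have A: "A \<in> SL2Z" by (simp add: G_def)
      show "\<psi> (SL2Z_act A z) = of_real (\<eta> (SL2Z_act A z)) * (F (modular_orbit z) / of_real (max (S z) 1))"
        using automorphize_invariant[OF A z, of \<eta>] modular_orbit_act[OF A z] by (simp add: \<psi>_def S_def)
    qed
    also have "\<dots> = (\<Sum>A\<in>G. of_real (\<eta> (SL2Z_act A z))) * (F (modular_orbit z) / of_real (max (S z) 1))"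
      by (rule sum_distrib_right[symmetric])
    also have "(\<Sum>A\<in>G. of_real (\<eta> (SL2Z_act A z))) = complex_of_real (S z)"
      by (simp add: S_def automorphize_def G_def)
    also have "complex_of_real (S z) * (F (modular_orbit z) / of_real (max (S z) 1)) = F (modular_orbit z)"
    proof (cases "F (modular_orbit z) = 0")
      case False
      then obtain A where "A \<in> SL2Z" "SL2Z_act A z \<in> K" using K(3)[OF z] by auto
      then have "1 \<le> S z" unfolding S_def using \<eta>(3) by (intro automorphize_ge_one[OF \<eta>(4,5,6,2) z])
      then have "max (S z) 1 = S z" "complex_of_real (S z) \<noteq> 0" by auto
      then show ?thesis by simp
    qed simp
    finally show "automorphize \<psi> z = F (modular_orbit z)" .
  qed (use \<eta> in auto)
qed

section \<open>The limit theorem on the quotient\<close>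

lemma integral_modular_measure_cong:
  fixes g h :: "complex \<Rightarrow> complex"
  assumes "\<And>z. z \<in> upper_half_plane \<Longrightarrow> g z = h z"
  shows "(\<integral>z. g z \<partial>modular_measure) = (\<integral>z. h z \<partial>modular_measure)"
proof (rule Bochner_Integration.integral_cong[OF refl])
  fix z assume "z \<in> space modular_measure"
  then have "z \<in> fundamental_domain" by (simp add: modular_measure_def space_restrict_space)
  then show "g z = h z" using assms fundamental_domain_subset by blast
qed

theorem theorem2:
  fixes k :: "nat \<Rightarrow> nat" and f :: "nat \<Rightarrow> complex \<Rightarrow> complex" and c :: real
  assumes "filterlim k at_top sequentially"
    and "\<And>n. cusp_form (k n) (f n)"
    and "\<And>n. petersson (k n) (f n) (f n) = 1"
    and "(\<lambda>n. zero_count (f n)) \<sim>[sequentially] (\<lambda>n. real (k n) / 12)"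
    and "c > 0"
    and "\<And>G. G \<in> Cc_modular \<Longrightarrow>
      (\<lambda>n. \<integral>z. G (modular_orbit z) * of_real (Im z ^ k n * (cmod (f n z))\<^sup>2) \<partial>modular_measure)
        \<longlonglongrightarrow> of_real c * (\<integral>z. G (modular_orbit z) \<partial>modular_measure)"
  shows "\<forall>F\<in>Cc_smooth_modular.
      (\<lambda>n. 1 / of_real (zero_count (f n)) *
         (\<Sum>p\<in>zero_orbits (f n). of_int (zorder (f n) (orbit_rep p)) *
            (of_real (stabilizer_weight (orbit_rep p)) * F p)))
        \<longlonglongrightarrow> (\<integral>z. F (modular_orbit z) \<partial>modular_measure)"
proof
  fix F assume "F \<in> Cc_smooth_modular"
  then have F: "continuous_on upper_half_plane (\<lambda>z. F (modular_orbit z))" "compactly_supported F"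
    unfolding Cc_smooth_modular_def mem_Collect_eq by (metis higher_differentiable_on.simps(1), blast)
  have nz: "\<exists>z\<in>upper_half_plane. f n z \<noteq> 0" for n using petersson_nonzero assms(3) by blast
  have hol: "f n holomorphic_on upper_half_plane" for n using assms(2) by (simp add: cusp_form_def)
  interpret equidistributed_mass k f c
  proof
    fix \<eta> :: "complex \<Rightarrow> real" and K
    assume \<eta>: "continuous_on UNIV \<eta>" and K: "compact K" "K \<subseteq> upper_half_plane" and supp: "\<And>z. z \<notin> K \<Longrightarrow> \<eta> z = 0"
    \<comment> \<open>The factor y^2 cancels the density 1 / y^2 produced by unfolding, so that the
      limit is taken against Lebesgue measure.\<close>
    define \<psi> where "\<psi> = (\<lambda>z. complex_of_real (\<eta> z * (Im z)\<^sup>2))"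
    have \<psi>: "continuous_on UNIV \<psi>" unfolding \<psi>_def by (intro continuous_intros \<eta>)
    have supp': "\<psi> z = 0" if "z \<notin> K" for z using supp[OF that] by (simp add: \<psi>_def)
    define G where "G = descend (automorphize \<psi>)"
    have G: "G \<in> Cc_modular" unfolding G_def by (rule Cc_modular_automorphize[OF \<psi> K supp'])
    have GP: "G (modular_orbit z) = automorphize \<psi> z" if "z \<in> upper_half_plane" for z
      unfolding G_def by (rule descend_modular_orbit) (rule automorphize_invariant[OF _ that])
    \<comment> \<open>Used twice: with the density of \<open>f n\<close> as \<Phi>, and with the
      constant 1 for the limit.\<close>
    have unfold: "(\<integral>z. G (modular_orbit z) * of_real (\<Phi> z) \<partial>modular_measure) = of_real (6 / pi * (LINT z|lborel. \<eta> z * \<Phi> z))"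
      if "continuous_on upper_half_plane \<Phi>" "\<And>A z. A \<in> SL2Z \<Longrightarrow> z \<in> upper_half_plane \<Longrightarrow> \<Phi> (SL2Z_act A z) = \<Phi> z" for \<Phi>
    proof -
      have "(\<integral>z. G (modular_orbit z) * of_real (\<Phi> z) \<partial>modular_measure) = (\<integral>z. automorphize \<psi> z * of_real (\<Phi> z) \<partial>modular_measure)"
        by (rule integral_modular_measure_cong) (simp add: GP)
      also have "\<dots> = of_real (6 / pi) * (\<integral>z. \<psi> z * of_real (\<Phi> z / (Im z)\<^sup>2) \<partial>lborel)"
        by (rule unfolding_integral[OF \<psi> K supp' that])
      also have "(\<lambda>z. \<psi> z * of_real (\<Phi> z / (Im z)\<^sup>2)) = (\<lambda>z. complex_of_real (\<eta> z * \<Phi> z))"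
      proof
        fix z
        show "\<psi> z * of_real (\<Phi> z / (Im z)\<^sup>2) = complex_of_real (\<eta> z * \<Phi> z)"
        proof (cases "z \<in> K")
          case True
          then have "Im z \<noteq> 0" using K(2) Im_pos[of z] by auto
          then show ?thesis by (simp add: \<psi>_def)
        qed (simp add: supp \<psi>_def)
      qed
      also have "(\<integral>z. complex_of_real (\<eta> z * \<Phi> z) \<partial>lborel) = of_real (LINT z|lborel. \<eta> z * \<Phi> z)"
        by (rule integral_complex_of_real)
      finally show ?thesis by simp
    qed
    have "(\<lambda>n. \<integral>z. G (modular_orbit z) * of_real (Im z ^ k n * (cmod (f n z))\<^sup>2) \<partial>modular_measure)
        \<longlonglongrightarrow> of_real c * (\<integral>z. G (modular_orbit z) * of_real 1 \<partial>modular_measure)"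
      using assms(6)[OF G] by simp
    moreover have "(\<integral>z. G (modular_orbit z) * of_real (Im z ^ k n * (cmod (f n z))\<^sup>2) \<partial>modular_measure) =
        of_real (6 / pi * (LINT z|lborel. \<eta> z * (Im z ^ k n * (cmod (f n z))\<^sup>2)))" for n
      by (rule unfold) (auto intro!: continuous_intros holomorphic_on_imp_continuous_on hol cusp_form_density_invariant assms(2))
    moreover have "(\<integral>z. G (modular_orbit z) * of_real 1 \<partial>modular_measure) = of_real (6 / pi * (LINT z|lborel. \<eta> z * 1))"
      by (rule unfold) auto
    ultimately have "(\<lambda>n. complex_of_real (6 / pi * (LINT z|lborel. \<eta> z * (Im z ^ k n * (cmod (f n z))\<^sup>2))))
        \<longlonglongrightarrow> complex_of_real (c * (6 / pi * (LINT z|lborel. \<eta> z)))" by simp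
    then have "(\<lambda>n. 6 / pi * (LINT z|lborel. \<eta> z * (Im z ^ k n * (cmod (f n z))\<^sup>2))) \<longlonglongrightarrow> c * (6 / pi * (LINT z|lborel. \<eta> z))"
      by (simp only: tendsto_of_real_iff)
    from tendsto_mult[OF tendsto_const[of "pi / 6"] this]
    show "(\<lambda>n. LINT z|lborel. \<eta> z * (Im z ^ k n * (cmod (f n z))\<^sup>2)) \<longlonglongrightarrow> c * (LINT z|lborel. \<eta> z)"
      by (simp add: mult.left_commute)
  qed (use assms(1,5) hol nz in auto)
  obtain \<psi> K where \<psi>: "continuous_on UNIV \<psi>" and K: "compact K" "K \<subseteq> upper_half_plane"
    and supp: "\<And>z. z \<notin> K \<Longrightarrow> \<psi> z = (0::complex)"
    and lift: "\<And>z. z \<in> upper_half_plane \<Longrightarrow> automorphize \<psi> z = F (modular_orbit z)"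
    using lift_partition[OF F] by metis
  define J where "J = (\<integral>z. \<psi> z * of_real (1 / (Im z)\<^sup>2) \<partial>lborel)"
  have int: "integrable lborel (\<lambda>z. \<psi> z * of_real (1 / (Im z)\<^sup>2))"
  proof -
    have "integrable lborel (\<lambda>z. indicator K z *\<^sub>R (\<psi> z * of_real (1 / (Im z)\<^sup>2)))"
      by (intro borel_integrable_compact K(1) continuous_intros continuous_on_subset[OF \<psi>])
        (use K(2) in \<open>auto simp: upper_half_plane_def\<close>)
    also have "(\<lambda>z. indicator K z *\<^sub>R (\<psi> z * of_real (1 / (Im z)\<^sup>2))) = (\<lambda>z. \<psi> z * of_real (1 / (Im z)\<^sup>2))"
      using supp by (auto simp: indicator_def fun_eq_iff)
    finally show ?thesis .
  qed
  define X where "X = (\<lambda>n. (\<Sum>w\<in>{w \<in> K. f n w = 0}. of_int (zorder (f n) w) * \<psi> w))"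
  \<comment> \<open>Equidistribution on the half-plane is stated for real test functions and is
    applied to the real and imaginary parts of \<open>\<psi>\<close>.\<close>
  have lim: "(\<lambda>n. X n / of_nat (k n)) \<longlonglongrightarrow> J / of_real (4 * pi)"
    unfolding tendsto_complex_iff
  proof
    have "(\<lambda>n. (\<Sum>w\<in>{w \<in> K. f n w = 0}. zorder (f n) w * Re (\<psi> w)) / k n) \<longlonglongrightarrow> (LINT z|lborel. Re (\<psi> z) / (Im z)\<^sup>2) / (4 * pi)"
      by (rule zeros_equidistributed[OF _ K]) (use supp in \<open>auto intro!: continuous_intros \<psi>\<close>)
    moreover have "(LINT z|lborel. Re (\<psi> z) / (Im z)\<^sup>2) = Re J"
      unfolding J_def integral_Re[OF int, symmetric] by simp
    ultimately show "(\<lambda>n. Re (X n / of_nat (k n))) \<longlonglongrightarrow> Re (J / of_real (4 * pi))"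
      by (simp only: Re_divide_of_nat Re_divide_of_real) (simp add: X_def)
    have "(\<lambda>n. (\<Sum>w\<in>{w \<in> K. f n w = 0}. zorder (f n) w * Im (\<psi> w)) / k n) \<longlonglongrightarrow> (LINT z|lborel. Im (\<psi> z) / (Im z)\<^sup>2) / (4 * pi)"
      by (rule zeros_equidistributed[OF _ K]) (use supp in \<open>auto intro!: continuous_intros \<psi>\<close>)
    moreover have "(LINT z|lborel. Im (\<psi> z) / (Im z)\<^sup>2) = Im J"
      unfolding J_def integral_Im[OF int, symmetric] by simp
    ultimately show "(\<lambda>n. Im (X n / of_nat (k n))) \<longlonglongrightarrow> Im (J / of_real (4 * pi))"
      by (simp only: Im_divide_of_nat Im_divide_of_real) (simp add: X_def)
  qed
  \<comment> \<open>Asymptotic equivalence sets the quotient 0 / 0 to 1; for large n the weight is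
    positive and the plain quotient remains.\<close>
  have "(\<lambda>n. zero_count (f n) / (real (k n) / 12)) \<longlonglongrightarrow> 1"
  proof (rule Lim_transform_eventually)
    show "(\<lambda>n. if zero_count (f n) = 0 \<and> real (k n) / 12 = 0 then 1 else zero_count (f n) / (real (k n) / 12)) \<longlonglongrightarrow> 1"
      using assms(4) by (simp add: asymp_equiv_def)
  qed (use weight_pos in \<open>eventually_elim, auto\<close>)
  \<comment> \<open>For positive weight this is k / \<open>zero_count\<close>, with limit
    12.\<close>
  then have "(\<lambda>n. complex_of_real (12 * inverse (zero_count (f n) / (real (k n) / 12)))) \<longlonglongrightarrow> of_real (12 * inverse 1)"
    by (intro tendsto_intros) auto
  from tendsto_mult[OF this tendsto_mult[OF tendsto_const[of 2] lim]]
  have "(\<lambda>n. complex_of_real (12 * inverse (zero_count (f n) / (real (k n) / 12))) * (2 * (X n / of_nat (k n))))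
      \<longlonglongrightarrow> of_real (12 * inverse 1) * (2 * (J / of_real (4 * pi)))" .
  \<comment> \<open>12 * 2 / (4 pi) = 6 / pi is the constant of the unfolding formula, so the limit
    of the zero sums is the normalized integral of \<open>F\<close>.\<close>
  also have "of_real (12 * inverse 1) * (2 * (J / of_real (4 * pi))) = of_real (6 / pi) * J"
    by (simp add: field_simps)
  also have "of_real (6 / pi) * J = (\<integral>z. automorphize \<psi> z * of_real 1 \<partial>modular_measure)"
    unfolding J_def by (rule unfolding_integral[OF \<psi> K supp, symmetric]) auto
  also have "\<dots> = (\<integral>z. F (modular_orbit z) \<partial>modular_measure)"
    by (rule integral_modular_measure_cong) (simp add: lift)
  finally have main: "(\<lambda>n. complex_of_real (12 * inverse (zero_count (f n) / (real (k n) / 12))) * (2 * (X n / of_nat (k n))))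
      \<longlonglongrightarrow> (\<integral>z. F (modular_orbit z) \<partial>modular_measure)" .
  have sum: "(\<Sum>p\<in>zero_orbits (f n). of_int (zorder (f n) (orbit_rep p)) * (of_real (stabilizer_weight (orbit_rep p)) * F p)) = 2 * X n" for n
    unfolding X_def by (rule zero_orbits_sum[OF assms(2) nz K supp lift])
  show "(\<lambda>n. 1 / of_real (zero_count (f n)) *
         (\<Sum>p\<in>zero_orbits (f n). of_int (zorder (f n) (orbit_rep p)) *
            (of_real (stabilizer_weight (orbit_rep p)) * F p)))
        \<longlonglongrightarrow> (\<integral>z. F (modular_orbit z) \<partial>modular_measure)"
    unfolding sum
  proof (rule Lim_transform_eventually[OF main])
    show "\<forall>\<^sub>F n in sequentially. complex_of_real (12 * inverse (zero_count (f n) / (real (k n) / 12))) * (2 * (X n / of_nat (k n))) =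
        1 / of_real (zero_count (f n)) * (2 * X n)"
      using weight_pos by eventually_elim (simp add: field_simps)
  qed
qed

end
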